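(* Let $X$ be a binary curve of genus $g\ge1$ and let $0\le d\le 2g$. 1. For every balanced multidegree $\underline d$ on $X$ with $|\underline d|=d$ and every $L\in\operatorname{Pic}^{\underline d}X$ we have $h^0(X,L)\le d/2+1$. If $d=0$ and $h^0(X,L)=1$ then $L=\mathcal O_X$; if $d=2g-2$ and $h^0(X,L)=g$ then $L=\omega_X$. 2. If $g\ge2$, for every $[\widehat L]\in\overline{P^d_X}$ we have $h^0(\widehat L)\le d/2+1$.
   Context: Work over an algebraically closed field. A binary curve of genus $g$ is a reduced nodal curve $X=C_1\cup C_2$ with $C_1\cong C_2\cong\mathbb P^1$ and $\#(C_1\cap C_2)=g+1$ ($g\ge-1$ is the arithmetic genus). A multidegree $\underline d=(d_1,d_2)$ with $|\underline d|=d_1+d_2=d$ is balanced on a binary curve of genus $g$ if $\frac{d-g-1}{2}\le d_i\le\frac{d+g+1}{2}$ for $i=1,2$, strictly balanced if the inequalities are strict; a line bundle is (strictly) balanced if its multidegree is. $\operatorname{Pic}^{\underline d}X$ denotes line bundles of multidegree $\underline d$; $\omega_X$ is the dualizing sheaf. For $S\subset X_{\mathrm{sing}}$ let $Y_S$ be the normalization of $X$ at the nodes in $S$ (a binary curve of genus $g-\#S$), and let $\widehat X_S=Y_S\cup E_1\cup\dots\cup E_{\#S}$ be the blow-up of $X$ at $S$: each $E_i\cong\mathbb P^1$ is attached to $Y_S$ at the two points lying over a node of $S$. A line bundle $\widehat L$ of degree $d$ on $\widehat X_S$ is (strictly) balanced if it has degree $1$ on each $E_i$ and its restriction to $Y_S$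 is (strictly) balanced on $Y_S$; two such line bundles are equivalent if their restrictions to $Y_S$ are isomorphic. The compactified Picard variety $\overline{P^d_X}$ (for $g\ge 2$) has as points the equivalence classes $[\widehat L]$ of strictly balanced line bundles of degree $d$ on the curves $\widehat X_S$, $S\subset X_{\mathrm{sing}}$ (equivalently pairs $[M,S]$, $M=\widehat L|_{Y_S}$), together with, when $m:=\frac{d-g-1}{2}\in\mathbb Z$, one additional point $\ell_0$, given by $S=X_{\mathrm{sing}}$ and $M=(\mathcal O_{\mathbb P^1}(m),\mathcal O_{\mathbb P^1}(m))$ on $C_1\sqcup C_2$. For a point $[\widehat L]=[M,S]$, $h^0(\widehat L)=h^0(\widehat X_S,\widehat L)=h^0(Y_S,M)$, which does not depend on the representative. *)

theory Defs
  imports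
    "HOL-Analysis.Abstract_Topology"
    "HOL-Computational_Algebra.Polynomial"
    "HOL-Library.Extended_Real"
    "HOL-Library.Function_Algebras"
begin

section \<open>Spaces with functions\<close>

text \<open>
  A reduced scheme of finite type over an algebraically closed field \<open>k\<close> is given by its
  \<open>k\<close>-points, their Zariski topology, and the sheaf of \<open>k\<close>-valued regular functions.
  Functions on \<open>U\<close> are total functions vanishing outside \<open>U\<close>, so that two functions
  agreeing on \<open>U\<close> are equal.
\<close>

record ('p, 'k) fspace =
  zar :: "'p topology"
  reg :: "'p set \<Rightarrow> ('p \<Rightarrow> 'k) set"

abbreviation pts :: "('p, 'k, 'z) fspace_scheme \<Rightarrow> 'p set"
  where "pts X \<equiv> topspace (zar X)"

definition cut :: "'p set \<Rightarrow> ('p \<Rightarrow> 'k::zero) \<Rightarrow> 'p \<Rightarrow> 'k"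
  where "cut U f = (\<lambda>x. if x \<in> U then f x else 0)"

definition space_with_functions :: "('p, 'k::field) fspace \<Rightarrow> bool"
  where "space_with_functions X \<longleftrightarrow>
    (\<forall>U. openin (zar X) U \<longrightarrow>
        (\<forall>f\<in>reg X U. cut U f = f)
      \<and> (\<forall>c. cut U (\<lambda>_. c) \<in> reg X U)
      \<and> (\<forall>f\<in>reg X U. \<forall>h\<in>reg X U. f + h \<in> reg X U \<and> f * h \<in> reg X U)
      \<and> (\<forall>V f. openin (zar X) V \<and> V \<subseteq> U \<and> f \<in> reg X U \<longrightarrow> cut V f \<in> reg X V)
      \<and> (\<forall>f\<in>reg X U. openin (zar X) {x \<in> U. f x \<noteq> 0}
            \<and> (\<lambda>x. inverse (f x)) \<in> reg X {x \<in> U. f x \<noteq> 0}))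
  \<and> (\<forall>\<U> f. (\<forall>U\<in>\<U>. openin (zar X) U \<and> cut U f \<in> reg X U) \<longrightarrow> cut (\<Union>\<U>) f \<in> reg X (\<Union>\<U>))"

definition closed_immersion ::
    "('q, 'k::zero) fspace \<Rightarrow> ('p, 'k) fspace \<Rightarrow> ('q \<Rightarrow> 'p) \<Rightarrow> bool"
  where "closed_immersion Y X \<phi> \<longleftrightarrow>
    embedding_map (zar Y) (zar X) \<phi> \<and> closedin (zar X) (\<phi> ` pts Y)
  \<and> (\<forall>U f. openin (zar X) U \<and> f \<in> reg X U \<longrightarrow>
        cut (pts Y) (\<lambda>y. f (\<phi> y)) \<in> reg Y {y \<in> pts Y. \<phi> y \<in> U})
  \<and> (\<forall>V g y. openin (zar Y) V \<and> g \<in> reg Y V \<and> y \<in> V \<longrightarrow>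
        (\<exists>U f. openin (zar X) U \<and> \<phi> y \<in> U \<and> f \<in> reg X U \<and>
           (\<forall>z\<in>V. \<phi> z \<in> U \<longrightarrow> f (\<phi> z) = g z)))"


section \<open>The projective line\<close>

datatype 'k proj_line = Aff 'k | Infty

definition cofinite_topology :: "'a topology"
  where "cofinite_topology = topology (\<lambda>U. U = {} \<or> finite (- U))"

lemma openin_cofinite_topology: "openin cofinite_topology U \<longleftrightarrow> U = {} \<or> finite (- U)"
proof -
  have "istopology (\<lambda>U::'a set. U = {} \<or> finite (- U))"
    unfolding istopology_def
  proof (intro conjI allI impI)
    fix S T :: "'a set"
    assume "S = {} \<or> finite (- S)" "T = {} \<or> finite (- T)"
    then show "S \<inter> T = {} \<or> finite (- (S \<inter> T))" by auto
  next
    fix \<K> :: "'a set set"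
    assume *: "\<forall>K\<in>\<K>. K = {} \<or> finite (- K)"
    show "\<Union>\<K> = {} \<or> finite (- \<Union>\<K>)"
    proof (cases "\<Union>\<K> = {}")
      case False
      then obtain K where "K \<in> \<K>" "K \<noteq> {}" by auto
      with * have "finite (- K)" by auto
      moreover have "- \<Union>\<K> \<subseteq> - K" using \<open>K \<in> \<K>\<close> by auto
      ultimately show ?thesis using finite_subset by blast
    qed simp
  qed
  then show ?thesis by (simp add: cofinite_topology_def)
qed

text \<open>
  A polynomial \<open>p\<close> of degree at most \<open>n\<close> stands for the binary form
  \<open>\<Sum>i\<le>n. coeff p i * x ^ i * y ^ (n - i)\<close>; it is evaluated at \<open>(t, 1)\<close> and, for
  the point at infinity, at \<open>(1, 0)\<close>.
\<close>

fun form_eval :: "nat \<Rightarrow> 'k::comm_ring_1 poly \<Rightarrow> 'k proj_line \<Rightarrow> 'k"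
  where
    "form_eval n p (Aff t) = poly p t"
  | "form_eval n p Infty = coeff p n"

definition proj_reg :: "'k::field proj_line set \<Rightarrow> ('k proj_line \<Rightarrow> 'k) set"
  where "proj_reg U = {f. cut U f = f \<and>
    (\<forall>x\<in>U. \<exists>V n p q. openin cofinite_topology V \<and> x \<in> V \<and> V \<subseteq> U \<and>
       degree p \<le> n \<and> degree q \<le> n \<and>
       (\<forall>y\<in>V. form_eval n q y \<noteq> 0 \<and> f y = form_eval n p y / form_eval n q y))}"

definition P1 :: "('k::field proj_line, 'k) fspace"
  where "P1 = \<lparr>zar = cofinite_topology, reg = proj_reg\<rparr>"

text \<open>
  A local parameter at \<open>x\<close> (first argument): \<open>t - a\<close> at a finite point \<open>a\<close>, and \<open>1 / t\<close> at
  infinity. Only its values near \<open>x\<close> matter.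
\<close>

fun local_param :: "'k::field proj_line \<Rightarrow> 'k proj_line \<Rightarrow> 'k"
  where
    "local_param (Aff a) (Aff t) = t - a"
  | "local_param (Aff a) Infty = 1"
  | "local_param Infty (Aff t) = inverse t"
  | "local_param Infty Infty = 0"

text \<open>The rational function \<open>h\<close>, regular on a punctured neighbourhood of \<open>x\<close>, has order \<open>n\<close> at \<open>x\<close>.\<close>

definition has_order :: "('k::field proj_line \<Rightarrow> 'k) \<Rightarrow> 'k proj_line \<Rightarrow> int \<Rightarrow> bool"
  where "has_order h x n \<longleftrightarrow>
    (\<exists>W u. openin cofinite_topology W \<and> x \<in> W \<and> u \<in> proj_reg W \<and> (\<forall>y\<in>W. u y \<noteq> 0) \<and>
       (\<forall>y\<in>W - {x}. h y = u y * local_param x y powi n))"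


section \<open>Invertible sheaves\<close>

text \<open>
  Sheaves of modules. Addition and zero of all section modules come from the type \<open>'m\<close>, which is no
  restriction up to isomorphism: the groups of sections over the various open sets embed into
  their direct sum.
\<close>

record ('p, 'k, 'm) mod_sheaf =
  sec :: "'p set \<Rightarrow> 'm set"
  smul :: "'p set \<Rightarrow> ('p \<Rightarrow> 'k) \<Rightarrow> 'm \<Rightarrow> 'm"
  res :: "'p set \<Rightarrow> 'p set \<Rightarrow> 'm \<Rightarrow> 'm"

definition module_sheaf :: "('p, 'k::field) fspace \<Rightarrow> ('p, 'k, 'm::ab_group_add) mod_sheaf \<Rightarrow> bool"
  where "module_sheaf X L \<longleftrightarrow>
    (\<forall>U. openin (zar X) U \<longrightarrow>
        0 \<in> sec L U
      \<and> (\<forall>s\<in>sec L U. - s \<in> sec L U)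
      \<and> (\<forall>s\<in>sec L U. \<forall>t\<in>sec L U. s + t \<in> sec L U)
      \<and> (\<forall>f\<in>reg X U. \<forall>s\<in>sec L U. smul L U f s \<in> sec L U)
      \<and> (\<forall>f\<in>reg X U. \<forall>s\<in>sec L U. \<forall>t\<in>sec L U.
            smul L U f (s + t) = smul L U f s + smul L U f t)
      \<and> (\<forall>f\<in>reg X U. \<forall>h\<in>reg X U. \<forall>s\<in>sec L U.
            smul L U (f + h) s = smul L U f s + smul L U h s
          \<and> smul L U (f * h) s = smul L U f (smul L U h s))
      \<and> (\<forall>s\<in>sec L U. smul L U (cut U 1) s = s))
  \<and> (\<forall>U V. openin (zar X) U \<and> openin (zar X) V \<and> V \<subseteq> U \<longrightarrow>
        (\<forall>s\<in>sec L U. res L U V s \<in> sec L V)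
      \<and> (\<forall>s\<in>sec L U. \<forall>t\<in>sec L U. res L U V (s + t) = res L U V s + res L U V t)
      \<and> (\<forall>f\<in>reg X U. \<forall>s\<in>sec L U. res L U V (smul L U f s) = smul L V (cut V f) (res L U V s)))
  \<and> (\<forall>U. openin (zar X) U \<longrightarrow> (\<forall>s\<in>sec L U. res L U U s = s))
  \<and> (\<forall>U V W. openin (zar X) U \<and> openin (zar X) V \<and> openin (zar X) W \<and> W \<subseteq> V \<and> V \<subseteq> U \<longrightarrow>
        (\<forall>s\<in>sec L U. res L V W (res L U V s) = res L U W s))
  \<and> (\<forall>\<U> \<sigma>. (\<forall>U\<in>\<U>. openin (zar X) U \<and> \<sigma> U \<in> sec L U) \<and>
        (\<forall>U\<in>\<U>. \<forall>V\<in>\<U>. res L U (U \<inter> V) (\<sigma> U) = res L V (U \<inter> V) (\<sigma> V)) \<longrightarrow>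
        (\<exists>!s. s \<in> sec L (\<Union>\<U>) \<and> (\<forall>U\<in>\<U>. res L (\<Union>\<U>) U s = \<sigma> U)))"

text \<open>The section \<open>e\<close> over \<open>U\<close> defines an isomorphism from the structure sheaf to \<open>L\<close> over \<open>U\<close>.\<close>

definition generator ::
    "('p, 'k::field) fspace \<Rightarrow> ('p, 'k, 'm::ab_group_add) mod_sheaf \<Rightarrow> 'p set \<Rightarrow> 'm \<Rightarrow> bool"
  where "generator X L U e \<longleftrightarrow> e \<in> sec L U \<and>
    (\<forall>V. openin (zar X) V \<and> V \<subseteq> U \<longrightarrow>
       bij_betw (\<lambda>f. smul L V f (res L U V e)) (reg X V) (sec L V))"

definition invertible_sheaf ::
    "('p, 'k::field) fspace \<Rightarrow> ('p, 'k, 'm::ab_group_add) mod_sheaf \<Rightarrow> bool"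
  where "invertible_sheaf X L \<longleftrightarrow> module_sheaf X L \<and>
    (\<forall>x\<in>pts X. \<exists>U e. openin (zar X) U \<and> x \<in> U \<and> generator X L U e)"

definition sheaf_iso ::
    "('p, 'k::field) fspace \<Rightarrow> ('p, 'k, 'm::ab_group_add) mod_sheaf \<Rightarrow>
     ('p, 'k, 'n::ab_group_add) mod_sheaf \<Rightarrow> bool"
  where "sheaf_iso X L M \<longleftrightarrow> (\<exists>\<theta>.
    (\<forall>U. openin (zar X) U \<longrightarrow>
        bij_betw (\<theta> U) (sec L U) (sec M U)
      \<and> (\<forall>s\<in>sec L U. \<forall>t\<in>sec L U. \<theta> U (s + t) = \<theta> U s + \<theta> U t)
      \<and> (\<forall>f\<in>reg X U. \<forall>s\<in>sec L U. \<theta> U (smul L U f s) = smul M U f (\<theta> U s)))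
  \<and> (\<forall>U V. openin (zar X) U \<and> openin (zar X) V \<and> V \<subseteq> U \<longrightarrow>
        (\<forall>s\<in>sec L U. \<theta> V (res L U V s) = res M U V (\<theta> U s))))"

definition structure_sheaf :: "('p, 'k::field) fspace \<Rightarrow> ('p, 'k, 'p \<Rightarrow> 'k) mod_sheaf"
  where "structure_sheaf X = \<lparr>sec = reg X, smul = (\<lambda>U f s. f * s), res = (\<lambda>U V s. cut V s)\<rparr>"

text \<open>
  The dimension over \<open>k\<close> of the space of global sections, as an extended natural number: it is
  infinite if there are arbitrarily large independent sets of sections.
\<close>

definition independent_sections ::
    "('p, 'k::field) fspace \<Rightarrow> ('p, 'k, 'm::ab_group_add) mod_sheaf \<Rightarrow> 'm set \<Rightarrow> bool"
  where "independent_sections X L B \<longleftrightarrow> finite B \<and> B \<subseteq> sec L (pts X) \<and>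
    (\<forall>c. (\<Sum>b\<in>B. smul L (pts X) (cut (pts X) (\<lambda>_. c b)) b) = 0 \<longrightarrow> (\<forall>b\<in>B. c b = 0))"

definition h0 :: "('p, 'k::field) fspace \<Rightarrow> ('p, 'k, 'm::ab_group_add) mod_sheaf \<Rightarrow> enat"
  where "h0 X L = (SUP B\<in>{B. independent_sections X L B}. enat (card B))"

text \<open>
  The pullback of \<open>L\<close> along \<open>\<phi>\<close>, from the projective line to \<open>X\<close>, has degree \<open>n\<close>: the divisor
  \<open>D\<close> of some nonzero rational section, induced by a section \<open>s\<close> of \<open>L\<close> over an open set \<open>V\<close>
  meeting the image of \<open>\<phi>\<close>, has degree \<open>n\<close>.
\<close>

definition has_degree ::
    "('p, 'k::field) fspace \<Rightarrow> ('p, 'k, 'm::ab_group_add) mod_sheaf \<Rightarrow>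
     ('k proj_line \<Rightarrow> 'p) \<Rightarrow> int \<Rightarrow> bool"
  where "has_degree X L \<phi> n \<longleftrightarrow>
    (\<exists>V s D. openin (zar X) V \<and> s \<in> sec L V \<and> (\<exists>t. \<phi> t \<in> V) \<and>
       finite {t. D t \<noteq> 0} \<and> (\<Sum>t | D t \<noteq> 0. D t) = n \<and>
       (\<forall>t. \<exists>U e f. openin (zar X) U \<and> \<phi> t \<in> U \<and> generator X L U e \<and> f \<in> reg X (U \<inter> V) \<and>
          res L V (U \<inter> V) s = smul L (U \<inter> V) f (res L U (U \<inter> V) e) \<and>
          has_order (\<lambda>y. f (\<phi> y)) t (D t)))"

text \<open>
  For \<open>Y\<close> a closed subvariety of \<open>X\<close>, whose points form a subset of those of \<open>X\<close>: the invertible sheaf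
  \<open>M\<close> on \<open>Y\<close> is the restriction of the invertible sheaf \<open>L\<close>. A map from the restriction of
  \<open>L\<close> to \<open>M\<close> is the same as a semilinear map \<open>\<theta>\<close> as below, and it is an isomorphism if and only if
  it takes local generators to local generators.
\<close>

definition restricts_to ::
    "('p, 'k::field) fspace \<Rightarrow> ('p, 'k, 'm::ab_group_add) mod_sheaf \<Rightarrow>
     ('p, 'k) fspace \<Rightarrow> ('p, 'k, 'n::ab_group_add) mod_sheaf \<Rightarrow> bool"
  where "restricts_to X L Y M \<longleftrightarrow> invertible_sheaf Y M \<and> (\<exists>\<theta>.
    (\<forall>U. openin (zar X) U \<longrightarrow>
        (\<forall>s\<in>sec L U. \<theta> U s \<in> sec M (U \<inter> pts Y))
      \<and> (\<forall>s\<in>sec L U. \<forall>t\<in>sec L U. \<theta> U (s + t) = \<theta> U s + \<theta> U t)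
      \<and> (\<forall>f\<in>reg X U. \<forall>s\<in>sec L U.
            \<theta> U (smul L U f s) = smul M (U \<inter> pts Y) (cut (U \<inter> pts Y) f) (\<theta> U s))
      \<and> (\<forall>e. generator X L U e \<longrightarrow> generator Y M (U \<inter> pts Y) (\<theta> U e)))
  \<and> (\<forall>U V. openin (zar X) U \<and> openin (zar X) V \<and> V \<subseteq> U \<longrightarrow>
        (\<forall>s\<in>sec L U. \<theta> V (res L U V s) = res M (U \<inter> pts Y) (V \<inter> pts Y) (\<theta> U s))))"


section \<open>Binary curves\<close>

datatype comp = C1 | C2

text \<open>The intersection of the two components parametrized by \<open>\<phi> C1\<close> and \<open>\<phi> C2\<close>.\<close>

definition sing :: "(comp \<Rightarrow> 'k proj_line \<Rightarrow> 'p) \<Rightarrow> 'p set"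
  where "sing \<phi> = range (\<phi> C1) \<inter> range (\<phi> C2)"

text \<open>
  The components are smooth, so an intersection point is an ordinary node if and only if they meet
  transversally there, i.e. some regular function near the point vanishes on the first component and
  restricts to a local parameter of the second one.
\<close>

definition node_at :: "('p, 'k::field) fspace \<Rightarrow> (comp \<Rightarrow> 'k proj_line \<Rightarrow> 'p) \<Rightarrow> 'p \<Rightarrow> bool"
  where "node_at X \<phi> P \<longleftrightarrow>
    (\<exists>U f t. openin (zar X) U \<and> P \<in> U \<and> f \<in> reg X U \<and> (\<forall>s. f (\<phi> C1 s) = 0) \<and>
       \<phi> C2 t = P \<and> has_order (\<lambda>y. f (\<phi> C2 y)) t 1)"

definition binary_curve ::
    "('p, 'k::alg_closed_field) fspace \<Rightarrow> (comp \<Rightarrow> 'k proj_line \<Rightarrow> 'p) \<Rightarrow> int \<Rightarrow> bool"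
  where "binary_curve X \<phi> g \<longleftrightarrow> space_with_functions X \<and>
    (\<forall>i. closed_immersion P1 X (\<phi> i)) \<and> pts X = range (\<phi> C1) \<union> range (\<phi> C2) \<and>
    finite (sing \<phi>) \<and> int (card (sing \<phi>)) = g + 1 \<and> (\<forall>P\<in>sing \<phi>. node_at X \<phi> P)"

abbreviation total_degree :: "(comp \<Rightarrow> int) \<Rightarrow> int"
  where "total_degree d \<equiv> d C1 + d C2"

definition balanced :: "int \<Rightarrow> (comp \<Rightarrow> int) \<Rightarrow> bool"
  where "balanced g d \<longleftrightarrow> (\<forall>i.
    (real_of_int (total_degree d) - g - 1) / 2 \<le> d i \<and> d i \<le> (real_of_int (total_degree d) + g + 1) / 2)"

definition strictly_balanced :: "int \<Rightarrow> (comp \<Rightarrow> int) \<Rightarrow> bool"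
  where "strictly_balanced g d \<longleftrightarrow> (\<forall>i.
    (real_of_int (total_degree d) - g - 1) / 2 < d i \<and> d i < (real_of_int (total_degree d) + g + 1) / 2)"

definition Pic ::
    "('p, 'k::alg_closed_field) fspace \<Rightarrow> (comp \<Rightarrow> 'k proj_line \<Rightarrow> 'p) \<Rightarrow> (comp \<Rightarrow> int) \<Rightarrow>
     ('p, 'k, 'm::ab_group_add) mod_sheaf set"
  where "Pic X \<phi> d = {L. invertible_sheaf X L \<and> (\<forall>i. has_degree X L (\<phi> i) (d i))}"

text \<open>
  The dualizing sheaf of a nodal curve is the sheaf of (Rosenlicht) regular differentials: a section
  consists of rational differentials on the components that are regular except for at most simple
  poles at the nodes, with opposite residues on the two branches of each node.

  A rational differential on the projective line is written \<open>h dt\<close>. Its coefficient with respect to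
  the differential of \<open>local_param x\<close> is \<open>h\<close> at finite points and \<open>- t\<^sup>2 h\<close> at infinity.
\<close>

fun diff_coeff :: "('k::field proj_line \<Rightarrow> 'k) \<Rightarrow> 'k proj_line \<Rightarrow> 'k proj_line \<Rightarrow> 'k"
  where
    "diff_coeff h (Aff a) y = h y"
  | "diff_coeff h Infty (Aff t) = - (t ^ 2) * h (Aff t)"
  | "diff_coeff h Infty Infty = 0"

definition diff_regular_at :: "('k::field proj_line \<Rightarrow> 'k) \<Rightarrow> 'k proj_line \<Rightarrow> bool"
  where "diff_regular_at h x \<longleftrightarrow>
    (\<exists>W u. openin cofinite_topology W \<and> x \<in> W \<and> u \<in> proj_reg W \<and>
       (\<forall>y\<in>W - {x}. u y = diff_coeff h x y))"

definition log_residue :: "('k::field proj_line \<Rightarrow> 'k) \<Rightarrow> 'k proj_line \<Rightarrow> 'k \<Rightarrow> bool"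
  where "log_residue h x r \<longleftrightarrow>
    (\<exists>W u. openin cofinite_topology W \<and> x \<in> W \<and> u \<in> proj_reg W \<and> u x = r \<and>
       (\<forall>y\<in>W - {x}. u y = local_param x y * diff_coeff h x y))"

text \<open>
  In a section \<open>\<eta>\<close> over \<open>U\<close>, \<open>\<eta> i\<close> is the coefficient \<open>h\<close> of \<open>h dt\<close> on the \<open>i\<close>-th component,
  as a regular function away from infinity and from the nodes.
\<close>

definition dualizing_sheaf ::
    "('p, 'k::alg_closed_field) fspace \<Rightarrow> (comp \<Rightarrow> 'k proj_line \<Rightarrow> 'p) \<Rightarrow>
     ('p, 'k, comp \<Rightarrow> 'k proj_line \<Rightarrow> 'k) mod_sheaf"
  where "dualizing_sheaf X \<phi> = \<lparr>
    sec = (\<lambda>U. {\<eta>.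
        (\<forall>i. \<eta> i \<in> proj_reg {t. t \<noteq> Infty \<and> \<phi> i t \<in> U - sing \<phi>})
      \<and> (\<forall>i. \<phi> i Infty \<in> U - sing \<phi> \<longrightarrow> diff_regular_at (\<eta> i) Infty)
      \<and> (\<forall>t1 t2. \<phi> C1 t1 = \<phi> C2 t2 \<and> \<phi> C1 t1 \<in> U \<longrightarrow>
            (\<exists>r. log_residue (\<eta> C1) t1 r \<and> log_residue (\<eta> C2) t2 (- r)))}),
    smul = (\<lambda>U f \<eta> i t. f (\<phi> i t) * \<eta> i t),
    res = (\<lambda>U V \<eta> i. cut {t. \<phi> i t \<in> V} (\<eta> i))\<rparr>"


section \<open>Partial normalizations and blow-ups at nodes\<close>

text \<open>
  The curve obtained from projective lines indexed by \<open>I\<close> by identifying points with the same image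
  under the maps \<open>\<psi> c\<close>: a set is open, and a function regular, if it is so on every line. A
  point hit exactly twice is an ordinary node.
\<close>

definition glued_curve :: "'c set \<Rightarrow> ('c \<Rightarrow> 'k::field proj_line \<Rightarrow> 'q) \<Rightarrow> ('q, 'k) fspace"
  where "glued_curve I \<psi> = \<lparr>
    zar = topology (\<lambda>U. U \<subseteq> (\<Union>c\<in>I. range (\<psi> c)) \<and>
      (\<forall>c\<in>I. openin cofinite_topology (\<psi> c -` U))),
    reg = (\<lambda>U. {f. cut U f = f \<and> (\<forall>c\<in>I. (\<lambda>t. f (\<psi> c t)) \<in> proj_reg (\<psi> c -` U))})\<rparr>"

lemma openin_glued_curve:
  "openin (zar (glued_curve I \<psi>)) U \<longleftrightarrow>
     U \<subseteq> (\<Union>c\<in>I. range (\<psi> c)) \<and> (\<forall>c\<in>I. openin cofinite_topology (\<psi> c -` U))"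
proof -
  have "istopology (\<lambda>U. U \<subseteq> (\<Union>c\<in>I. range (\<psi> c)) \<and>
      (\<forall>c\<in>I. openin cofinite_topology (\<psi> c -` U)))"
    unfolding istopology_def
  proof (intro conjI allI impI ballI)
    fix S T c
    assume "S \<subseteq> (\<Union>c\<in>I. range (\<psi> c)) \<and> (\<forall>c\<in>I. openin cofinite_topology (\<psi> c -` S))"
      "T \<subseteq> (\<Union>c\<in>I. range (\<psi> c)) \<and> (\<forall>c\<in>I. openin cofinite_topology (\<psi> c -` T))" "c \<in> I"
    then show "openin cofinite_topology (\<psi> c -` (S \<inter> T))" by (simp add: openin_Int)
  next
    fix \<K> c
    assume "\<forall>K\<in>\<K>. K \<subseteq> (\<Union>c\<in>I. range (\<psi> c)) \<and> (\<forall>c\<in>I. openin cofinite_topology (\<psi> c -` K))"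
      "c \<in> I"
    then have "openin cofinite_topology (\<Union>K\<in>\<K>. \<psi> c -` K)" by (intro openin_Union) auto
    then show "openin cofinite_topology (\<psi> c -` (\<Union>\<K>))" by (simp add: vimage_Union)
  qed auto
  then show ?thesis by (simp add: glued_curve_def)
qed

text \<open>
  Points of the curves derived from a binary curve: an old point, the point on a given branch over a
  separated node, and the points other than zero and infinity of the exceptional component over a node.
\<close>

datatype ('p, 'k) bpoint = Old 'p | Branch comp 'p | Exc 'p 'k

datatype 'p bcomp = Strict comp | Exceptional 'p

definition norm_map ::
    "(comp \<Rightarrow> 'k proj_line \<Rightarrow> 'p) \<Rightarrow> 'p set \<Rightarrow> comp \<Rightarrow> 'k proj_line \<Rightarrow> ('p, 'k) bpoint"
  where "norm_map \<phi> S i t = (if \<phi> i t \<in> S then Branch i (\<phi> i t) else Old (\<phi> i t))"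

definition partial_normalization ::
    "(comp \<Rightarrow> 'k::field proj_line \<Rightarrow> 'p) \<Rightarrow> 'p set \<Rightarrow> (('p, 'k) bpoint, 'k) fspace"
  where "partial_normalization \<phi> S = glued_curve UNIV (norm_map \<phi> S)"

fun exc_map :: "'p \<Rightarrow> 'k::zero proj_line \<Rightarrow> ('p, 'k) bpoint"
  where
    "exc_map P (Aff a) = (if a = 0 then Branch C1 P else Exc P a)"
  | "exc_map P Infty = Branch C2 P"

fun blowup_map ::
    "(comp \<Rightarrow> 'k::zero proj_line \<Rightarrow> 'p) \<Rightarrow> 'p set \<Rightarrow> 'p bcomp \<Rightarrow> 'k proj_line \<Rightarrow> ('p, 'k) bpoint"
  where
    "blowup_map \<phi> S (Strict i) = norm_map \<phi> S i"
  | "blowup_map \<phi> S (Exceptional P) = exc_map P"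

definition blowup ::
    "(comp \<Rightarrow> 'k::field proj_line \<Rightarrow> 'p) \<Rightarrow> 'p set \<Rightarrow> (('p, 'k) bpoint, 'k) fspace"
  where "blowup \<phi> S = glued_curve (range Strict \<union> Exceptional ` S) (blowup_map \<phi> S)"


section \<open>The compactified Picard variety\<close>

text \<open>
  The line bundle \<open>L\<close> on the blow-up at \<open>S\<close> has degree 1 on every exceptional component and its
  restriction to the partial normalization has multidegree \<open>e\<close>.
\<close>

definition blowup_bundle ::
    "(comp \<Rightarrow> 'k::alg_closed_field proj_line \<Rightarrow> 'p) \<Rightarrow> 'p set \<Rightarrow> (comp \<Rightarrow> int) \<Rightarrow>
     (('p, 'k) bpoint, 'k, 'm::ab_group_add) mod_sheaf \<Rightarrow> bool"
  where "blowup_bundle \<phi> S e L \<longleftrightarrow> S \<subseteq> sing \<phi> \<and> invertible_sheaf (blowup \<phi> S) L \<and>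
    (\<forall>i. has_degree (blowup \<phi> S) L (blowup_map \<phi> S (Strict i)) (e i)) \<and>
    (\<forall>P\<in>S. has_degree (blowup \<phi> S) L (blowup_map \<phi> S (Exceptional P)) 1)"

definition strictly_balanced_bundles ::
    "(comp \<Rightarrow> 'k::alg_closed_field proj_line \<Rightarrow> 'p) \<Rightarrow> int \<Rightarrow> int \<Rightarrow>
     ('p set \<times> (('p, 'k) bpoint, 'k, 'm::ab_group_add) mod_sheaf) set"
  where "strictly_balanced_bundles \<phi> g d = {(S, L). \<exists>e. blowup_bundle \<phi> S e L \<and>
    total_degree e + int (card S) = d \<and> strictly_balanced (g - int (card S)) e}"

text \<open>
  Two bundles are equivalent if their restrictions to the partial normalization are isomorphic. These
  restrictions can be taken to be sheaves of functions: sections of an invertible sheaf on a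
  reduced curve are determined by their values in the fibres, and each fibre can be identified
  with \<open>k\<close>.
\<close>

definition bundle_equiv ::
    "(comp \<Rightarrow> 'k::alg_closed_field proj_line \<Rightarrow> 'p) \<Rightarrow> int \<Rightarrow> int \<Rightarrow>
     (('p set \<times> (('p, 'k) bpoint, 'k, 'm::ab_group_add) mod_sheaf) \<times>
      ('p set \<times> (('p, 'k) bpoint, 'k, 'm) mod_sheaf)) set"
  where "bundle_equiv \<phi> g d = {((S, L), (S', L')).
    (S, L) \<in> strictly_balanced_bundles \<phi> g d \<and> (S', L') \<in> strictly_balanced_bundles \<phi> g d \<and> S = S' \<and>
    (\<exists>(M :: (('p, 'k) bpoint, 'k, ('p, 'k) bpoint \<Rightarrow> 'k) mod_sheaf)
        (M' :: (('p, 'k) bpoint, 'k, ('p, 'k) bpoint \<Rightarrow> 'k) mod_sheaf).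
       restricts_to (blowup \<phi> S) L (partial_normalization \<phi> S) M \<and>
       restricts_to (blowup \<phi> S) L' (partial_normalization \<phi> S) M' \<and>
       sheaf_iso (partial_normalization \<phi> S) M M')}"

text \<open>
  The additional point, the class of the bundles on the blow-up at all nodes whose restriction to the
  disjoint union of the two components is \<open>O(m)\<close> on each of them.
\<close>

definition ell0 ::
    "(comp \<Rightarrow> 'k::alg_closed_field proj_line \<Rightarrow> 'p) \<Rightarrow> int \<Rightarrow>
     ('p set \<times> (('p, 'k) bpoint, 'k, 'm::ab_group_add) mod_sheaf) set"
  where "ell0 \<phi> m = {(S, L). S = sing \<phi> \<and> blowup_bundle \<phi> S (\<lambda>_. m) L}"

definition compactified_picard ::
    "(comp \<Rightarrow> 'k::alg_closed_field proj_line \<Rightarrow> 'p) \<Rightarrow> int \<Rightarrow> int \<Rightarrow>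
     ('p set \<times> (('p, 'k) bpoint, 'k, 'm::ab_group_add) mod_sheaf) set set"
  where "compactified_picard \<phi> g d =
    strictly_balanced_bundles \<phi> g d // bundle_equiv \<phi> g d \<union> {ell0 \<phi> m | m. 2 * m = d - g - 1}"

end

theory Submission
  imports Defs
begin

text \<open>
  A section of a bundle of bidegree \<open>(a, b)\<close> with \<open>a \<le> b\<close> on a binary curve with \<open>g + 1\<close> nodes is a pair of
  binary forms of degrees \<open>a\<close> and \<open>b\<close> satisfying one linear condition for each node. If the first
  form is zero, the second one vanishes at all nodes, so \<open>h\<^sup>0 \<le> max 0 (a + 1) + max 0 (b - g)\<close>. For
  balanced bidegrees this gives the inequality. The same count applies on a blow-up, since a section
  of degree 1 on an exceptional component is determined by its values at the two attaching points.

  In the extremal case of degree 0 the bidegree is \<open>(0, 0)\<close> and a nonzero section has no zeros. In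
  the extremal case of degree \<open>2 g - 2\<close> the bidegree is \<open>(g - 1, g - 1)\<close>, and for any two nodes there is
  a nonzero section vanishing at the other ones; such sections determine the gluing data of the bundle
  up to a common factor, and dividing by the forms vanishing at the nodes turns sections
  into regular differentials.
\<close>

section \<open>Rational functions on the projective line\<close>

text \<open>Sections of \<open>L\<close> are elements of an abstract type and a degree is witnessed
  by an unspecified rational section, so at the outset nothing makes a section a form. Its values
  are read off through a generator chosen separately at every point. These values jump arbitrarily
  from point to point: only their vanishing and their quotients have a meaning. The rational section
  witnessing the degree yields on each component a nowhere zero correction \<open>G\<close> that
  turns values into sections of O(n), hence into forms; comparing \<open>G\<close> on the two
  branches of a node records the gluing of the bundle. The second obstacle is that a binary curve is
  given by closed immersions and transversality, whereas isomorphisms concern its structure sheaf.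
  Transversality makes a function regular as soon as it is so along both components
  (\<open>binary_glued\<close>), so regularity can be tested on the projective line. For
  differentials, the g + 1 nodes lower O(g - 1) to O(-2). Values agree across a node while residues
  are opposite; rescaling \<open>G\<close> on one component absorbs the sign.\<close>

lemma infinite_UNIV_alg_closed: "infinite (UNIV :: 'k::alg_closed_field set)"
proof
  assume fin: "finite (UNIV :: 'k set)"
  \<comment> \<open>Every field element is a root of the product, so \<open>p\<close> takes the
    value 1 everywhere although its degree is positive.\<close>
  define p :: "'k poly" where "p = (\<Prod>a\<in>UNIV. [:- a, 1:]) + 1"
  have "poly p x = 1" for x
    using fin by (simp add: p_def poly_prod prod_zero)
  moreover have "degree p > 0"
  proof -
    have "degree (\<Prod>a\<in>UNIV. [:- a, 1::'k:]) = card (UNIV :: 'k set)"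
      using fin by (subst degree_prod_eq_sum_degree) auto
    moreover have "card (UNIV :: 'k set) > 0" using fin by (simp add: card_gt_0_iff)
    ultimately show ?thesis unfolding p_def by (subst degree_add_eq_left) auto
  qed
  ultimately show False using alg_closed_imp_poly_has_root[of p] by auto
qed

lemma infinite_UNIV_proj_line: "infinite (UNIV :: 'k::alg_closed_field proj_line set)"
proof -
  have "infinite (range (Aff :: 'k \<Rightarrow> _))"
    using infinite_UNIV_alg_closed by (auto dest!: finite_imageD simp: inj_def)
  then show ?thesis by (rule infinite_super[OF subset_UNIV])
qed

lemma MOST_proj_line_ex:
  assumes "\<forall>\<^sub>\<infinity>y::'k::alg_closed_field proj_line. P y"
  obtains y where "P y"
proof -
  have "{y. P y} \<noteq> {}"
  proof
    assume "{y. P y} = {}"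
    then have "finite (UNIV :: 'k proj_line set)" using assms by (simp add: eventually_cofinite)
    with infinite_UNIV_proj_line show False by blast
  qed
  then obtain y where "P y" by blast
  then show ?thesis by (rule that)
qed

lemma MOST_not_eq: "\<forall>\<^sub>\<infinity>y. y \<noteq> (a::'a)"
  by (simp add: eventually_cofinite)

lemma MOST_notin: "finite E \<Longrightarrow> \<forall>\<^sub>\<infinity>y. y \<notin> (E::'a set)"
  by (simp add: eventually_cofinite)

section \<open>Binary forms and their zeros\<close>

lemma form_eval_0 [simp]: "form_eval n 0 y = 0"
  by (cases y) auto

lemma form_eval_add: "form_eval n (p + q) y = form_eval n p y + form_eval n q y"
  by (cases y) auto

lemma form_eval_diff: "form_eval n (p - q) y = form_eval n p y - form_eval n q y"
  by (cases y) auto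

lemma form_eval_smult: "form_eval n (smult c p) y = c * form_eval n p y"
  by (cases y) auto

text \<open>This is multiplicativity of evaluation at infinity, \<open>m\<close> and
  \<open>n\<close> being degrees of forms. If one of the polynomials has smaller degree, both sides
  vanish.\<close>

lemma coeff_mult_top:
  assumes "degree p \<le> m" "degree q \<le> n"
  shows "coeff (p * q) (m + n) = coeff p m * coeff q n"
proof (cases "degree p = m \<and> degree q = n")
  case True
  then show ?thesis using coeff_mult_degree_sum[of p q] by auto
next
  case False
  then have "degree p < m \<or> degree q < n" using assms by auto
  then have "coeff p m * coeff q n = 0" by (auto simp: coeff_eq_0)
  moreover have "degree (p * q) < m + n"
    using degree_mult_le[of p q] assms \<open>degree p < m \<or> degree q < n\<close> by linarith
  ultimately show ?thesis by (simp add: coeff_eq_0)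
qed

lemma form_eval_mult:
  assumes "degree p \<le> m" "degree q \<le> n"
  shows "form_eval (m + n) (p * q) y = form_eval m p y * form_eval n q y"
  using assms by (cases y) (auto simp: coeff_mult_top)

lemma degree_mult_le': "degree p \<le> m \<Longrightarrow> degree q \<le> n \<Longrightarrow> degree (p * q) \<le> m + n"
  using degree_mult_le[of p q] by linarith

lemma form_zeros:
  fixes p :: "'k::field poly"
  assumes "p \<noteq> 0" "degree p \<le> n"
  shows "finite {y. form_eval n p y = 0}" "card {y. form_eval n p y = 0} \<le> n"
proof -
  let ?R = "{x. poly p x = 0}"
  have fin: "finite ?R" using assms(1) by (rule poly_roots_finite)
  have card: "card ?R \<le> degree p" using assms(1) by (rule card_poly_roots_bound)
  have eq: "{y. form_eval n p y = 0} = Aff ` ?R \<union> (if coeff p n = 0 then {Infty} else {})"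
    (is "?Z = _")
  proof (intro set_eqI)
    show "y \<in> ?Z \<longleftrightarrow> y \<in> Aff ` ?R \<union> (if coeff p n = 0 then {Infty} else {})" for y
      by (cases y) auto
  qed
  show "finite ?Z" using fin eq by auto
  have im: "card (Aff ` ?R) = card ?R" by (rule card_image) (auto simp: inj_on_def)
  show "card ?Z \<le> n"
  proof (cases "coeff p n = 0")
    case True
    \<comment> \<open>A zero at infinity lowers the degree of the polynomial, which leaves room for
      this additional zero in the count.\<close>
    then have "degree p < n" using assms by (metis le_neq_implies_less leading_coeff_neq_0)
    moreover have "card ?Z \<le> card (Aff ` ?R) + 1"
      unfolding eq using True by (simp add: card_insert_if fin)
    ultimately show ?thesis using card im by simp
  next
    case False
    then show ?thesis unfolding eq using card im assms by simp
  qed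
qed

lemma form_eq_0:
  fixes p :: "'k::field poly"
  assumes "degree p \<le> n" "finite Z" "card Z > n" "\<And>z. z \<in> Z \<Longrightarrow> form_eval n p z = 0"
  shows "p = 0"
proof (rule ccontr)
  assume "p \<noteq> 0"
  then have "card Z \<le> n"
    using form_zeros[OF _ assms(1)] card_mono[of "{y. form_eval n p y = 0}" Z] assms(4) by fastforce
  then show False using assms by simp
qed

lemma MOST_form_neq_0:
  fixes p :: "'k::field poly"
  assumes "p \<noteq> 0" "degree p \<le> n"
  shows "\<forall>\<^sub>\<infinity>y. form_eval n p y \<noteq> 0"
  using form_zeros[OF assms] by (simp add: eventually_cofinite)

lemma form_eq_0_MOST:
  fixes p :: "'k::alg_closed_field poly"
  assumes "degree p \<le> n" "\<forall>\<^sub>\<infinity>y. form_eval n p y = 0"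
  shows "p = 0"
proof (rule ccontr)
  assume "p \<noteq> 0"
  from MOST_form_neq_0[OF this assms(1)] assms(2)
  have "\<forall>\<^sub>\<infinity>y::'k proj_line. False" by eventually_elim simp
  then show False using MOST_proj_line_ex by blast
qed

text \<open>The difference of the cross products is a form of degree \<open>n + m\<close> vanishing
  at almost all points of an infinite line, hence zero. The resulting identity can then be evaluated
  at any single point.\<close>

lemma form_cross_mult:
  fixes p q p' q' :: "'k::alg_closed_field poly"
  assumes deg: "degree p \<le> n" "degree q \<le> n" "degree p' \<le> m" "degree q' \<le> m"
    and nz: "q \<noteq> 0" "q' \<noteq> 0"
    and eq: "\<forall>\<^sub>\<infinity>y. form_eval n p y / form_eval n q y = form_eval m p' y / form_eval m q' y"
  shows "p * q' = p' * q"
proof -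
  have "form_eval (n + m) (p * q' - q * p') y =
      form_eval n p y * form_eval m q' y - form_eval n q y * form_eval m p' y" for y
    by (simp add: form_eval_mult form_eval_diff deg)
  note num = this
  from eq MOST_form_neq_0[OF nz(1) deg(2)] MOST_form_neq_0[OF nz(2) deg(4)]
  have "\<forall>\<^sub>\<infinity>y. form_eval (n + m) (p * q' - q * p') y = 0"
    by eventually_elim (simp add: num frac_eq_eq)
  moreover have "degree (p * q' - q * p') \<le> n + m"
    by (intro degree_diff_le degree_mult_le' deg)
  ultimately have "p * q' - q * p' = 0" by (rule form_eq_0_MOST[rotated])
  then show ?thesis by (metis right_minus_eq mult.commute)
qed

section \<open>Germs of regular functions\<close>

text \<open>A neighbourhood in the cofinite topology is a cofinite set containing the point. An
  equation near \<open>t\<close> thus splits into one for almost all points and one at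
  \<open>t\<close> itself, and germs can be handled without naming open sets.\<close>

definition reg_at :: "('k::field proj_line \<Rightarrow> 'k) \<Rightarrow> 'k proj_line \<Rightarrow> bool"
  where "reg_at f t \<longleftrightarrow> (\<exists>n p q. degree p \<le> n \<and> degree q \<le> n \<and> form_eval n q t \<noteq> 0 \<and>
    f t = form_eval n p t / form_eval n q t \<and>
    (\<forall>\<^sub>\<infinity>y. f y = form_eval n p y / form_eval n q y))"

lemma reg_atE:
  assumes "reg_at f t"
  obtains n p q where "degree p \<le> n" "degree q \<le> n" "form_eval n q t \<noteq> 0"
    "f t = form_eval n p t / form_eval n q t"
    "\<forall>\<^sub>\<infinity>y. f y = form_eval n p y / form_eval n q y" "q \<noteq> 0"
  using assms unfolding reg_at_def by (metis form_eval_0)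

lemma reg_at_cong:
  assumes "reg_at f t" "f t = g t" "\<forall>\<^sub>\<infinity>y. f y = g y"
  shows "reg_at g t"
proof -
  from assms(1) obtain n p q where *: "degree p \<le> n" "degree q \<le> n" "form_eval n q t \<noteq> 0"
    "f t = form_eval n p t / form_eval n q t" "\<forall>\<^sub>\<infinity>y. f y = form_eval n p y / form_eval n q y"
    by (rule reg_atE)
  moreover from *(5) assms(3) have "\<forall>\<^sub>\<infinity>y. g y = form_eval n p y / form_eval n q y"
    by eventually_elim simp
  ultimately show ?thesis unfolding reg_at_def using assms(2) by metis
qed

lemma reg_at_form:
  assumes "degree p \<le> n" "degree q \<le> n" "form_eval n q t \<noteq> 0"
  shows "reg_at (\<lambda>y. form_eval n p y / form_eval n q y) t"
  unfolding reg_at_def using assms by (intro exI[of _ n] exI[of _ p] exI[of _ q]) simp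

lemma reg_at_const: "reg_at (\<lambda>_. c) t"
proof -
  have "form_eval 0 [:c:] y = c" for y and c :: 'a by (cases y) auto
  then show ?thesis using reg_at_form[of "[:c:]" 0 "[:1:]" t] by simp
qed

lemma reg_at_mult:
  fixes f g :: "'k::field proj_line \<Rightarrow> 'k"
  assumes "reg_at f t" "reg_at g t"
  shows "reg_at (\<lambda>y. f y * g y) t"
proof -
  from assms(1) obtain n p q where f: "degree p \<le> n" "degree q \<le> n" "form_eval n q t \<noteq> 0"
    "f t = form_eval n p t / form_eval n q t" "\<forall>\<^sub>\<infinity>y. f y = form_eval n p y / form_eval n q y"
    by (rule reg_atE)
  from assms(2) obtain m p' q' where g: "degree p' \<le> m" "degree q' \<le> m" "form_eval m q' t \<noteq> 0"
    "g t = form_eval m p' t / form_eval m q' t" "\<forall>\<^sub>\<infinity>y. g y = form_eval m p' y / form_eval m q' y"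
    by (rule reg_atE)
  have "reg_at (\<lambda>y. form_eval (n + m) (p * p') y / form_eval (n + m) (q * q') y) t"
    by (rule reg_at_form) (simp_all add: degree_mult_le' form_eval_mult f g)
  then show ?thesis
  proof (rule reg_at_cong)
    from f(5) g(5) show "\<forall>\<^sub>\<infinity>y. form_eval (n + m) (p * p') y / form_eval (n + m) (q * q') y = f y * g y"
      by eventually_elim (simp add: form_eval_mult f g)
  qed (simp add: form_eval_mult f g)
qed

lemma reg_at_add:
  fixes f g :: "'k::field proj_line \<Rightarrow> 'k"
  assumes "reg_at f t" "reg_at g t"
  shows "reg_at (\<lambda>y. f y + g y) t"
proof -
  from assms(1) obtain n p q where f: "degree p \<le> n" "degree q \<le> n" "form_eval n q t \<noteq> 0"
    "f t = form_eval n p t / form_eval n q t" "\<forall>\<^sub>\<infinity>y. f y = form_eval n p y / form_eval n q y" "q \<noteq> 0"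
    by (rule reg_atE)
  from assms(2) obtain m p' q' where g: "degree p' \<le> m" "degree q' \<le> m" "form_eval m q' t \<noteq> 0"
    "g t = form_eval m p' t / form_eval m q' t" "\<forall>\<^sub>\<infinity>y. g y = form_eval m p' y / form_eval m q' y" "q' \<noteq> 0"
    by (rule reg_atE)
  have num: "form_eval (n + m) (p * q' + q * p') y =
      form_eval n p y * form_eval m q' y + form_eval n q y * form_eval m p' y"
    and den: "form_eval (n + m) (q * q') y = form_eval n q y * form_eval m q' y" for y
    by (simp_all add: form_eval_add form_eval_mult f g)
  have "reg_at (\<lambda>y. form_eval (n + m) (p * q' + q * p') y / form_eval (n + m) (q * q') y) t"
    by (rule reg_at_form) (simp_all add: degree_add_le degree_mult_le' form_eval_mult f g)
  then show ?thesis
  proof (rule reg_at_cong)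
    from f(5) g(5) MOST_form_neq_0[OF f(6,2)] MOST_form_neq_0[OF g(6,2)]
    show "\<forall>\<^sub>\<infinity>y. form_eval (n + m) (p * q' + q * p') y / form_eval (n + m) (q * q') y = f y + g y"
      by eventually_elim (simp add: num den add_frac_eq)
  qed (simp add: num den f g add_frac_eq)
qed

lemma reg_at_inverse:
  fixes f :: "'k::field proj_line \<Rightarrow> 'k"
  assumes "reg_at f t" "f t \<noteq> 0"
  shows "reg_at (\<lambda>y. inverse (f y)) t"
proof -
  from assms(1) obtain n p q where f: "degree p \<le> n" "degree q \<le> n" "form_eval n q t \<noteq> 0"
    "f t = form_eval n p t / form_eval n q t" "\<forall>\<^sub>\<infinity>y. f y = form_eval n p y / form_eval n q y"
    by (rule reg_atE)
  have "reg_at (\<lambda>y. form_eval n q y / form_eval n p y) t"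
    by (rule reg_at_form) (use f assms in auto)
  then show ?thesis
  proof (rule reg_at_cong)
    from f(5) show "\<forall>\<^sub>\<infinity>y. form_eval n q y / form_eval n p y = inverse (f y)"
      by eventually_elim simp
  qed (simp add: f)
qed

lemma reg_at_divide:
  fixes f :: "'k::field proj_line \<Rightarrow> 'k"
  assumes "reg_at f t" "reg_at g t" "g t \<noteq> 0"
  shows "reg_at (\<lambda>y. f y / g y) t"
  using reg_at_mult[OF assms(1) reg_at_inverse[OF assms(2,3)]] by (simp add: field_simps)

lemma reg_at_minus:
  fixes f :: "'k::field proj_line \<Rightarrow> 'k"
  assumes "reg_at f t"
  shows "reg_at (\<lambda>y. - f y) t"
  using reg_at_mult[OF reg_at_const[of "-1"] assms] by simp

lemma reg_at_diff:
  fixes f g :: "'k::field proj_line \<Rightarrow> 'k"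
  assumes "reg_at f t" "reg_at g t"
  shows "reg_at (\<lambda>y. f y - g y) t"
  using reg_at_add[OF assms(1) reg_at_minus[OF assms(2)]] by simp

text \<open>An identity theorem: agreement almost everywhere gives an identity of polynomials, which
  is evaluated at \<open>t\<close>, where neither denominator vanishes.\<close>

lemma reg_at_eq:
  fixes f g :: "'k::alg_closed_field proj_line \<Rightarrow> 'k"
  assumes "reg_at f t" "reg_at g t" "\<forall>\<^sub>\<infinity>y. f y = g y"
  shows "f t = g t"
proof -
  from assms(1) obtain n p q where f: "degree p \<le> n" "degree q \<le> n" "form_eval n q t \<noteq> 0"
    "f t = form_eval n p t / form_eval n q t" "\<forall>\<^sub>\<infinity>y. f y = form_eval n p y / form_eval n q y" "q \<noteq> 0"
    by (rule reg_atE)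
  from assms(2) obtain m p' q' where g: "degree p' \<le> m" "degree q' \<le> m" "form_eval m q' t \<noteq> 0"
    "g t = form_eval m p' t / form_eval m q' t" "\<forall>\<^sub>\<infinity>y. g y = form_eval m p' y / form_eval m q' y" "q' \<noteq> 0"
    by (rule reg_atE)
  have "\<forall>\<^sub>\<infinity>y. form_eval n p y / form_eval n q y = form_eval m p' y / form_eval m q' y"
    using assms(3) f(5) g(5) by eventually_elim simp
  with f g have "p * q' = p' * q"
    by (intro form_cross_mult[of p n q p' m q'])
  then have "form_eval (n + m) (p * q') t = form_eval (n + m) (q * p') t" by (simp add: mult.commute)
  then have "form_eval n p t * form_eval m q' t = form_eval n q t * form_eval m p' t"
    using f g by (simp add: form_eval_mult)
  then show ?thesis using f(3,4) g(3,4) by (simp add: frac_eq_eq mult.commute)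
qed

lemma MOST_neq_0_if_reg_at:
  fixes f :: "'k::alg_closed_field proj_line \<Rightarrow> 'k"
  assumes "reg_at f t" "f t \<noteq> 0"
  shows "\<forall>\<^sub>\<infinity>y. f y \<noteq> 0"
proof -
  from assms(1) obtain n p q where f: "degree p \<le> n" "degree q \<le> n" "form_eval n q t \<noteq> 0"
    "f t = form_eval n p t / form_eval n q t" "\<forall>\<^sub>\<infinity>y. f y = form_eval n p y / form_eval n q y" "q \<noteq> 0"
    by (rule reg_atE)
  have "p \<noteq> 0" using f assms by auto
  from f(5) MOST_form_neq_0[OF this f(1)] MOST_form_neq_0[OF f(6,2)] show ?thesis
    by eventually_elim simp
qed

lemma openin_cofinite_MOST:
  "openin cofinite_topology U \<Longrightarrow> t \<in> U \<Longrightarrow> \<forall>\<^sub>\<infinity>y. y \<in> U"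
  by (auto simp: openin_cofinite_topology eventually_cofinite Compl_eq)

lemma proj_reg_iff:
  fixes f :: "'k::alg_closed_field proj_line \<Rightarrow> 'k"
  assumes "openin cofinite_topology U"
  shows "f \<in> proj_reg U \<longleftrightarrow> cut U f = f \<and> (\<forall>t\<in>U. reg_at f t)"
proof (intro iffI conjI ballI)
  fix t assume f: "f \<in> proj_reg U" and t: "t \<in> U"
  then obtain V n p q where *: "openin cofinite_topology V" "t \<in> V"
    "degree p \<le> n" "degree q \<le> n" "\<And>y. y \<in> V \<Longrightarrow> form_eval n q y \<noteq> 0 \<and> f y = form_eval n p y / form_eval n q y"
    unfolding proj_reg_def by blast
  have "\<forall>\<^sub>\<infinity>y. f y = form_eval n p y / form_eval n q y"
    using openin_cofinite_MOST[OF *(1,2)] by eventually_elim (use * in blast)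
  then show "reg_at f t" unfolding reg_at_def using * by blast
next
  assume *: "cut U f = f \<and> (\<forall>t\<in>U. reg_at f t)"
  show "f \<in> proj_reg U"
    unfolding proj_reg_def
  proof (safe, use * in simp)
    fix t assume t: "t \<in> U"
    with * have "reg_at f t" by blast
    then obtain n p q where f: "degree p \<le> n" "degree q \<le> n" "form_eval n q t \<noteq> 0"
      "f t = form_eval n p t / form_eval n q t" "\<forall>\<^sub>\<infinity>y. f y = form_eval n p y / form_eval n q y" "q \<noteq> 0"
      by (rule reg_atE)
    \<comment> \<open>Discarding finitely many exceptional points leaves a cofinite subset of
      \<open>U\<close>; it still contains \<open>t\<close> because the germ equation holds at
      \<open>t\<close> as well.\<close>
    let ?V = "{y \<in> U. form_eval n q y \<noteq> 0 \<and> f y = form_eval n p y / form_eval n q y}"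
    have "\<forall>\<^sub>\<infinity>y. y \<in> ?V"
      using f(5) MOST_form_neq_0[OF f(6,2)] openin_cofinite_MOST[OF assms t]
      by eventually_elim simp
    then have "openin cofinite_topology ?V"
      by (simp add: openin_cofinite_topology eventually_cofinite Compl_eq)
    then show "\<exists>V n p q. openin cofinite_topology V \<and> t \<in> V \<and> V \<subseteq> U \<and> degree p \<le> n \<and> degree q \<le> n \<and>
         (\<forall>y\<in>V. form_eval n q y \<noteq> 0 \<and> f y = form_eval n p y / form_eval n q y)"
      using t f by (intro exI[of _ ?V] exI[of _ n] exI[of _ p] exI[of _ q]) auto
  qed
qed (auto simp: proj_reg_def)

lemma proj_reg_cutI:
  fixes f :: "'k::alg_closed_field proj_line \<Rightarrow> 'k"
  assumes "openin cofinite_topology U" "\<And>t. t \<in> U \<Longrightarrow> reg_at f t"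
  shows "cut U f \<in> proj_reg U"
  unfolding proj_reg_iff[OF assms(1)]
proof (intro conjI ballI)
  show "cut U (cut U f) = cut U f" by (auto simp: cut_def)
  fix t assume t: "t \<in> U"
  have "\<forall>\<^sub>\<infinity>y. f y = cut U f y"
    using openin_cofinite_MOST[OF assms(1) t] by eventually_elim (simp add: cut_def)
  then show "reg_at (cut U f) t"
    by (intro reg_at_cong[OF assms(2)[OF t]]) (simp_all add: cut_def t)
qed

lemma reg_at_witness:
  fixes u :: "'k::alg_closed_field proj_line \<Rightarrow> 'k"
  assumes "reg_at u t"
  obtains W u' where "openin cofinite_topology W" "t \<in> W" "u' \<in> proj_reg W"
    "\<And>y. y \<in> W \<Longrightarrow> u' y = u y"
proof -
  obtain n p q where u: "degree p \<le> n" "degree q \<le> n" "form_eval n q t \<noteq> 0"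
    "u t = form_eval n p t / form_eval n q t" "\<forall>\<^sub>\<infinity>y. u y = form_eval n p y / form_eval n q y" "q \<noteq> 0"
    using assms by (rule reg_atE)
  let ?W = "{y. form_eval n q y \<noteq> 0 \<and> u y = form_eval n p y / form_eval n q y}"
  have "\<forall>\<^sub>\<infinity>y. y \<in> ?W"
    using u(5) MOST_form_neq_0[OF u(6,2)] by eventually_elim simp
  then have W: "openin cofinite_topology ?W"
    by (simp add: openin_cofinite_topology eventually_cofinite Compl_eq)
  have "cut ?W u \<in> proj_reg ?W"
    unfolding proj_reg_def
  proof (intro CollectI conjI ballI)
    show "cut ?W (cut ?W u) = cut ?W u" by (auto simp: cut_def)
    fix x assume x: "x \<in> ?W"
    show "\<exists>V n p q. openin cofinite_topology V \<and> x \<in> V \<and> V \<subseteq> ?W \<and> degree p \<le> n \<and> degree q \<le> n \<and>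
       (\<forall>y\<in>V. form_eval n q y \<noteq> 0 \<and> cut ?W u y = form_eval n p y / form_eval n q y)"
      using x W u(1,2) by (intro exI[of _ ?W] exI[of _ n] exI[of _ p] exI[of _ q]) (simp add: cut_def)
  qed
  moreover have "t \<in> ?W" using u by simp
  ultimately show ?thesis by (intro that[OF W, of "cut ?W u"]) (simp_all add: cut_def)
qed

lemma has_orderE:
  fixes h :: "'k::alg_closed_field proj_line \<Rightarrow> 'k"
  assumes "has_order h t n"
  obtains u where "reg_at u t" "u t \<noteq> 0" "\<forall>\<^sub>\<infinity>y. h y = u y * local_param t y powi n"
proof -
  from assms obtain W u where *: "openin cofinite_topology W" "t \<in> W" "u \<in> proj_reg W"
    "\<forall>y\<in>W. u y \<noteq> 0" "\<And>y. y \<in> W - {t} \<Longrightarrow> h y = u y * local_param t y powi n"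
    unfolding has_order_def by blast
  have "\<forall>\<^sub>\<infinity>y. h y = u y * local_param t y powi n"
    using openin_cofinite_MOST[OF *(1,2)] MOST_not_eq[of t] by eventually_elim (use * in blast)
  moreover have "reg_at u t" using *(2,3) proj_reg_iff[OF *(1)] by blast
  moreover have "u t \<noteq> 0" using *(2,4) by blast
  ultimately show ?thesis by (intro that)
qed

section \<open>Sections of twists of the projective line\<close>

text \<open>
  A section of \<open>\<O>(n)\<close> is represented by its values at the homogeneous coordinates \<open>(t, 1)\<close> and
  \<open>(1, 0)\<close>, as in \<open>form_eval\<close>. Near infinity, passing to the coordinates \<open>(1, 1 / t)\<close> divides the
  value at \<open>(t, 1)\<close> by \<open>t ^ n\<close>.
\<close>

fun twist :: "int \<Rightarrow> 'k::field proj_line \<Rightarrow> 'k proj_line \<Rightarrow> 'k"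
  where
    "twist n (Aff a) y = 1"
  | "twist n Infty (Aff t) = t powi n"
  | "twist n Infty Infty = 1"

lemma twist_self [simp]: "twist n t t = 1"
  by (cases t) auto

lemma twist_0 [simp]: "twist 0 t y = 1"
  by (cases t; cases y) auto

text \<open>For \<open>t = Infty\<close> the twist is a power of the coordinate, and at
  \<open>Aff 0\<close> a power of zero, where exponent laws break down. Hence the restriction to
  almost all points.\<close>

lemma MOST_twist:
  shows MOST_twist_neq_0: "\<forall>\<^sub>\<infinity>y. twist n t y \<noteq> 0"
    and MOST_twist_add: "\<forall>\<^sub>\<infinity>y. twist (m + n) t y = twist m t y * twist n t y"
    and MOST_twist_diff: "\<forall>\<^sub>\<infinity>y. twist (m - n) t y = twist m t y / twist n t y"
    and MOST_twist_minus: "\<forall>\<^sub>\<infinity>y. twist (- n) t y = inverse (twist n t y)"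
proof -
  have *: "\<forall>\<^sub>\<infinity>y. y \<noteq> Aff 0" by (rule MOST_not_eq)
  have "twist n t y \<noteq> 0" "twist (m + n) t y = twist m t y * twist n t y"
    "twist (m - n) t y = twist m t y / twist n t y" "twist (- n) t y = inverse (twist n t y)"
    if "y \<noteq> Aff 0" for y
    using that by (cases t; cases y; auto simp: power_int_add power_int_diff power_int_minus)+
  then show "\<forall>\<^sub>\<infinity>y. twist n t y \<noteq> 0" "\<forall>\<^sub>\<infinity>y. twist (m + n) t y = twist m t y * twist n t y"
    "\<forall>\<^sub>\<infinity>y. twist (m - n) t y = twist m t y / twist n t y"
    "\<forall>\<^sub>\<infinity>y. twist (- n) t y = inverse (twist n t y)"
    by (auto intro: eventually_mono[OF *])
qed

lemma twist_powi: "twist 1 t y powi k = twist k t y"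
  by (cases t; cases y) auto

text \<open>Regularity at \<open>t\<close> of a section of O(n): dividing by the twist passes to the
  coordinate in the chart around \<open>t\<close>.\<close>

definition oreg :: "int \<Rightarrow> ('k::field proj_line \<Rightarrow> 'k) \<Rightarrow> 'k proj_line \<Rightarrow> bool"
  where "oreg n P t \<longleftrightarrow> reg_at (\<lambda>y. P y / twist n t y) t"

lemma oreg_0 [simp]: "oreg 0 P t \<longleftrightarrow> reg_at P t"
  by (simp add: oreg_def)

lemma oreg_Aff [simp]: "oreg n P (Aff a) \<longleftrightarrow> reg_at P (Aff a)"
  by (simp add: oreg_def)

lemma oreg_cong:
  assumes "oreg n P t" "P t = Q t" "\<forall>\<^sub>\<infinity>y. P y = Q y"
  shows "oreg n Q t"
  unfolding oreg_def
proof (rule reg_at_cong)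
  show "reg_at (\<lambda>y. P y / twist n t y) t" using assms(1) by (simp add: oreg_def)
  show "\<forall>\<^sub>\<infinity>y. P y / twist n t y = Q y / twist n t y"
    using assms(3) by eventually_elim simp
qed (simp add: assms)

lemma oreg_mult:
  assumes "oreg n P t" "oreg m Q t"
  shows "oreg (n + m) (\<lambda>y. P y * Q y) t"
  unfolding oreg_def
proof (rule reg_at_cong)
  show "reg_at (\<lambda>y. (P y / twist n t y) * (Q y / twist m t y)) t"
    using assms unfolding oreg_def by (rule reg_at_mult)
  show "\<forall>\<^sub>\<infinity>y. (P y / twist n t y) * (Q y / twist m t y) = P y * Q y / twist (n + m) t y"
    using MOST_twist_add[of n m t] by eventually_elim simp
qed simp

lemma oreg_divide:
  assumes "oreg n P t" "oreg m Q t" "Q t \<noteq> 0"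
  shows "oreg (n - m) (\<lambda>y. P y / Q y) t"
  unfolding oreg_def
proof (rule reg_at_cong)
  show "reg_at (\<lambda>y. (P y / twist n t y) / (Q y / twist m t y)) t"
    using assms unfolding oreg_def by (intro reg_at_divide[of "\<lambda>y. P y / twist n t y"]) auto
  show "\<forall>\<^sub>\<infinity>y. (P y / twist n t y) / (Q y / twist m t y) = P y / Q y / twist (n - m) t y"
    using MOST_twist_diff[of n m t] by eventually_elim simp
qed simp

lemma oreg_cmult: "oreg n P t \<Longrightarrow> oreg n (\<lambda>y. c * P y) t"
  using oreg_mult[of 0 "\<lambda>_. c" t n P] reg_at_const[of c t] by simp

lemma oreg_form:
  assumes "degree p \<le> n"
  shows "oreg (int n) (form_eval n p) t"
proof (cases t)
  case (Aff a)
  have "reg_at (\<lambda>y. form_eval n p y / form_eval n 1 y) t"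
    by (rule reg_at_form) (use assms in \<open>auto simp: Aff\<close>)
  moreover have "\<forall>\<^sub>\<infinity>y. form_eval n p y / form_eval n 1 y = form_eval n p y"
    using MOST_not_eq[of Infty]
  proof eventually_elim
    case (elim y)
    then show ?case by (cases y) auto
  qed
  ultimately have "reg_at (form_eval n p) t"
    by (intro reg_at_cong[where g = "form_eval n p"]) (simp_all add: Aff)
  then show ?thesis by (simp add: Aff)
next
  case Infty
  \<comment> \<open>\<open>monom 1 n\<close> is the form x ^ n, which trivializes O(n) near
    infinity. On the affine chart y ^ n, written as the polynomial 1, did the same.\<close>
  have *: "form_eval n (monom 1 n) y = twist (int n) Infty y" for y :: "'a proj_line"
    by (cases y) (auto simp: poly_monom)
  have "reg_at (\<lambda>y. form_eval n p y / form_eval n (monom 1 n) y) t"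
    by (rule reg_at_form) (use assms in \<open>auto simp: Infty degree_monom_le\<close>)
  then show ?thesis by (simp add: oreg_def * Infty)
qed

section \<open>Linear forms with a prescribed zero, and divisors\<close>

text \<open>The determinant of the homogeneous coordinate vectors (s, 1) and (1, 0) of the two
  points. It is antisymmetric, and as a function of the first point it is a linear form whose only
  zero is the second.\<close>

fun bracket :: "'k::field proj_line \<Rightarrow> 'k proj_line \<Rightarrow> 'k"
  where
    "bracket (Aff s) (Aff a) = s - a"
  | "bracket (Aff s) Infty = - 1"
  | "bracket Infty (Aff a) = 1"
  | "bracket Infty Infty = 0"

lemma bracket_eq_0_iff [simp]: "bracket y z = 0 \<longleftrightarrow> y = z"
  by (cases y; cases z) auto

lemma bracket_commute: "bracket y z = - bracket z y"
  by (cases y; cases z) auto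

lemma bracket_form: "\<exists>q. degree q \<le> 1 \<and> (\<forall>y. form_eval 1 q y = bracket y z)"
proof (cases z)
  case (Aff a)
  have "form_eval 1 [:- a, 1:] y = bracket y z" for y by (cases y) (auto simp: Aff)
  then show ?thesis by (intro exI[of _ "[:- a, 1:]"]) simp
next
  case Infty
  have "form_eval 1 [:- 1:] y = bracket y z" for y by (cases y) (auto simp: Infty)
  then show ?thesis by (intro exI[of _ "[:- 1:]"]) simp
qed

lemma prod_bracket_form:
  assumes "finite Z"
  shows "\<exists>q. degree q \<le> card Z \<and> (\<forall>y. form_eval (card Z) q y = (\<Prod>z\<in>Z. bracket y z))"
  using assms
proof induction
  case empty
  have "form_eval 0 (1 :: 'a poly) y = 1" for y by (cases y) auto
  then show ?case by (intro exI[of _ 1]) auto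
next
  case (insert z Z)
  then obtain q where q: "degree q \<le> card Z" "\<And>y. form_eval (card Z) q y = (\<Prod>z\<in>Z. bracket y z)"
    by blast
  obtain r where r: "degree r \<le> 1" "\<And>y. form_eval 1 r y = bracket y z" using bracket_form by blast
  have "degree (r * q) \<le> 1 + card Z" using degree_mult_le'[OF r(1) q(1)] .
  moreover have "form_eval (1 + card Z) (r * q) y = (\<Prod>z\<in>insert z Z. bracket y z)" for y
    using insert by (simp add: form_eval_mult[OF r(1) q(1), simplified] q r[simplified])
  ultimately show ?case using insert by (intro exI[of _ "r * q"]) simp
qed

lemma oreg_prod_bracket:
  assumes "finite Z"
  shows "oreg (int (card Z)) (\<lambda>y. \<Prod>z\<in>Z. bracket y z) t"
proof -
  obtain q where q: "degree q \<le> card Z" "\<And>y. form_eval (card Z) q y = (\<Prod>z\<in>Z. bracket y z)"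
    using prod_bracket_form[OF assms] by blast
  then show ?thesis using oreg_form[OF q(1), of t] by (simp add: q(2)[symmetric])
qed

lemma oreg_bracket: "oreg 1 (\<lambda>y. bracket y z) t"
  using oreg_prod_bracket[of "{z}" t] by simp

text \<open>Both forms vanish on \<open>Z\<close>. Scaled so as to agree at one further point, they
  differ by a form with more zeros than its degree.\<close>

lemma form_factor:
  fixes p :: "'k::alg_closed_field poly"
  assumes "degree p \<le> card Z" "finite Z" "\<And>z. z \<in> Z \<Longrightarrow> form_eval (card Z) p z = 0"
  shows "\<exists>\<alpha>. \<forall>y. form_eval (card Z) p y = \<alpha> * (\<Prod>z\<in>Z. bracket y z)"
proof -
  obtain q where q: "degree q \<le> card Z" "\<And>y. form_eval (card Z) q y = (\<Prod>z\<in>Z. bracket y z)"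
    using prod_bracket_form[OF assms(2)] by blast
  obtain y0 where y0: "y0 \<notin> Z"
    using MOST_notin[OF assms(2)] MOST_proj_line_ex by blast
  let ?v = "\<lambda>r. form_eval (card Z) r y0"
  have nz: "?v q \<noteq> 0" using q(2) y0 assms(2) by auto
  have "smult (?v q) p - smult (?v p) q = 0"
  proof (rule form_eq_0[of _ "card Z" "insert y0 Z"])
    show "degree (smult (?v q) p - smult (?v p) q) \<le> card Z"
      by (intro degree_diff_le order.trans[OF degree_smult_le] assms q)
    fix z assume "z \<in> insert y0 Z"
    then show "form_eval (card Z) (smult (?v q) p - smult (?v p) q) z = 0"
    proof
      assume z: "z \<in> Z"
      then have "form_eval (card Z) q z = 0" using q(2) assms(2) by auto
      then show ?thesis using assms(3)[OF z] by (simp add: form_eval_diff form_eval_smult)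
    qed (simp add: form_eval_diff form_eval_smult mult.commute)
  qed (use assms y0 in auto)
  then have "form_eval (card Z) (smult (?v q) p - smult (?v p) q) y = 0" for y by simp
  then have "?v q * form_eval (card Z) p y = ?v p * form_eval (card Z) q y" for y
    by (simp add: form_eval_diff form_eval_smult)
  then have "form_eval (card Z) p y = (?v p / ?v q) * (\<Prod>z\<in>Z. bracket y z)" for y
    using nz q(2) by (simp add: field_simps)
  then show ?thesis by blast
qed

lemma reg_at_power: "reg_at w t \<Longrightarrow> reg_at (\<lambda>y. w y ^ n) t"
  by (induction n) (auto intro: reg_at_const reg_at_mult)

lemma reg_at_powi:
  assumes "reg_at w t" "w t \<noteq> 0"
  shows "reg_at (\<lambda>y. w y powi k) t"
proof (cases "k \<ge> 0")
  case True
  then show ?thesis using reg_at_power[OF assms(1)] by (simp add: power_int_def)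
next
  case False
  then show ?thesis
    using reg_at_power[OF reg_at_inverse[OF assms]] by (simp add: power_int_def)
qed

lemma bracket_order:
  "\<exists>w. reg_at w t \<and> w t \<noteq> 0 \<and>
    (\<forall>\<^sub>\<infinity>y. bracket y z = w y * local_param t y powi (if z = t then 1 else 0) * twist 1 t y)"
proof (cases "z = t")
  case False
  have "reg_at (\<lambda>y. bracket y z / twist 1 t y) t" using oreg_bracket[of z t] by (simp add: oreg_def)
  moreover have "\<forall>\<^sub>\<infinity>y. bracket y z = bracket y z / twist 1 t y * local_param t y powi 0 * twist 1 t y"
    using MOST_twist_neq_0[of 1 t] by eventually_elim simp
  ultimately show ?thesis using False by (intro exI[of _ "\<lambda>y. bracket y z / twist 1 t y"]) auto
next
  case True
  \<comment> \<open>At infinity the bracket is -1 at every finite point s, while local parameter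
    times twist is (1 / s) * s = 1.\<close>
  define c :: 'a where "c = (if t = Infty then - 1 else 1)"
  have "\<forall>\<^sub>\<infinity>y. y \<noteq> Infty \<and> y \<noteq> Aff 0"
    using MOST_not_eq[of Infty] MOST_not_eq[of "Aff 0"] by eventually_elim simp
  then have "\<forall>\<^sub>\<infinity>y. bracket y z = c * local_param t y powi 1 * twist 1 t y"
  proof eventually_elim
    case (elim y)
    then show ?case using True by (cases t; cases y) (auto simp: c_def)
  qed
  then show ?thesis using True by (intro exI[of _ "\<lambda>_. c"]) (auto simp: reg_at_const c_def)
qed

text \<open>For divisor \<open>D\<close> supported on \<open>S\<close>, the product of brackets is a
  rational section with that divisor of the twist of degree sum of \<open>D\<close>. It is the model
  with which an arbitrary rational section of the same divisor is compared.\<close>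

lemma divisor_order:
  fixes D :: "'k::field proj_line \<Rightarrow> int"
  assumes "finite S"
  shows "\<exists>w. reg_at w t \<and> w t \<noteq> 0 \<and> (\<forall>\<^sub>\<infinity>y. (\<Prod>z\<in>S. bracket y z powi D z) =
    w y * local_param t y powi (if t \<in> S then D t else 0) * twist (\<Sum>z\<in>S. D z) t y)"
  using assms
proof induction
  case empty
  then show ?case by (intro exI[of _ "\<lambda>_. 1"]) (simp add: reg_at_const)
next
  case (insert z S)
  then obtain w where w: "reg_at w t" "w t \<noteq> 0" "\<forall>\<^sub>\<infinity>y. (\<Prod>z\<in>S. bracket y z powi D z) =
    w y * local_param t y powi (if t \<in> S then D t else 0) * twist (\<Sum>z\<in>S. D z) t y" by blast
  obtain v where v: "reg_at v t" "v t \<noteq> 0"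
    "\<forall>\<^sub>\<infinity>y. bracket y z = v y * local_param t y powi (if z = t then 1 else 0) * twist 1 t y"
    using bracket_order by blast
  let ?w = "\<lambda>y. w y * (v y powi D z)"
  have "\<forall>\<^sub>\<infinity>y. (\<Prod>z\<in>insert z S. bracket y z powi D z) =
    ?w y * local_param t y powi (if t \<in> insert z S then D t else 0) * twist (\<Sum>z\<in>insert z S. D z) t y"
    using w(3) v(3) MOST_twist_add[of "D z" "sum D S" t]
  proof eventually_elim
    case (elim y)
    show ?case
    proof (cases "z = t")
      case True
      then have "t \<notin> S" using insert by auto
      then show ?thesis using elim insert True
        by (simp add: power_int_mult_distrib twist_powi)
    next
      case False
      then show ?thesis using elim insert
        by (simp add: power_int_mult_distrib twist_powi)
    qed
  qed
  moreover have "reg_at ?w t" using w v by (intro reg_at_mult reg_at_powi)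
  moreover have "?w t \<noteq> 0" using w v by simp
  ultimately show ?case by blast
qed

text \<open>
  Write the function as a quotient of polynomials with denominator of least degree: a root of the
  denominator would also be a root of the numerator.
\<close>

lemma reg_everywhere_affine:
  fixes P :: "'k::alg_closed_field proj_line \<Rightarrow> 'k"
  assumes "\<And>a. reg_at P (Aff a)"
  shows "\<exists>p. \<forall>a. P (Aff a) = poly p a"
proof -
  define A where "A = (\<lambda>k. \<exists>p q. q \<noteq> 0 \<and> degree q = k \<and>
    (\<forall>\<^sub>\<infinity>y. P y = form_eval (max (degree p) (degree q)) p y / form_eval (max (degree p) (degree q)) q y))"
  have aff: "form_eval n p y / form_eval n q y = form_eval m p y / form_eval m q y"
    if "y \<noteq> Infty" for n m y and p q :: "'k poly" using that by (cases y) auto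
  obtain n p q where "degree p \<le> n" "degree q \<le> n"
    "\<forall>\<^sub>\<infinity>y. P y = form_eval n p y / form_eval n q y" "q \<noteq> 0"
    using assms[of 0] by (rule reg_atE)
  moreover from this(3) MOST_not_eq[of Infty]
  have "\<forall>\<^sub>\<infinity>y. P y = form_eval (max (degree p) (degree q)) p y / form_eval (max (degree p) (degree q)) q y"
    by eventually_elim (use aff in metis)
  ultimately have "A (degree q)" unfolding A_def by blast
  then have "A (LEAST k. A k)" by (rule LeastI)
  then obtain p q where pq: "q \<noteq> 0" "degree q = (LEAST k. A k)" "\<forall>\<^sub>\<infinity>y. P y =
    form_eval (max (degree p) (degree q)) p y / form_eval (max (degree p) (degree q)) q y"
    unfolding A_def by blast
  have cross: "\<exists>p' q'. p * q' = p' * q \<and> poly q' a \<noteq> 0 \<and> P (Aff a) = poly p' a / poly q' a" for a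
  proof -
    obtain m p' q' where *: "degree p' \<le> m" "degree q' \<le> m" "form_eval m q' (Aff a) \<noteq> 0"
      "P (Aff a) = form_eval m p' (Aff a) / form_eval m q' (Aff a)"
      "\<forall>\<^sub>\<infinity>y. P y = form_eval m p' y / form_eval m q' y" "q' \<noteq> 0"
      using assms[of a] by (rule reg_atE)
    have "\<forall>\<^sub>\<infinity>y. form_eval (max (degree p) (degree q)) p y / form_eval (max (degree p) (degree q)) q y
        = form_eval m p' y / form_eval m q' y"
      using pq(3) *(5) by eventually_elim simp
    then have "p * q' = p' * q"
      using form_cross_mult[of p "max (degree p) (degree q)" q p' m q'] * pq(1) by simp
    then show ?thesis using * by (intro exI[of _ p'] exI[of _ q']) auto
  qed
  have "degree q = 0"
  proof (rule ccontr)
    assume "degree q \<noteq> 0"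
    then obtain a where a: "poly q a = 0" using alg_closed_imp_poly_has_root by blast
    obtain p' q' where c: "p * q' = p' * q" "poly q' a \<noteq> 0" using cross by blast
    have "poly p a * poly q' a = 0" using c(1) a by (metis poly_mult mult_zero_right)
    then have "poly p a = 0" using c by simp
    then obtain p1 where p1: "p = [:- a, 1:] * p1" using poly_eq_0_iff_dvd by (metis dvdE)
    obtain q1 where q1: "q = [:- a, 1:] * q1" using a poly_eq_0_iff_dvd by (metis dvdE)
    have "q1 \<noteq> 0" using pq(1) q1 by auto
    then have deg: "degree q = Suc (degree q1)" unfolding q1 by (subst degree_mult_eq) auto
    have "\<forall>\<^sub>\<infinity>y. P y = form_eval (max (degree p1) (degree q1)) p1 y / form_eval (max (degree p1) (degree q1)) q1 y"
      using pq(3) MOST_not_eq[of Infty] MOST_not_eq[of "Aff a"]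
    proof eventually_elim
      case (elim y)
      then obtain s where "y = Aff s" "s \<noteq> a" by (cases y) auto
      then show ?case using elim(1) by (simp add: p1 q1 poly_mult del: mult_pCons_left)
    qed
    then have "A (degree q1)" unfolding A_def using \<open>q1 \<noteq> 0\<close> by blast
    then have "degree q \<le> degree q1" unfolding pq(2) by (rule Least_le)
    then show False using deg by simp
  qed
  then obtain c where q: "q = [:c:]" by (rule degree_eq_zeroE)
  with pq(1) have "c \<noteq> 0" by auto
  have "P (Aff a) = poly (smult (inverse c) p) a" for a
  proof -
    obtain p' q' where *: "p * q' = p' * q" "poly q' a \<noteq> 0" "P (Aff a) = poly p' a / poly q' a"
      using cross by blast
    from *(1) have "poly (p * q') a = poly (p' * q) a" by simp
    then have "poly p a * poly q' a = c * poly p' a" by (simp add: q)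
    then have "poly p' a = poly p a * poly q' a / c" using \<open>c \<noteq> 0\<close> by (simp add: field_simps)
    then show ?thesis using *(2,3) by (simp add: divide_inverse mult.commute)
  qed
  then show ?thesis by blast
qed

text \<open>The global sections of O(n) are the forms of degree \<open>n\<close>. Regularity at
  finite points makes \<open>P\<close> polynomial there; regularity at infinity bounds the degree
  and fixes the remaining value.\<close>

lemma oreg_everywhere:
  fixes P :: "'k::alg_closed_field proj_line \<Rightarrow> 'k"
  assumes "\<And>t. oreg n P t"
  obtains p where "P = form_eval (nat n) p" "degree p \<le> nat n" "n < 0 \<longrightarrow> p = 0"
proof -
  obtain p where p: "\<And>a. P (Aff a) = poly p a"
  proof -
    have "reg_at P (Aff a)" for a using assms[of "Aff a"] by simp
    then show ?thesis using reg_everywhere_affine that by blast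
  qed
  obtain m p' q' where *: "degree p' \<le> m" "degree q' \<le> m" "coeff q' m \<noteq> 0"
    "P Infty = coeff p' m / coeff q' m"
    "\<forall>\<^sub>\<infinity>y. P y / twist n Infty y = form_eval m p' y / form_eval m q' y" "q' \<noteq> 0"
    using assms[of Infty] unfolding oreg_def by (rule reg_atE) auto
  have dq: "degree q' = m" using *(2,3) by (simp add: le_antisym le_degree)
  \<comment> \<open>To stay among polynomials, the integer power s powi n is distributed over the
    natural exponents \<open>nat n\<close> and \<open>nat (- n)\<close>, at least one of which is
    0.\<close>
  have eq: "p * q' * monom 1 (nat (- n)) = p' * monom 1 (nat n)" (is "?l = ?r")
  proof -
    have "\<forall>\<^sub>\<infinity>y. form_eval (max (degree ?l) (degree ?r)) (?l - ?r) y = 0"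
      using *(5) MOST_not_eq[of Infty] MOST_not_eq[of "Aff 0"] MOST_form_neq_0[OF *(6,2)]
    proof eventually_elim
      case (elim y)
      then obtain s where y: "y = Aff s" "s \<noteq> 0" by (cases y) auto
      have "poly p s * poly q' s = poly p' s * s powi n"
        using elim y p by (simp add: field_simps)
      moreover have "s powi n = s ^ nat n / s ^ nat (- n)"
        using y by (simp add: power_int_def field_simps)
      ultimately show ?case using y by (simp add: poly_monom field_simps)
    qed
    then have "?l - ?r = 0" by (rule form_eq_0_MOST[rotated]) (intro degree_diff_le; simp)
    then show ?thesis by simp
  qed
  show ?thesis
  proof (cases "p = 0")
    case True
    then have "p' = 0" using eq by (simp add: monom_eq_0_iff)
    then have "P y = form_eval (nat n) 0 y" for y using p True * by (cases y) auto
    then show ?thesis by (intro that[of 0]) auto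
  next
    case False
    then have "p' \<noteq> 0" using eq *(6) by (auto simp: monom_eq_0_iff)
    have "degree ?l = degree p + m + nat (- n)" using False *(6)
      by (simp add: degree_mult_eq monom_eq_0_iff degree_monom_eq dq)
    moreover have "degree ?r = degree p' + nat n" using \<open>p' \<noteq> 0\<close>
      by (simp add: degree_mult_eq monom_eq_0_iff degree_monom_eq)
    \<comment> \<open>Here \<open>q'\<close> has degree exactly \<open>m\<close>, as it does not
      vanish at infinity. For negative \<open>n\<close> this inequality is impossible.\<close>
    ultimately have d: "degree p + nat (- n) \<le> nat n" using eq *(1) by simp
    then have n: "n \<ge> 0" "degree p \<le> nat n" by auto
    then have eq': "p * q' = p' * monom 1 (nat n)" using eq by (simp add: monom_0)
    \<comment> \<open>The coefficients of degree \<open>nat n + m\<close> of the two sides of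
      \<open>eq'\<close> compare the values at infinity.\<close>
    have "coeff (p * q') (nat n + m) = coeff p (nat n) * coeff q' m"
      by (rule coeff_mult_top) (use n * in auto)
    moreover have "coeff (p' * monom 1 (nat n)) (nat n + m) = coeff p' m"
      using coeff_mult_top[of p' m "monom 1 (nat n)" "nat n"] *(1)
      by (simp add: degree_monom_le add.commute)
    ultimately have "coeff p' m = coeff p (nat n) * coeff q' m" using eq' by simp
    then have "P Infty = coeff p (nat n)" using *(3,4) by simp
    then have "P y = form_eval (nat n) p y" for y using p by (cases y) auto
    then show ?thesis using n by (intro that[of p]) auto
  qed
qed

section \<open>Values of sections of invertible sheaves\<close>

lemma cut_cut [simp]: "cut U (cut V f) = cut (U \<inter> V) f"
  by (auto simp: cut_def)

lemma cut_eqI: "(\<And>x. x \<in> U \<Longrightarrow> f x = h x) \<Longrightarrow> cut U f = cut U h"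
  by (auto simp: cut_def)

context
  fixes X :: "('p, 'k::field) fspace"
  assumes swf: "space_with_functions X"
begin

lemma space_with_functionsD:
  assumes "openin (zar X) U"
  shows "(\<forall>f\<in>reg X U. cut U f = f) \<and> (\<forall>c. cut U (\<lambda>_. c) \<in> reg X U) \<and>
    (\<forall>f\<in>reg X U. \<forall>h\<in>reg X U. f + h \<in> reg X U \<and> f * h \<in> reg X U) \<and>
    (\<forall>V f. openin (zar X) V \<and> V \<subseteq> U \<and> f \<in> reg X U \<longrightarrow> cut V f \<in> reg X V) \<and>
    (\<forall>f\<in>reg X U. openin (zar X) {x \<in> U. f x \<noteq> 0} \<and>
      (\<lambda>x. inverse (f x)) \<in> reg X {x \<in> U. f x \<noteq> 0})"
  by (rule swf[unfolded space_with_functions_def, THEN conjunct1, THEN spec, THEN mp, OF assms])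

lemma reg_cut: "openin (zar X) U \<Longrightarrow> f \<in> reg X U \<Longrightarrow> cut U f = f"
  using space_with_functionsD[THEN conjunct1] by blast

lemma reg_const: "openin (zar X) U \<Longrightarrow> cut U (\<lambda>_. c) \<in> reg X U"
  using space_with_functionsD[THEN conjunct2, THEN conjunct1] by blast

lemma reg_add: "openin (zar X) U \<Longrightarrow> f \<in> reg X U \<Longrightarrow> h \<in> reg X U \<Longrightarrow> f + h \<in> reg X U"
  using space_with_functionsD[THEN conjunct2, THEN conjunct2, THEN conjunct1] by blast

lemma reg_mult: "openin (zar X) U \<Longrightarrow> f \<in> reg X U \<Longrightarrow> h \<in> reg X U \<Longrightarrow> f * h \<in> reg X U"
  using space_with_functionsD[THEN conjunct2, THEN conjunct2, THEN conjunct1] by blast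

lemma reg_res:
  "openin (zar X) U \<Longrightarrow> openin (zar X) V \<Longrightarrow> V \<subseteq> U \<Longrightarrow> f \<in> reg X U \<Longrightarrow> cut V f \<in> reg X V"
  using space_with_functionsD[THEN conjunct2, THEN conjunct2, THEN conjunct2, THEN conjunct1] by blast

lemma reg_inverse:
  "openin (zar X) U \<Longrightarrow> f \<in> reg X U \<Longrightarrow> (\<lambda>x. inverse (f x)) \<in> reg X {x \<in> U. f x \<noteq> 0}"
  using space_with_functionsD[THEN conjunct2, THEN conjunct2, THEN conjunct2, THEN conjunct2] by blast

lemma reg_Union:
  "(\<And>U. U \<in> \<U> \<Longrightarrow> openin (zar X) U \<and> cut U f \<in> reg X U) \<Longrightarrow> cut (\<Union>\<U>) f \<in> reg X (\<Union>\<U>)"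
  using swf[unfolded space_with_functions_def, THEN conjunct2] by blast

lemma reg_local:
  assumes "\<And>x. x \<in> U \<Longrightarrow> \<exists>W. openin (zar X) W \<and> x \<in> W \<and> W \<subseteq> U \<and> cut W f \<in> reg X W"
  shows "cut U f \<in> reg X U"
proof -
  let ?W = "{W. openin (zar X) W \<and> W \<subseteq> U \<and> cut W f \<in> reg X W}"
  have "\<Union>?W = U" using assms by blast
  moreover have "cut (\<Union>?W) f \<in> reg X (\<Union>?W)" by (rule reg_Union) auto
  ultimately show ?thesis by simp
qed

end

section \<open>Line bundles and the values of their sections\<close>

locale line_bundle =
  fixes X :: "('p, 'k::field) fspace" and L :: "('p, 'k, 'm::ab_group_add) mod_sheaf"
  assumes swf: "space_with_functions X"
    and invertible: "invertible_sheaf X L"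
begin

abbreviation "opn \<equiv> openin (zar X)"

lemma module: "module_sheaf X L"
  using invertible by (simp add: invertible_sheaf_def)

lemma module_sheafD:
  assumes "opn U"
  shows "0 \<in> sec L U \<and> (\<forall>s\<in>sec L U. - s \<in> sec L U) \<and>
    (\<forall>s\<in>sec L U. \<forall>t\<in>sec L U. s + t \<in> sec L U) \<and>
    (\<forall>f\<in>reg X U. \<forall>s\<in>sec L U. smul L U f s \<in> sec L U) \<and>
    (\<forall>f\<in>reg X U. \<forall>s\<in>sec L U. \<forall>t\<in>sec L U. smul L U f (s + t) = smul L U f s + smul L U f t) \<and>
    (\<forall>f\<in>reg X U. \<forall>h\<in>reg X U. \<forall>s\<in>sec L U.
       smul L U (f + h) s = smul L U f s + smul L U h s \<and>
       smul L U (f * h) s = smul L U f (smul L U h s)) \<and>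
    (\<forall>s\<in>sec L U. smul L U (cut U 1) s = s)"
  by (rule module[unfolded module_sheaf_def, THEN conjunct1, THEN spec, THEN mp, OF assms])

lemma module_sheaf_resD:
  assumes "opn U" "opn V" "V \<subseteq> U"
  shows "(\<forall>s\<in>sec L U. res L U V s \<in> sec L V) \<and>
    (\<forall>s\<in>sec L U. \<forall>t\<in>sec L U. res L U V (s + t) = res L U V s + res L U V t) \<and>
    (\<forall>f\<in>reg X U. \<forall>s\<in>sec L U. res L U V (smul L U f s) = smul L V (cut V f) (res L U V s))"
  by (rule module[unfolded module_sheaf_def, THEN conjunct2, THEN conjunct1, THEN spec, THEN spec,
      THEN mp, OF conjI[OF assms(1) conjI[OF assms(2,3)]]])

lemma sec_0: "opn U \<Longrightarrow> 0 \<in> sec L U"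
  by (rule module_sheafD[THEN conjunct1])

lemma sec_add: "opn U \<Longrightarrow> s \<in> sec L U \<Longrightarrow> t \<in> sec L U \<Longrightarrow> s + t \<in> sec L U"
  using module_sheafD[THEN conjunct2, THEN conjunct2, THEN conjunct1] by blast

lemma sec_smul: "opn U \<Longrightarrow> f \<in> reg X U \<Longrightarrow> s \<in> sec L U \<Longrightarrow> smul L U f s \<in> sec L U"
  using module_sheafD[THEN conjunct2, THEN conjunct2, THEN conjunct2, THEN conjunct1] by blast

lemma smul_add: "opn U \<Longrightarrow> f \<in> reg X U \<Longrightarrow> h \<in> reg X U \<Longrightarrow> s \<in> sec L U \<Longrightarrow>
    smul L U (f + h) s = smul L U f s + smul L U h s"
  using module_sheafD[THEN conjunct2, THEN conjunct2, THEN conjunct2, THEN conjunct2, THEN conjunct2, THEN conjunct1] by blast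

lemma smul_mult: "opn U \<Longrightarrow> f \<in> reg X U \<Longrightarrow> h \<in> reg X U \<Longrightarrow> s \<in> sec L U \<Longrightarrow>
    smul L U (f * h) s = smul L U f (smul L U h s)"
  using module_sheafD[THEN conjunct2, THEN conjunct2, THEN conjunct2, THEN conjunct2, THEN conjunct2, THEN conjunct1] by blast

lemma smul_1: "opn U \<Longrightarrow> s \<in> sec L U \<Longrightarrow> smul L U (cut U 1) s = s"
  using module_sheafD[THEN conjunct2, THEN conjunct2, THEN conjunct2, THEN conjunct2, THEN conjunct2, THEN conjunct2] by blast

lemma sec_res: "opn U \<Longrightarrow> opn V \<Longrightarrow> V \<subseteq> U \<Longrightarrow> s \<in> sec L U \<Longrightarrow> res L U V s \<in> sec L V"
  using module_sheaf_resD[THEN conjunct1] by blast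

lemma res_add: "opn U \<Longrightarrow> opn V \<Longrightarrow> V \<subseteq> U \<Longrightarrow> s \<in> sec L U \<Longrightarrow> t \<in> sec L U \<Longrightarrow>
    res L U V (s + t) = res L U V s + res L U V t"
  using module_sheaf_resD[THEN conjunct2, THEN conjunct1] by blast

lemma res_smul: "opn U \<Longrightarrow> opn V \<Longrightarrow> V \<subseteq> U \<Longrightarrow> f \<in> reg X U \<Longrightarrow> s \<in> sec L U \<Longrightarrow>
    res L U V (smul L U f s) = smul L V (cut V f) (res L U V s)"
  using module_sheaf_resD[THEN conjunct2, THEN conjunct2] by blast

lemma res_id: "opn U \<Longrightarrow> s \<in> sec L U \<Longrightarrow> res L U U s = s"
  using module[unfolded module_sheaf_def, THEN conjunct2, THEN conjunct2, THEN conjunct1] by blast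

lemma res_res: "opn U \<Longrightarrow> opn V \<Longrightarrow> opn W \<Longrightarrow> W \<subseteq> V \<Longrightarrow> V \<subseteq> U \<Longrightarrow> s \<in> sec L U \<Longrightarrow>
    res L V W (res L U V s) = res L U W s"
  using module[unfolded module_sheaf_def, THEN conjunct2, THEN conjunct2, THEN conjunct2, THEN conjunct1]
  by blast

lemma sheaf_axiom:
  assumes "\<And>U. U \<in> \<U> \<Longrightarrow> opn U" "\<And>U. U \<in> \<U> \<Longrightarrow> \<sigma> U \<in> sec L U"
    "\<And>U V. U \<in> \<U> \<Longrightarrow> V \<in> \<U> \<Longrightarrow> res L U (U \<inter> V) (\<sigma> U) = res L V (U \<inter> V) (\<sigma> V)"
  shows "\<exists>!s. s \<in> sec L (\<Union>\<U>) \<and> (\<forall>U\<in>\<U>. res L (\<Union>\<U>) U s = \<sigma> U)"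
proof -
  have "\<forall>\<U> \<sigma>. (\<forall>U\<in>\<U>. opn U \<and> \<sigma> U \<in> sec L U) \<and>
        (\<forall>U\<in>\<U>. \<forall>V\<in>\<U>. res L U (U \<inter> V) (\<sigma> U) = res L V (U \<inter> V) (\<sigma> V)) \<longrightarrow>
        (\<exists>!s. s \<in> sec L (\<Union>\<U>) \<and> (\<forall>U\<in>\<U>. res L (\<Union>\<U>) U s = \<sigma> U))"
    by (rule module[unfolded module_sheaf_def, THEN conjunct2, THEN conjunct2, THEN conjunct2,
      THEN conjunct2])
  from this[THEN spec[of _ \<U>], THEN spec[of _ \<sigma>], THEN mp] assms show ?thesis by blast
qed

text \<open>Both sections glue the same family, indexed by all open sets on which they agree, so the
  uniqueness in the sheaf axiom applies.\<close>

lemma section_eqI: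
  assumes U: "opn U" and s: "s \<in> sec L U" and t: "t \<in> sec L U"
    and eq: "\<And>x. x \<in> U \<Longrightarrow> \<exists>W. opn W \<and> x \<in> W \<and> W \<subseteq> U \<and> res L U W s = res L U W t"
  shows "s = t"
proof -
  define \<W> where "\<W> = {W. opn W \<and> W \<subseteq> U \<and> res L U W s = res L U W t}"
  have un: "\<Union>\<W> = U" using eq unfolding \<W>_def by blast
  have "\<exists>!r. r \<in> sec L (\<Union>\<W>) \<and> (\<forall>W\<in>\<W>. res L (\<Union>\<W>) W r = res L U W s)"
  proof (rule sheaf_axiom)
    fix V W assume *: "V \<in> \<W>" "W \<in> \<W>"
    then have "opn V" "opn W" "V \<subseteq> U" "W \<subseteq> U" "opn (V \<inter> W)" by (auto simp: \<W>_def)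
    then show "res L V (V \<inter> W) (res L U V s) = res L W (V \<inter> W) (res L U W s)"
      by (simp add: res_res U s)
  next
    fix W assume "W \<in> \<W>"
    then have "opn W" "W \<subseteq> U" by (auto simp: \<W>_def)
    then show "opn W" "res L U W s \<in> sec L W" using U s by (auto intro: sec_res)
  qed
  moreover have "\<forall>W\<in>\<W>. res L U W t = res L U W s" by (simp add: \<W>_def)
  ultimately show ?thesis using s t unfolding un by blast
qed

lemma generator_coord:
  assumes "generator X L W e" "opn V" "V \<subseteq> W" "s \<in> sec L V"
  obtains f where "f \<in> reg X V" "s = smul L V f (res L W V e)"
  using assms unfolding generator_def bij_betw_def by blast

lemma generator_coord_unique:
  assumes "generator X L W e" "opn V" "V \<subseteq> W" "f \<in> reg X V" "h \<in> reg X V"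
    "smul L V f (res L W V e) = smul L V h (res L W V e)"
  shows "f = h"
  using assms unfolding generator_def bij_betw_def inj_on_def by blast

lemma generator_sec: "generator X L W e \<Longrightarrow> e \<in> sec L W"
  by (simp add: generator_def)

text \<open>The generators chosen at different points are unrelated. A value function is therefore
  not regular by itself, but the quotient of two of them can be.\<close>

definition triv :: "'p \<Rightarrow> 'p set \<times> 'm"
  where "triv x = (SOME (U, e). opn U \<and> x \<in> U \<and> generator X L U e)"

lemma triv:
  assumes "x \<in> pts X"
  shows "opn (fst (triv x))" "x \<in> fst (triv x)" "generator X L (fst (triv x)) (snd (triv x))"
proof -
  have "\<exists>p. case p of (U, e) \<Rightarrow> opn U \<and> x \<in> U \<and> generator X L U e"
    using invertible assms by (auto simp: invertible_sheaf_def)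
  then have "case triv x of (U, e) \<Rightarrow> opn U \<and> x \<in> U \<and> generator X L U e"
    unfolding triv_def by (rule someI_ex)
  then show "opn (fst (triv x))" "x \<in> fst (triv x)" "generator X L (fst (triv x)) (snd (triv x))"
    by (auto split: prod.splits)
qed

text \<open>The value at \<open>x\<close> of a section over \<open>U\<close>, the fibre at \<open>x\<close> being identified with the field by \<open>triv x\<close>.\<close>

definition val :: "'p set \<Rightarrow> 'm \<Rightarrow> 'p \<Rightarrow> 'k"
  where "val U s x = (THE f. f \<in> reg X (U \<inter> fst (triv x)) \<and>
    res L U (U \<inter> fst (triv x)) s =
      smul L (U \<inter> fst (triv x)) f (res L (fst (triv x)) (U \<inter> fst (triv x)) (snd (triv x)))) x"

lemma val_triv:
  assumes U: "opn U" "s \<in> sec L U" and x: "x \<in> pts X"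
    and f: "f \<in> reg X (U \<inter> fst (triv x))" "res L U (U \<inter> fst (triv x)) s =
      smul L (U \<inter> fst (triv x)) f (res L (fst (triv x)) (U \<inter> fst (triv x)) (snd (triv x)))"
  shows "val U s x = f x"
proof -
  have "(THE f. f \<in> reg X (U \<inter> fst (triv x)) \<and> res L U (U \<inter> fst (triv x)) s =
      smul L (U \<inter> fst (triv x)) f (res L (fst (triv x)) (U \<inter> fst (triv x)) (snd (triv x)))) = f"
    using generator_coord_unique[OF triv(3)[OF x], of "U \<inter> fst (triv x)"] f U triv(1)[OF x]
    by (intro the_equality) auto
  then show ?thesis by (simp add: val_def)
qed

lemma opn_pts: "opn U \<Longrightarrow> x \<in> U \<Longrightarrow> x \<in> pts X"
  using openin_subset by blast

lemma triv_coord: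
  assumes "opn U" "s \<in> sec L U" "x \<in> pts X"
  obtains f where "f \<in> reg X (U \<inter> fst (triv x))" "res L U (U \<inter> fst (triv x)) s =
      smul L (U \<inter> fst (triv x)) f (res L (fst (triv x)) (U \<inter> fst (triv x)) (snd (triv x)))"
  using generator_coord[OF triv(3)[OF assms(3)], of "U \<inter> fst (triv x)" "res L U (U \<inter> fst (triv x)) s"]
    sec_res[of U "U \<inter> fst (triv x)" s] triv(1)[OF assms(3)] assms by auto

text \<open>The generator chosen at \<open>x\<close> does not depend on the open set, so restricting
  a section merely restricts its coordinate.\<close>

lemma val_res:
  assumes U: "opn U" "opn V" "V \<subseteq> U" "s \<in> sec L U" and x: "x \<in> V"
  shows "val V (res L U V s) x = val U s x"
proof -
  have xp: "x \<in> pts X" using opn_pts U x by blast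
  let ?T = "fst (triv x)" and ?e = "snd (triv x)"
  note t = triv[OF xp]
  obtain f where f: "f \<in> reg X (U \<inter> ?T)" "res L U (U \<inter> ?T) s = smul L (U \<inter> ?T) f (res L ?T (U \<inter> ?T) ?e)"
    using triv_coord[OF U(1,4) xp] .
  have o: "opn (U \<inter> ?T)" "opn (V \<inter> ?T)" using U t by auto
  have e: "?e \<in> sec L ?T" using generator_sec t by blast
  have "res L V (V \<inter> ?T) (res L U V s) = res L (U \<inter> ?T) (V \<inter> ?T) (res L U (U \<inter> ?T) s)"
    using U o by (subst (1 2) res_res) auto
  also have "\<dots> = smul L (V \<inter> ?T) (cut (V \<inter> ?T) f) (res L (U \<inter> ?T) (V \<inter> ?T) (res L ?T (U \<inter> ?T) ?e))"
    unfolding f(2) using U o f e t by (intro res_smul sec_res) auto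
  also have "res L (U \<inter> ?T) (V \<inter> ?T) (res L ?T (U \<inter> ?T) ?e) = res L ?T (V \<inter> ?T) ?e"
    using U o e t by (intro res_res) auto
  finally have "val V (res L U V s) x = cut (V \<inter> ?T) f x"
    using U o f by (intro val_triv[OF _ _ xp] sec_res reg_res[OF swf o(1,2)]) auto
  then show ?thesis using val_triv[OF U(1,4) xp f] x t by (simp add: cut_def)
qed

lemma val_add:
  assumes U: "opn U" "s \<in> sec L U" "t \<in> sec L U" and x: "x \<in> U"
  shows "val U (s + t) x = val U s x + val U t x"
proof -
  have xp: "x \<in> pts X" using opn_pts U x by blast
  let ?T = "fst (triv x)" and ?e = "snd (triv x)"
  note tr = triv[OF xp]
  have o: "opn (U \<inter> ?T)" using U tr by auto
  obtain f where f: "f \<in> reg X (U \<inter> ?T)" "res L U (U \<inter> ?T) s = smul L (U \<inter> ?T) f (res L ?T (U \<inter> ?T) ?e)"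
    using triv_coord[OF U(1,2) xp] .
  obtain h where h: "h \<in> reg X (U \<inter> ?T)" "res L U (U \<inter> ?T) t = smul L (U \<inter> ?T) h (res L ?T (U \<inter> ?T) ?e)"
    using triv_coord[OF U(1,3) xp] .
  have e: "res L ?T (U \<inter> ?T) ?e \<in> sec L (U \<inter> ?T)" using generator_sec tr o by (intro sec_res) auto
  have "res L U (U \<inter> ?T) (s + t) = smul L (U \<inter> ?T) (f + h) (res L ?T (U \<inter> ?T) ?e)"
    using f h U o e by (simp add: res_add smul_add)
  then have "val U (s + t) x = (f + h) x"
    by (rule val_triv[OF U(1) sec_add[OF U] xp reg_add[OF swf o f(1) h(1)]])
  then show ?thesis using val_triv[OF U(1,2) xp f] val_triv[OF U(1,3) xp h] by simp
qed

lemma val_smul: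
  assumes U: "opn U" "s \<in> sec L U" "h \<in> reg X U" and x: "x \<in> U"
  shows "val U (smul L U h s) x = h x * val U s x"
proof -
  have xp: "x \<in> pts X" using opn_pts U x by blast
  let ?T = "fst (triv x)" and ?e = "snd (triv x)"
  note tr = triv[OF xp]
  have o: "opn (U \<inter> ?T)" using U tr by auto
  obtain f where f: "f \<in> reg X (U \<inter> ?T)" "res L U (U \<inter> ?T) s = smul L (U \<inter> ?T) f (res L ?T (U \<inter> ?T) ?e)"
    using triv_coord[OF U(1,2) xp] .
  have h: "cut (U \<inter> ?T) h \<in> reg X (U \<inter> ?T)" using U o by (intro reg_res[OF swf U(1)]) auto
  have e: "res L ?T (U \<inter> ?T) ?e \<in> sec L (U \<inter> ?T)" using generator_sec tr o by (intro sec_res) auto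
  have "res L U (U \<inter> ?T) (smul L U h s) = smul L (U \<inter> ?T) (cut (U \<inter> ?T) h * f) (res L ?T (U \<inter> ?T) ?e)"
    using f h U o e by (simp add: res_smul smul_mult)
  then have "val U (smul L U h s) x = (cut (U \<inter> ?T) h * f) x"
    by (rule val_triv[OF U(1) sec_smul[OF U(1,3,2)] xp reg_mult[OF swf o h f(1)]])
  then show ?thesis using val_triv[OF U(1,2) xp f] tr x by (simp add: cut_def)
qed

lemma val_0: "opn U \<Longrightarrow> x \<in> U \<Longrightarrow> val U 0 x = 0"
  using val_add[of U 0 0 x] sec_0[of U] by (metis add.right_neutral add_cancel_right_right)

lemma val_coord:
  assumes "opn W" "generator X L W e" "opn U" "U \<subseteq> W" "s \<in> sec L U"
  obtains f where "f \<in> reg X U" "\<And>x. x \<in> U \<Longrightarrow> val U s x = f x * val W e x"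
proof -
  obtain f where f: "f \<in> reg X U" "s = smul L U f (res L W U e)"
    using generator_coord[OF assms(2-5)] by blast
  have "val U s x = f x * val W e x" if "x \<in> U" for x
    unfolding f(2) using assms f that generator_sec[OF assms(2)]
    by (simp add: val_smul val_res sec_res)
  then show ?thesis using that f by blast
qed

text \<open>The generator chosen at \<open>x\<close> is a multiple of \<open>e\<close> near
  \<open>x\<close>. If \<open>e\<close> had value 0, so would that generator, whose coordinate with
  respect to itself is 1.\<close>

lemma val_generator_neq_0:
  assumes "opn W" "generator X L W e" "x \<in> W"
  shows "val W e x \<noteq> 0"
proof
  assume 0: "val W e x = 0"
  have xp: "x \<in> pts X" using opn_pts assms by blast
  let ?T = "fst (triv x)" and ?e = "snd (triv x)"
  note tr = triv[OF xp]
  have o: "opn (W \<inter> ?T)" using assms tr by auto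
  have e: "?e \<in> sec L ?T" using generator_sec tr by blast
  have e': "res L ?T (W \<inter> ?T) ?e \<in> sec L (W \<inter> ?T)"
    using generator_sec tr o by (intro sec_res) auto
  then obtain f where f: "f \<in> reg X (W \<inter> ?T)"
    "\<And>y. y \<in> W \<inter> ?T \<Longrightarrow> val (W \<inter> ?T) (res L ?T (W \<inter> ?T) ?e) y = f y * val W e y"
    using val_coord[OF assms(1,2) o] by blast
  have "val (W \<inter> ?T) (res L ?T (W \<inter> ?T) ?e) x = 0" using f(2) 0 assms(3) tr by auto
  then have v0: "val ?T ?e x = 0" using val_res[OF tr(1) o _ e] tr assms(3) by auto
  have "res L ?T (?T \<inter> ?T) ?e = smul L (?T \<inter> ?T) (cut (?T \<inter> ?T) 1) (res L ?T (?T \<inter> ?T) ?e)"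
    using tr e by (simp add: res_id smul_1)
  moreover have "cut (?T \<inter> ?T) 1 \<in> reg X (?T \<inter> ?T)"
    using reg_const[OF swf tr(1), of 1] by (simp add: one_fun_def)
  ultimately have "val ?T ?e x = cut (?T \<inter> ?T) 1 x" by (intro val_triv[OF tr(1) e xp])
  then show False using v0 tr by (simp add: cut_def)
qed

text \<open>Here reducedness enters. Near \<open>x\<close> both sections are multiples
  \<open>f\<close> and \<open>h\<close> of one generator, whose value at every nearby point is
  nonzero and cancels; so \<open>f\<close> and \<open>h\<close> agree pointwise, and regular
  functions are determined by their values.\<close>

lemma section_eq_by_val:
  assumes U: "opn U" "s \<in> sec L U" "t \<in> sec L U"
    and eq: "\<And>x. x \<in> U \<Longrightarrow> val U s x = val U t x"
  shows "s = t"
proof (rule section_eqI[OF U])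
  fix x assume x: "x \<in> U"
  then have xp: "x \<in> pts X" using opn_pts U by blast
  let ?T = "fst (triv x)" and ?e = "snd (triv x)"
  note tr = triv[OF xp]
  have o: "opn (U \<inter> ?T)" using U tr by auto
  have e: "res L ?T (U \<inter> ?T) ?e \<in> sec L (U \<inter> ?T)" using generator_sec tr o by (intro sec_res) auto
  obtain f where f: "f \<in> reg X (U \<inter> ?T)" "res L U (U \<inter> ?T) s = smul L (U \<inter> ?T) f (res L ?T (U \<inter> ?T) ?e)"
    using triv_coord[OF U(1,2) xp] .
  obtain h where h: "h \<in> reg X (U \<inter> ?T)" "res L U (U \<inter> ?T) t = smul L (U \<inter> ?T) h (res L ?T (U \<inter> ?T) ?e)"
    using triv_coord[OF U(1,3) xp] .
  have "f y = h y" if y: "y \<in> U \<inter> ?T" for y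
  proof -
    let ?v = "val (U \<inter> ?T) (res L ?T (U \<inter> ?T) ?e) y"
    have "f y * ?v = val U s y" "h y * ?v = val U t y"
      using val_smul[OF o e f(1) y] val_smul[OF o e h(1) y] val_res[OF U(1) o _ U(2) y]
        val_res[OF U(1) o _ U(3) y] f h by auto
    moreover have "?v \<noteq> 0"
      using val_res[OF tr(1) o _ generator_sec[OF tr(3)] y] val_generator_neq_0[OF tr(1,3)] y by auto
    moreover have "val U s y = val U t y" using eq y by blast
    ultimately show ?thesis by (metis mult_right_cancel)
  qed
  then have "f = h" using reg_cut[OF swf o f(1)] reg_cut[OF swf o h(1)] cut_eqI[of "U \<inter> ?T" f h] by simp
  then show "\<exists>W. opn W \<and> x \<in> W \<and> W \<subseteq> U \<and> res L U W s = res L U W t"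
    using o x tr f h by (intro exI[of _ "U \<inter> ?T"]) auto
qed

text \<open>Since values determine sections, local sections with the prescribed values agree on
  overlaps automatically.\<close>

lemma section_glue_by_val:
  assumes "\<And>x. x \<in> U \<Longrightarrow> \<exists>W t. opn W \<and> x \<in> W \<and> W \<subseteq> U \<and> t \<in> sec L W \<and> (\<forall>y\<in>W. val W t y = F y)"
  obtains s where "s \<in> sec L U" "\<And>x. x \<in> U \<Longrightarrow> val U s x = F x"
proof -
  define \<W> where "\<W> = {W. opn W \<and> W \<subseteq> U \<and> (\<exists>t\<in>sec L W. \<forall>y\<in>W. val W t y = F y)}"
  define \<sigma> where "\<sigma> W = (SOME t. t \<in> sec L W \<and> (\<forall>y\<in>W. val W t y = F y))" for W
  have \<sigma>: "\<sigma> W \<in> sec L W \<and> (\<forall>y\<in>W. val W (\<sigma> W) y = F y)" if "W \<in> \<W>" for W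
    unfolding \<sigma>_def by (rule someI_ex) (use that in \<open>auto simp: \<W>_def\<close>)
  have o: "opn W" if "W \<in> \<W>" for W using that by (simp add: \<W>_def)
  have un: "\<Union>\<W> = U"
  proof
    show "U \<subseteq> \<Union>\<W>"
    proof
      fix x assume "x \<in> U"
      from assms[OF this] show "x \<in> \<Union>\<W>" unfolding \<W>_def by blast
    qed
  qed (auto simp: \<W>_def)
  have oU: "opn U" unfolding un[symmetric] using o by (rule openin_Union)
  have "\<exists>!s. s \<in> sec L (\<Union>\<W>) \<and> (\<forall>W\<in>\<W>. res L (\<Union>\<W>) W s = \<sigma> W)"
  proof (rule sheaf_axiom)
    fix V W assume *: "V \<in> \<W>" "W \<in> \<W>"
    then have o': "opn (V \<inter> W)" using o by auto
    show "res L V (V \<inter> W) (\<sigma> V) = res L W (V \<inter> W) (\<sigma> W)"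
      by (rule section_eq_by_val[OF o']) (use * o o' \<sigma> in \<open>auto simp: sec_res val_res\<close>)
  qed (use o \<sigma> in auto)
  then obtain s where s: "s \<in> sec L U" "\<And>W. W \<in> \<W> \<Longrightarrow> res L U W s = \<sigma> W"
    unfolding un by blast
  have "val U s x = F x" if x: "x \<in> U" for x
  proof -
    obtain W where W: "W \<in> \<W>" "x \<in> W" using x un by blast
    then have "W \<subseteq> U" using un by blast
    then have "val U s x = val W (res L U W s) x" using val_res[OF oU o[OF W(1)] _ s(1) W(2)] by simp
    then show ?thesis using s(2)[OF W(1)] \<sigma>[OF W(1)] W by simp
  qed
  with s show ?thesis using that by blast
qed

text \<open>The arbitrary identification of each fibre cancels: near any point both value functions
  are regular multiples of the values of one generator.\<close>

lemma val_quotient_regular: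
  assumes U: "opn U" "s \<in> sec L U" "t \<in> sec L U" and nz: "\<And>x. x \<in> U \<Longrightarrow> val U s x \<noteq> 0"
  shows "cut U (\<lambda>x. val U t x / val U s x) \<in> reg X U"
proof (rule reg_local[OF swf])
  fix x assume x: "x \<in> U"
  then have xp: "x \<in> pts X" using opn_pts U by blast
  let ?T = "fst (triv x)" and ?e = "snd (triv x)"
  let ?W = "U \<inter> ?T"
  note tr = triv[OF xp]
  have o: "opn ?W" using U tr by auto
  have sub: "?W \<subseteq> U" "?W \<subseteq> ?T" by auto
  obtain f where f: "f \<in> reg X ?W" "\<And>y. y \<in> ?W \<Longrightarrow> val ?W (res L U ?W s) y = f y * val ?T ?e y"
    using val_coord[OF tr(1,3) o sub(2) sec_res[OF U(1) o sub(1) U(2)]] by blast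
  obtain h where h: "h \<in> reg X ?W" "\<And>y. y \<in> ?W \<Longrightarrow> val ?W (res L U ?W t) y = h y * val ?T ?e y"
    using val_coord[OF tr(1,3) o sub(2) sec_res[OF U(1) o sub(1) U(3)]] by blast
  have v: "val ?T ?e y \<noteq> 0" if "y \<in> ?W" for y using val_generator_neq_0[OF tr(1,3)] that by blast
  have f': "val U s y = f y * val ?T ?e y" if "y \<in> ?W" for y
    using f(2)[OF that] val_res[OF U(1) o sub(1) U(2) that] by simp
  have h': "val U t y = h y * val ?T ?e y" if "y \<in> ?W" for y
    using h(2)[OF that] val_res[OF U(1) o sub(1) U(3) that] by simp
  have fnz: "f y \<noteq> 0" if "y \<in> ?W" for y using nz[of y] f'[OF that] that by auto
  have "{y \<in> ?W. f y \<noteq> 0} = ?W" using fnz by auto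
  then have "h * (\<lambda>y. inverse (f y)) \<in> reg X ?W"
    using reg_mult[OF swf o h(1)] reg_inverse[OF swf o f(1)] by simp
  moreover have "cut ?W (\<lambda>x. val U t x / val U s x) = cut ?W (h * (\<lambda>y. inverse (f y)))"
    using v f' h' by (intro cut_eqI) (simp add: field_simps)
  ultimately have "cut ?W (\<lambda>x. val U t x / val U s x) \<in> reg X ?W"
    using reg_cut[OF swf o] by metis
  then show "\<exists>W. opn W \<and> x \<in> W \<and> W \<subseteq> U \<and> cut W (\<lambda>x. val U t x / val U s x) \<in> reg X W"
    using o x tr by (intro exI[of _ ?W]) auto
qed

text \<open>The isomorphism divides values by those of \<open>s\<close>; its inverse multiplies
  \<open>s\<close> by a function.\<close>

lemma nowhere_zero_imp_trivial:
  assumes s: "s \<in> sec L (pts X)" and nz: "\<And>x. x \<in> pts X \<Longrightarrow> val (pts X) s x \<noteq> 0"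
  shows "sheaf_iso X L (structure_sheaf X)"
  unfolding sheaf_iso_def
proof (intro exI conjI allI impI ballI; (elim conjE)?)
  let ?v = "val (pts X) s"
  let ?\<theta> = "\<lambda>U t. cut U (\<lambda>x. val U t x / ?v x)"
  fix U assume U: "opn U"
  have sub: "U \<subseteq> pts X" using openin_subset[OF U] .
  have sU: "res L (pts X) U s \<in> sec L U" "\<And>x. x \<in> U \<Longrightarrow> val U (res L (pts X) U s) x = ?v x"
    using sub U s by (auto intro!: sec_res val_res)
  have nzU: "?v x \<noteq> 0" if "x \<in> U" for x using nz sub that by blast
  show "bij_betw (?\<theta> U) (sec L U) (sec (structure_sheaf X) U)"
    unfolding bij_betw_def structure_sheaf_def mod_sheaf.simps
  proof (intro conjI set_eqI iffI)
    show "inj_on (?\<theta> U) (sec L U)"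
    proof (rule inj_onI)
      fix t t' assume t: "t \<in> sec L U" "t' \<in> sec L U" "?\<theta> U t = ?\<theta> U t'"
      show "t = t'"
      proof (rule section_eq_by_val[OF U t(1,2)])
        fix x assume x: "x \<in> U"
        have "?\<theta> U t x = ?\<theta> U t' x" using t(3) by metis
        then show "val U t x = val U t' x" using x nzU by (simp add: cut_def)
      qed
    qed
    fix f
    {
      assume "f \<in> ?\<theta> U ` sec L U"
      then obtain t where t: "t \<in> sec L U" "f = ?\<theta> U t" by blast
      have "?\<theta> U t = cut U (\<lambda>x. val U t x / val U (res L (pts X) U s) x)"
        using sU by (intro cut_eqI) simp
      also have "\<dots> \<in> reg X U" using U sU t nzU by (intro val_quotient_regular) auto
      finally show "f \<in> reg X U" using t by simp
    next
      assume f: "f \<in> reg X U"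
      let ?t = "smul L U f (res L (pts X) U s)"
      have "?\<theta> U ?t = cut U f" using U sU f nzU by (intro cut_eqI) (simp add: val_smul)
      then have "?\<theta> U ?t = f" using reg_cut[OF swf U f] by simp
      moreover have "?t \<in> sec L U" using U sU f by (intro sec_smul) auto
      ultimately show "f \<in> ?\<theta> U ` sec L U" by (intro image_eqI[where x = ?t and f = "?\<theta> U"]) (rule sym)
    }
  qed
  fix t assume t: "t \<in> sec L U"
  {
    fix r assume r: "r \<in> sec L U"
    show "?\<theta> U (t + r) = ?\<theta> U t + ?\<theta> U r"
      using U t r by (auto simp: cut_def fun_eq_iff val_add add_divide_distrib)
  next
    fix f assume f: "f \<in> reg X U"
    have "?\<theta> U (smul L U f t) = f * ?\<theta> U t"
      using U t f by (auto simp: cut_def fun_eq_iff val_smul)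
    then show "?\<theta> U (smul L U f t) = smul (structure_sheaf X) U f (?\<theta> U t)"
      by (simp add: structure_sheaf_def)
  next
    fix V assume V: "opn V" "V \<subseteq> U"
    have "?\<theta> V (res L U V t) = cut V (?\<theta> U t)"
      using U V t by (auto simp: cut_def fun_eq_iff val_res)
    then show "?\<theta> V (res L U V t) = res (structure_sheaf X) U V (?\<theta> U t)"
      by (simp add: structure_sheaf_def)
  }
qed

end

section \<open>Bounding the number of sections by evaluation at points\<close>

lemma homogeneous_system_nontrivial:
  fixes a :: "'b \<Rightarrow> 'z \<Rightarrow> 'k::field"
  assumes "finite Z" "finite B" "card Z < card B"
  shows "\<exists>c. (\<exists>b\<in>B. c b \<noteq> 0) \<and> (\<forall>z\<in>Z. (\<Sum>b\<in>B. c b * a b z) = 0)"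
  using assms
proof (induction Z arbitrary: B a)
  case empty
  then have "B \<noteq> {}" by auto
  then show ?case by (intro exI[of _ "\<lambda>_. 1"]) auto
next
  case (insert z Z)
  show ?case
  proof (cases "\<forall>b\<in>B. a b z = 0")
    case True
    moreover obtain c where "\<exists>b\<in>B. c b \<noteq> 0" "\<forall>z\<in>Z. (\<Sum>b\<in>B. c b * a b z) = 0"
      using insert.IH[of B a] insert.prems insert.hyps by auto
    ultimately show ?thesis by (intro exI[of _ c]) auto
  next
    case False
    then obtain b0 where b0: "b0 \<in> B" "a b0 z \<noteq> 0" by blast
    let ?B = "B - {b0}"
    \<comment> \<open>Gaussian elimination: the equation at \<open>z\<close> is solved for the
      unknown of \<open>b0\<close> and substituted into the others. The value \<open>- r\<close> of
      that unknown is restored in \<open>c'\<close>.\<close>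
    define a' where "a' b y = a b y - a b z / a b0 z * a b0 y" for b y
    have "card Z < card ?B" using insert b0 by auto
    then obtain c where c: "\<exists>b\<in>?B. c b \<noteq> 0" "\<forall>y\<in>Z. (\<Sum>b\<in>?B. c b * a' b y) = 0"
      using insert.IH[of ?B a'] insert.prems by auto
    define r where "r = (\<Sum>b\<in>?B. c b * (a b z / a b0 z))"
    define c' where "c' b = (if b = b0 then - r else c b)" for b
    have split: "(\<Sum>b\<in>B. c' b * a b y) = - r * a b0 y + (\<Sum>b\<in>?B. c b * a b y)" for y
      using insert.prems b0 by (subst sum.remove[of _ b0]) (auto simp: c'_def intro!: sum.cong)
    have "(\<Sum>b\<in>?B. c b * a' b y) = (\<Sum>b\<in>?B. c b * a b y) - r * a b0 y" for y
      by (simp add: a'_def r_def algebra_simps sum_subtractf sum_distrib_left)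
    then have "\<forall>y\<in>Z. (\<Sum>b\<in>B. c' b * a b y) = 0" using c(2) split by simp
    moreover have "(\<Sum>b\<in>B. c' b * a b z) = 0"
      unfolding split r_def using b0 by (simp add: sum_distrib_right mult.assoc)
    moreover have "\<exists>b\<in>B. c' b \<noteq> 0" using c(1) by (auto simp: c'_def)
    ultimately show ?thesis by (intro exI[of _ c']) auto
  qed
qed

context line_bundle
begin

lemma val_sum:
  assumes "opn U" "finite B" "\<And>b. b \<in> B \<Longrightarrow> s b \<in> sec L U"
  shows "(\<Sum>b\<in>B. s b) \<in> sec L U \<and> (\<forall>x\<in>U. val U (\<Sum>b\<in>B. s b) x = (\<Sum>b\<in>B. val U (s b) x))"
  using assms(2,1,3)
proof induction
  case empty
  then show ?case by (simp add: sec_0 val_0)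
next
  case (insert b B)
  then show ?case by (simp add: sec_add val_add)
qed

text \<open>Evaluation on \<open>Z\<close> is an injective linear map to a space of dimension
  \<open>card Z\<close>: any larger set of sections has a nontrivial combination vanishing on
  \<open>Z\<close>, hence zero. Only vanishing matters, so the choice of fibre coordinates is
  harmless.\<close>

lemma h0_le_card:
  assumes Z: "finite Z" "Z \<subseteq> pts X"
    and inj: "\<And>s. s \<in> sec L (pts X) \<Longrightarrow> (\<And>x. x \<in> Z \<Longrightarrow> val (pts X) s x = 0) \<Longrightarrow> s = 0"
  shows "h0 X L \<le> enat (card Z)"
  unfolding h0_def
proof (rule SUP_least)
  fix B assume "B \<in> {B. independent_sections X L B}"
  then have B: "finite B" "B \<subseteq> sec L (pts X)"
    "\<And>c. (\<Sum>b\<in>B. smul L (pts X) (cut (pts X) (\<lambda>_. c b)) b) = 0 \<Longrightarrow> \<forall>b\<in>B. c b = 0"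
    by (auto simp: independent_sections_def)
  have o: "opn (pts X)" by simp
  show "enat (card B) \<le> enat (card Z)"
  proof (rule ccontr)
    assume "\<not> ?thesis"
    then have "card Z < card B" by simp
    then obtain c where c: "\<exists>b\<in>B. c b \<noteq> 0" "\<forall>z\<in>Z. (\<Sum>b\<in>B. c b * val (pts X) b z) = 0"
      using homogeneous_system_nontrivial[OF Z(1) B(1), of "val (pts X)"] by blast
    let ?s = "\<lambda>b. smul L (pts X) (cut (pts X) (\<lambda>_. c b)) b"
    have k: "cut (pts X) (\<lambda>_. c b) \<in> reg X (pts X)" for b by (rule reg_const[OF swf o])
    have sec: "?s b \<in> sec L (pts X)" if "b \<in> B" for b
      using that B(2) k by (intro sec_smul) auto
    have v: "val (pts X) (?s b) x = c b * val (pts X) b x" if "b \<in> B" "x \<in> pts X" for b x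
      using val_smul[OF o _ k that(2), of b b] that B(2) by (auto simp: cut_def)
    note sm = val_sum[OF o B(1), of ?s, OF sec]
    have "(\<Sum>b\<in>B. ?s b) = 0"
    proof (rule inj)
      fix x assume x: "x \<in> Z"
      then have "val (pts X) (\<Sum>b\<in>B. ?s b) x = (\<Sum>b\<in>B. c b * val (pts X) b x)"
        using sm Z v by (subst sm[THEN conjunct2, rule_format]) (auto intro!: sum.cong)
      then show "val (pts X) (\<Sum>b\<in>B. ?s b) x = 0" using c x by simp
    qed (use sm in blast)
    from B(3)[OF this] c(1) show False by blast
  qed
qed

end

section \<open>Curves glued from projective lines\<close>

text \<open>The common description of blow-ups, which satisfy it by construction, and of binary
  curves, for which it is proved from the nodes being ordinary. Regularity is phrased with germs so
  that it can be checked point by point.\<close>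

definition glued_from ::
    "('p, 'k::alg_closed_field) fspace \<Rightarrow> 'c set \<Rightarrow> ('c \<Rightarrow> 'k proj_line \<Rightarrow> 'p) \<Rightarrow> bool"
  where "glued_from X I \<psi> \<longleftrightarrow>
    (\<forall>U. openin (zar X) U \<longleftrightarrow>
      U \<subseteq> (\<Union>c\<in>I. range (\<psi> c)) \<and> (\<forall>c\<in>I. openin cofinite_topology (\<psi> c -` U))) \<and>
    (\<forall>U f. openin (zar X) U \<longrightarrow> (f \<in> reg X U \<longleftrightarrow>
      cut U f = f \<and> (\<forall>c\<in>I. \<forall>t. \<psi> c t \<in> U \<longrightarrow> reg_at (\<lambda>y. f (\<psi> c y)) t)))"

lemma openin_cofiniteI_MOST:
  assumes "\<And>t. t \<in> U \<Longrightarrow> \<forall>\<^sub>\<infinity>y. y \<in> U"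
  shows "openin cofinite_topology U"
  using assms by (cases "U = {}") (auto simp: openin_cofinite_topology eventually_cofinite Compl_eq)

lemma cut_fixed_zero: "cut U f = f \<Longrightarrow> x \<notin> U \<Longrightarrow> f x = 0"
  by (metis cut_def)

lemma glued_curve_glued_from: "glued_from (glued_curve I \<psi>) I \<psi>"
proof -
  have "f \<in> reg (glued_curve I \<psi>) U \<longleftrightarrow>
      cut U f = f \<and> (\<forall>c\<in>I. \<forall>t. \<psi> c t \<in> U \<longrightarrow> reg_at (\<lambda>y. f (\<psi> c y)) t)"
    if U: "openin (zar (glued_curve I \<psi>)) U" for U f
  proof -
    have "(\<lambda>t. f (\<psi> c t)) \<in> proj_reg (\<psi> c -` U) \<longleftrightarrow>
        (\<forall>t. \<psi> c t \<in> U \<longrightarrow> reg_at (\<lambda>y. f (\<psi> c y)) t)" if c: "c \<in> I" and f: "cut U f = f" for c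
    proof -
      have "cut (\<psi> c -` U) (\<lambda>t. f (\<psi> c t)) = (\<lambda>t. f (\<psi> c t))"
        using cut_fixed_zero[OF f] by (auto simp: cut_def fun_eq_iff)
      moreover have "openin cofinite_topology (\<psi> c -` U)" using U c by (simp add: openin_glued_curve)
      ultimately show ?thesis by (auto simp: proj_reg_iff)
    qed
    then show ?thesis by (auto simp: glued_curve_def)
  qed
  then show ?thesis unfolding glued_from_def openin_glued_curve by blast
qed

context
  fixes X :: "('p, 'k::alg_closed_field) fspace" and I :: "'c set" and \<psi> :: "'c \<Rightarrow> 'k proj_line \<Rightarrow> 'p"
  assumes glued: "glued_from X I \<psi>"
begin

lemma glued_open:
  "openin (zar X) U \<longleftrightarrow> U \<subseteq> (\<Union>c\<in>I. range (\<psi> c)) \<and> (\<forall>c\<in>I. openin cofinite_topology (\<psi> c -` U))"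
  using glued by (simp add: glued_from_def)

lemma glued_reg:
  "openin (zar X) U \<Longrightarrow> f \<in> reg X U \<longleftrightarrow>
    cut U f = f \<and> (\<forall>c\<in>I. \<forall>t. \<psi> c t \<in> U \<longrightarrow> reg_at (\<lambda>y. f (\<psi> c y)) t)"
  using glued by (simp add: glued_from_def)

lemma glued_pts: "pts X = (\<Union>c\<in>I. range (\<psi> c))"
proof
  show "pts X \<subseteq> (\<Union>c\<in>I. range (\<psi> c))" using glued_open[of "pts X"] by simp
  have "\<psi> c -` (\<Union>c\<in>I. range (\<psi> c)) = UNIV" if "c \<in> I" for c using that by auto
  then have "openin (zar X) (\<Union>c\<in>I. range (\<psi> c))"
    by (simp add: glued_open openin_cofinite_topology)
  then show "(\<Union>c\<in>I. range (\<psi> c)) \<subseteq> pts X" by (rule openin_subset)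
qed

lemma glued_MOST:
  "openin (zar X) U \<Longrightarrow> c \<in> I \<Longrightarrow> \<psi> c t \<in> U \<Longrightarrow> \<forall>\<^sub>\<infinity>y. \<psi> c y \<in> U"
  using openin_cofinite_MOST[of "\<psi> c -` U" t] by (auto simp: glued_open)

lemma glued_reg_at:
  "openin (zar X) U \<Longrightarrow> f \<in> reg X U \<Longrightarrow> c \<in> I \<Longrightarrow> \<psi> c t \<in> U \<Longrightarrow> reg_at (\<lambda>y. f (\<psi> c y)) t"
  using glued_reg by blast

lemma glued_reg_cutI:
  assumes "openin (zar X) U" "\<And>c t. c \<in> I \<Longrightarrow> \<psi> c t \<in> U \<Longrightarrow> reg_at (\<lambda>y. f (\<psi> c y)) t"
  shows "cut U f \<in> reg X U"
  unfolding glued_reg[OF assms(1)]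
proof (intro conjI ballI allI impI)
  fix c t assume *: "c \<in> I" "\<psi> c t \<in> U"
  have "\<forall>\<^sub>\<infinity>y. f (\<psi> c y) = cut U f (\<psi> c y)"
    using glued_MOST[OF assms(1) *] by eventually_elim (simp add: cut_def)
  then show "reg_at (\<lambda>y. cut U f (\<psi> c y)) t"
    using * by (intro reg_at_cong[OF assms(2)[OF *]]) (simp_all add: cut_def)
qed simp

lemma glued_nonzero_open:
  assumes U: "openin (zar X) U" and f: "f \<in> reg X U"
  shows "openin (zar X) {x \<in> U. f x \<noteq> 0}"
  unfolding glued_open
proof (intro conjI ballI openin_cofiniteI_MOST)
  show "{x \<in> U. f x \<noteq> 0} \<subseteq> (\<Union>c\<in>I. range (\<psi> c))" using U glued_open by blast
  fix c t assume c: "c \<in> I" and t: "t \<in> \<psi> c -` {x \<in> U. f x \<noteq> 0}"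
  have "reg_at (\<lambda>y. f (\<psi> c y)) t" using glued_reg_at[OF U f c] t by simp
  then have "\<forall>\<^sub>\<infinity>y. f (\<psi> c y) \<noteq> 0" by (rule MOST_neq_0_if_reg_at) (use t in simp)
  moreover have "\<forall>\<^sub>\<infinity>y. \<psi> c y \<in> U" using glued_MOST[OF U c, of t] t by simp
  ultimately show "\<forall>\<^sub>\<infinity>y. y \<in> \<psi> c -` {x \<in> U. f x \<noteq> 0}" by eventually_elim simp
qed

lemma glued_space_with_functions: "space_with_functions X"
  unfolding space_with_functions_def
proof (intro conjI allI impI ballI)
  fix U assume U: "openin (zar X) U"
  show "cut U (\<lambda>_. c) \<in> reg X U" for c by (intro glued_reg_cutI U reg_at_const)
  fix f
  {
    assume f: "f \<in> reg X U"
    then show c: "cut U f = f" using glued_reg[OF U] by blast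
    note r = glued_reg_at[OF U f]
    {
      fix h assume h: "h \<in> reg X U"
      have c': "cut U h = h" using glued_reg[OF U] h by blast
      note r' = glued_reg_at[OF U h]
      have "cut U (f + h) \<in> reg X U" unfolding plus_fun_apply
        by (intro glued_reg_cutI U) (simp add: reg_at_add r r')
      moreover have "cut U (f + h) = f + h"
        using cut_fixed_zero[OF c] cut_fixed_zero[OF c'] by (auto simp: cut_def fun_eq_iff)
      ultimately show "f + h \<in> reg X U" by simp
      have "cut U (f * h) \<in> reg X U" unfolding plus_fun_apply
        by (intro glued_reg_cutI U) (simp add: reg_at_mult r r')
      moreover have "cut U (f * h) = f * h"
        using cut_fixed_zero[OF c] by (auto simp: cut_def fun_eq_iff)
      ultimately show "f * h \<in> reg X U" by simp
    }
    show O: "openin (zar X) {x \<in> U. f x \<noteq> 0}" by (rule glued_nonzero_open[OF U f])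
    have "cut {x \<in> U. f x \<noteq> 0} (\<lambda>x. inverse (f x)) \<in> reg X {x \<in> U. f x \<noteq> 0}"
      by (intro glued_reg_cutI O reg_at_inverse r) auto
    moreover have "cut {x \<in> U. f x \<noteq> 0} (\<lambda>x. inverse (f x)) = (\<lambda>x. inverse (f x))"
      using cut_fixed_zero[OF c] by (auto simp: cut_def fun_eq_iff)
    ultimately show "(\<lambda>x. inverse (f x)) \<in> reg X {x \<in> U. f x \<noteq> 0}" by simp
  }
  fix V assume "openin (zar X) V \<and> V \<subseteq> U \<and> f \<in> reg X U"
  then show "cut V f \<in> reg X V" by (intro glued_reg_cutI) (auto intro: glued_reg_at[OF U])
next
  fix \<U> f assume *: "\<forall>U\<in>\<U>. openin (zar X) U \<and> cut U f \<in> reg X U"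
  show "cut (\<Union>\<U>) f \<in> reg X (\<Union>\<U>)"
  proof (intro glued_reg_cutI openin_Union)
    fix c t assume c: "c \<in> I" and "\<psi> c t \<in> \<Union>\<U>"
    then obtain U where U: "U \<in> \<U>" "\<psi> c t \<in> U" by blast
    then have o: "openin (zar X) U" "cut U f \<in> reg X U" using * by auto
    have "\<forall>\<^sub>\<infinity>y. cut U f (\<psi> c y) = f (\<psi> c y)"
      using glued_MOST[OF o(1) c U(2)] by eventually_elim (simp add: cut_def)
    then show "reg_at (\<lambda>y. f (\<psi> c y)) t"
      by (intro reg_at_cong[OF glued_reg_at[OF o c U(2)]]) (simp_all add: cut_def U)
  qed (use * in blast)
qed

end

section \<open>Sections on the components\<close>

locale glued_bundle = line_bundle X L
  for X :: "('p, 'k::alg_closed_field) fspace" and L :: "('p, 'k, 'm::ab_group_add) mod_sheaf" +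
  fixes I :: "'c set" and \<psi> :: "'c \<Rightarrow> 'k proj_line \<Rightarrow> 'p"
  assumes glued: "glued_from X I \<psi>"
begin

text \<open>Near \<open>t\<close> the section \<open>s\<close> is \<open>f\<close> times the
  generator, and \<open>f\<close> has the same order \<open>D t\<close> as the product
  \<open>A\<close>. The powers of the local parameter cancel and leave the unit \<open>h\<close> and
  the twist of \<open>A\<close>. The last clause gives the exact value at ordinary points
  \<open>t\<close>, about which a statement on almost all points says nothing.\<close>

lemma degree_local:
  assumes c: "c \<in> I" and V: "opn V" "s \<in> sec L V" and D: "finite {t. D t \<noteq> 0}"
    and U: "opn U" "\<psi> c t \<in> U" "generator X L U e" and f: "f \<in> reg X (U \<inter> V)"
    and eq: "res L V (U \<inter> V) s = smul L (U \<inter> V) f (res L U (U \<inter> V) e)"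
    and ord: "has_order (\<lambda>y. f (\<psi> c y)) t (D t)"
    and ne: "\<psi> c t0 \<in> V"
  defines "A \<equiv> \<lambda>y. \<Prod>z | D z \<noteq> 0. bracket y z powi D z"
  shows "\<exists>h. reg_at h t \<and> h t \<noteq> 0 \<and>
    (\<forall>\<^sub>\<infinity>y. val V s (\<psi> c y) / A y = h y * val U e (\<psi> c y) / twist (\<Sum>z | D z \<noteq> 0. D z) t y) \<and>
    (t \<noteq> Infty \<and> D t = 0 \<and> \<psi> c t \<in> V \<longrightarrow> val V s (\<psi> c t) / A t = h t * val U e (\<psi> c t))"
proof -
  have o: "opn (U \<inter> V)" using U V by blast
  have e: "e \<in> sec L U" using generator_sec U by blast
  have F: "val V s x = f x * val U e x" if "x \<in> U \<inter> V" for x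
  proof -
    have "val V s x = val (U \<inter> V) (res L V (U \<inter> V) s) x" using val_res[OF V(1) o _ V(2) that] by simp
    also have "\<dots> = f x * val (U \<inter> V) (res L U (U \<inter> V) e) x"
      unfolding eq using U by (intro val_smul o sec_res e f that) auto
    also have "val (U \<inter> V) (res L U (U \<inter> V) e) x = val U e x" using val_res[OF U(1) o _ e that] by simp
    finally show ?thesis .
  qed
  obtain u where u: "reg_at u t" "u t \<noteq> 0" "\<forall>\<^sub>\<infinity>y. f (\<psi> c y) = u y * local_param t y powi D t"
    using ord by (rule has_orderE)
  obtain w where w: "reg_at w t" "w t \<noteq> 0"
    "\<forall>\<^sub>\<infinity>y. A y = w y * local_param t y powi D t * twist (\<Sum>z | D z \<noteq> 0. D z) t y"
    using divisor_order[OF D, of t D] unfolding A_def by (auto split: if_splits)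
  have lp: "\<forall>\<^sub>\<infinity>y. local_param t y \<noteq> 0"
    using MOST_not_eq[of t] MOST_not_eq[of "Aff 0"] MOST_not_eq[of Infty]
  proof eventually_elim
    case (elim y)
    then show ?case by (cases t; cases y) auto
  qed
  have inUV: "\<forall>\<^sub>\<infinity>y. \<psi> c y \<in> U \<inter> V"
    using glued_MOST[OF glued U(1) c U(2)] glued_MOST[OF glued V(1) c ne] by eventually_elim simp
  let ?h = "\<lambda>y. u y / w y"
  have h: "reg_at ?h t" "?h t \<noteq> 0" using u w by (auto intro: reg_at_divide)
  moreover have "\<forall>\<^sub>\<infinity>y. val V s (\<psi> c y) / A y = ?h y * val U e (\<psi> c y) / twist (\<Sum>z | D z \<noteq> 0. D z) t y"
    using inUV u(3) w(3) lp
  proof eventually_elim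
    case (elim y)
    then show ?case using F[OF elim(1)] by simp
  qed
  moreover have "val V s (\<psi> c t) / A t = ?h t * val U e (\<psi> c t)"
    if t: "t \<noteq> Infty" "D t = 0" "\<psi> c t \<in> V"
  proof -
    have tUV: "\<psi> c t \<in> U \<inter> V" using t U by simp
    obtain a where a: "t = Aff a" using t by (cases t) auto
    have "reg_at (\<lambda>y. f (\<psi> c y)) t" by (rule glued_reg_at[OF glued o f c tUV])
    moreover have "\<forall>\<^sub>\<infinity>y. f (\<psi> c y) = u y" using u(3) t by simp
    ultimately have "f (\<psi> c t) = u t" by (intro reg_at_eq[OF _ u(1)])
    moreover have "A t = w t"
    proof (rule reg_at_eq)
      have "reg_at (\<lambda>y. \<Prod>z\<in>S. bracket y z powi D z) t" if "finite S" "S \<subseteq> {z. D z \<noteq> 0}" for S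
        using that
      proof induction
        case (insert z S)
        have "reg_at (\<lambda>y. bracket y z) t" using oreg_bracket[of z t] a by simp
        moreover have "bracket t z \<noteq> 0" using insert t by auto
        ultimately have "reg_at (\<lambda>y. bracket y z powi D z * (\<Prod>z\<in>S. bracket y z powi D z)) t"
          using insert by (intro reg_at_mult reg_at_powi) auto
        then show ?case using insert by simp
      qed (simp add: reg_at_const)
      then show "reg_at A t" unfolding A_def using D by blast
      show "\<forall>\<^sub>\<infinity>y. A y = w y" using w(3) t a by simp
    qed (rule w)
    ultimately show ?thesis using F[OF tUV] by simp
  qed
  ultimately show ?thesis by (intro exI[of _ ?h]) simp
qed

text \<open>An identification of the pullback of \<open>L\<close> with O(n), stored as the
  correction of the fibre coordinate at each point. As \<open>G\<close> has no zeros, it takes local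
  generators to nonvanishing local sections of O(n).\<close>

definition trivialization :: "'c \<Rightarrow> int \<Rightarrow> ('k proj_line \<Rightarrow> 'k) \<Rightarrow> bool"
  where "trivialization c n G \<longleftrightarrow> (\<forall>t. G t \<noteq> 0) \<and>
    (\<forall>U s t. opn U \<longrightarrow> s \<in> sec L U \<longrightarrow> \<psi> c t \<in> U \<longrightarrow> oreg n (\<lambda>y. val U s (\<psi> c y) / G y) t)"

text \<open>
  With \<open>s\<close> a rational section of divisor \<open>D\<close>, the function \<open>G\<close> is the quotient of the values of \<open>s\<close>
  by the form with divisor \<open>D\<close>, extended over the zeros and poles. It trades the arbitrary
  identifications of the fibres for those of \<open>\<O>(n)\<close>.
\<close>

lemma degree_trivialization:
  assumes c: "c \<in> I" and deg: "has_degree X L (\<psi> c) n"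
  shows "\<exists>G. trivialization c n G"
proof -
  obtain V s D t0 where V: "opn V" "s \<in> sec L V" "\<psi> c t0 \<in> V" "finite {t. D t \<noteq> 0}"
    "(\<Sum>t | D t \<noteq> 0. D t) = n"
    and loc: "\<forall>t. \<exists>U e f. opn U \<and> \<psi> c t \<in> U \<and> generator X L U e \<and> f \<in> reg X (U \<inter> V) \<and>
          res L V (U \<inter> V) s = smul L (U \<inter> V) f (res L U (U \<inter> V) e) \<and>
          has_order (\<lambda>y. f (\<psi> c y)) t (D t)"
    using deg unfolding has_degree_def by blast
  define A where "A y = (\<Prod>z | D z \<noteq> 0. bracket y z powi D z)" for y
  define F where "F y = val V s (\<psi> c y)" for y
  \<comment> \<open>One triple collects open set, generator and unit, so that they can be chosen
    together for every \<open>t\<close>.\<close>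
  define R where "R t z \<longleftrightarrow> (case z of (U, e, h) \<Rightarrow>
      opn U \<and> \<psi> c t \<in> U \<and> generator X L U e \<and> reg_at h t \<and> h t \<noteq> 0 \<and>
      (\<forall>\<^sub>\<infinity>y. F y / A y = h y * val U e (\<psi> c y) / twist n t y) \<and>
      (t \<noteq> Infty \<and> D t = 0 \<and> \<psi> c t \<in> V \<longrightarrow> F t / A t = h t * val U e (\<psi> c t)))" for t z
  have "\<exists>z. R t z" for t
  proof -
    obtain U e f where U: "opn U" "\<psi> c t \<in> U" "generator X L U e" "f \<in> reg X (U \<inter> V)"
      "res L V (U \<inter> V) s = smul L (U \<inter> V) f (res L U (U \<inter> V) e)"
      "has_order (\<lambda>y. f (\<psi> c y)) t (D t)" using loc by blast
    obtain h where "reg_at h t \<and> h t \<noteq> 0 \<and>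
      (\<forall>\<^sub>\<infinity>y. F y / A y = h y * val U e (\<psi> c y) / twist n t y) \<and>
      (t \<noteq> Infty \<and> D t = 0 \<and> \<psi> c t \<in> V \<longrightarrow> F t / A t = h t * val U e (\<psi> c t))"
      using degree_local[OF c V(1,2,4) U V(3)] unfolding V(5) A_def[symmetric] F_def[symmetric] ..
    then have "R t (U, e, h)" using U by (simp add: R_def)
    then show ?thesis ..
  qed
  then obtain z where z: "\<And>t. R t (z t)" by metis
  define U e h where "U t = fst (z t)" and "e t = fst (snd (z t))" and "h t = snd (snd (z t))" for t
  have "R t (U t, e t, h t)" for t using z[of t] by (simp add: U_def e_def h_def)
  then have U: "\<And>t. opn (U t)" "\<And>t. \<psi> c t \<in> U t" "\<And>t. generator X L (U t) (e t)"
    and h: "\<And>t. reg_at (h t) t" "\<And>t. h t t \<noteq> 0"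
    and F: "\<And>t. \<forall>\<^sub>\<infinity>y. F y / A y = h t y * val (U t) (e t) (\<psi> c y) / twist n t y"
    and F': "\<And>t. t \<noteq> Infty \<Longrightarrow> D t = 0 \<Longrightarrow> \<psi> c t \<in> V \<Longrightarrow> F t / A t = h t t * val (U t) (e t) (\<psi> c t)"
    by (auto simp: R_def)
  \<comment> \<open>Every point uses its own local data, so \<open>G\<close> is nonzero even at
    zeros and poles of \<open>s\<close> and at infinity. At all but finitely many points it equals
    the single rational expression \<open>F / A\<close>, which makes it comparable with the data
    chosen at any fixed \<open>t\<close>.\<close>
  define G where "G t = h t t * val (U t) (e t) (\<psi> c t)" for t
  have "\<forall>\<^sub>\<infinity>y. y \<notin> {t. D t \<noteq> 0}" using V(4) by (rule MOST_notin)
  then have "\<forall>\<^sub>\<infinity>y. G y = F y / A y"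
    using glued_MOST[OF glued V(1) c V(3)] MOST_not_eq[of Infty]
    by eventually_elim (use F' in \<open>auto simp: G_def\<close>)
  then have gen: "\<forall>\<^sub>\<infinity>y. G y = h t y * val (U t) (e t) (\<psi> c y) / twist n t y" for t
    using F[of t] by eventually_elim simp
  have nz: "G t \<noteq> 0" for t
    using h(2) val_generator_neq_0[OF U(1,3,2)] by (simp add: G_def)
  have "oreg n (\<lambda>y. val W r (\<psi> c y) / G y) t" if W: "opn W" "r \<in> sec L W" "\<psi> c t \<in> W" for W r t
  proof -
    let ?T = "W \<inter> U t"
    have o: "opn ?T" using W U by blast
    have tT: "\<psi> c t \<in> ?T" using W U by blast
    obtain k where k: "k \<in> reg X ?T" "\<And>x. x \<in> ?T \<Longrightarrow> val ?T (res L W ?T r) x = k x * val (U t) (e t) x"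
      using val_coord[OF U(1,3) o _ sec_res[OF W(1) o _ W(2)]] by blast
    have k': "val W r x = k x * val (U t) (e t) x" if "x \<in> ?T" for x
      using k(2)[OF that] val_res[OF W(1) o _ W(2) that] by simp
    \<comment> \<open>Up to the twist, the values of \<open>r\<close> and \<open>G\<close> are
      \<open>k\<close> and \<open>h t\<close> times the values of the same generator
      \<open>e t\<close>, which cancel.\<close>
    have "reg_at (\<lambda>y. k (\<psi> c y) / h t y) t"
      by (intro reg_at_divide h glued_reg_at[OF glued o k(1) c tT])
    then show ?thesis unfolding oreg_def
    proof (rule reg_at_cong)
      show "k (\<psi> c t) / h t t = val W r (\<psi> c t) / G t / twist n t t"
        using k'[OF tT] val_generator_neq_0[OF U(1,3,2), of t] by (simp add: G_def)
      show "\<forall>\<^sub>\<infinity>y. k (\<psi> c y) / h t y = val W r (\<psi> c y) / G y / twist n t y"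
        using gen[of t] glued_MOST[OF glued o c tT] MOST_twist_neq_0[of n t]
      proof eventually_elim
        case (elim y)
        have "val (U t) (e t) (\<psi> c y) \<noteq> 0" using val_generator_neq_0[OF U(1,3)] elim(2) by blast
        then show ?case using elim k'[OF elim(2)] by simp
      qed
    qed
  qed
  with nz have "trivialization c n G" by (simp add: trivialization_def)
  then show ?thesis by (rule exI[of _ G])
qed

lemma section_form:
  assumes c: "c \<in> I" and G: "trivialization c n G" and s: "s \<in> sec L (pts X)"
  obtains p where "degree p \<le> nat n" "n < 0 \<longrightarrow> p = 0"
    "\<forall>y. val (pts X) s (\<psi> c y) = G y * form_eval (nat n) p y"
proof -
  have "\<psi> c t \<in> pts X" for t using glued_pts[OF glued] c by blast
  then have "oreg n (\<lambda>y. val (pts X) s (\<psi> c y) / G y) t" for t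
    using G s by (simp add: trivialization_def)
  then obtain p where p: "(\<lambda>y. val (pts X) s (\<psi> c y) / G y) = form_eval (nat n) p"
    "degree p \<le> nat n" "n < 0 \<longrightarrow> p = 0"
    by (rule oreg_everywhere)
  have "val (pts X) s (\<psi> c y) = G y * form_eval (nat n) p y" for y
    using fun_cong[OF p(1), of y] G by (simp add: field_simps trivialization_def)
  with p(2,3) show ?thesis by (intro that[of p]) simp_all
qed

text \<open>A nonzero form of degree \<open>n\<close> has at most \<open>n\<close> zeros. For
  negative \<open>n\<close> the empty set qualifies as \<open>T\<close>.\<close>

lemma section_zero_on_component:
  assumes c: "c \<in> I" and deg: "has_degree X L (\<psi> c) n" and s: "s \<in> sec L (pts X)"
    and T: "finite T" "n < int (card T)" "\<And>t. t \<in> T \<Longrightarrow> val (pts X) s (\<psi> c t) = 0"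
  shows "val (pts X) s (\<psi> c y) = 0"
proof -
  obtain G where G: "trivialization c n G" using degree_trivialization[OF c deg] ..
  obtain p where p: "degree p \<le> nat n" "n < 0 \<longrightarrow> p = 0"
    "\<forall>y. val (pts X) s (\<psi> c y) = G y * form_eval (nat n) p y"
    by (rule section_form[OF c G s])
  have "p = 0"
  proof (cases "n < 0")
    case False
    have "form_eval (nat n) p t = 0" if "t \<in> T" for t using T(3)[OF that] p(3) G
      by (simp add: trivialization_def)
    then show ?thesis using form_eq_0[OF p(1) T(1)] T(2) False by simp
  qed (use p in blast)
  then show ?thesis using p(3) by simp
qed

text \<open>Test points for \<open>h0_le_card\<close>: \<open>T\<close> kills the section on the
  line \<open>i\<close>, hence at \<open>Q\<close>, and then \<open>Q\<close> together with
  \<open>R\<close> kills it on the line \<open>j\<close>. The truncation by \<open>nat\<close>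
  reflects that a line on which zero is already forced needs no test point.\<close>

lemma h0_le:
  assumes ij: "i \<in> I" "j \<in> I" and deg: "has_degree X L (\<psi> i) m" "has_degree X L (\<psi> j) n"
    and Q: "finite Q" "\<And>t. t \<in> Q \<Longrightarrow> \<psi> j t \<in> range (\<psi> i)"
    and det: "\<And>s. s \<in> sec L (pts X) \<Longrightarrow> (\<And>t. val (pts X) s (\<psi> i t) = 0) \<Longrightarrow>
      (\<And>t. val (pts X) s (\<psi> j t) = 0) \<Longrightarrow> s = 0"
  shows "h0 X L \<le> enat (nat (m + 1) + nat (n + 1 - int (card Q)))"
proof -
  obtain T where T: "finite T" "card T = nat (m + 1)" "T \<subseteq> (UNIV :: 'k proj_line set)"
    using infinite_arbitrarily_large[OF infinite_UNIV_proj_line] by blast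
  have "infinite (- Q)" using infinite_UNIV_proj_line Q(1) by (metis finite_compl)
  then obtain R where R: "finite R" "card R = nat (n + 1 - int (card Q))" "R \<subseteq> - Q"
    using infinite_arbitrarily_large by blast
  let ?Z = "\<psi> i ` T \<union> \<psi> j ` R"
  have "h0 X L \<le> enat (card ?Z)"
  proof (rule h0_le_card)
    show "?Z \<subseteq> pts X" using ij glued_pts[OF glued] by blast
    fix s assume s: "s \<in> sec L (pts X)" and z: "\<And>x. x \<in> ?Z \<Longrightarrow> val (pts X) s x = 0"
    have zi: "val (pts X) s (\<psi> i t) = 0" for t
      by (rule section_zero_on_component[OF ij(1) deg(1) s T(1)]) (use T z in auto)
    have "val (pts X) s (\<psi> j t) = 0" for t
    proof (rule section_zero_on_component[OF ij(2) deg(2) s])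
      show "finite (Q \<union> R)" using Q R by simp
      have "card (Q \<union> R) = card Q + card R" using Q R by (intro card_Un_disjoint) auto
      then show "n < int (card (Q \<union> R))" using R by simp
      fix t assume "t \<in> Q \<union> R"
      then show "val (pts X) s (\<psi> j t) = 0"
      proof
        assume "t \<in> Q"
        then obtain t' where "\<psi> j t = \<psi> i t'" using Q(2) by blast
        then show ?thesis using zi by simp
      qed (use z in auto)
    qed
    then show "s = 0" using det[OF s] zi by blast
  qed (use T R in simp)
  also have "card ?Z \<le> card T + card R"
    using card_Un_le[of "\<psi> i ` T" "\<psi> j ` R"] card_image_le[OF T(1), of "\<psi> i"]
      card_image_le[OF R(1), of "\<psi> j"] by linarith
  then have "enat (card ?Z) \<le> enat (nat (m + 1) + nat (n + 1 - int (card Q)))" using T R by simp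
  finally show ?thesis .
qed

end

section \<open>Binary curves are glued from their components\<close>

lemma form_divide_root:
  fixes p :: "'k::field poly"
  assumes "degree p \<le> n" "form_eval n p t = 0"
  shows "\<exists>q. degree q \<le> n - 1 \<and> (\<forall>y. form_eval n p y = bracket y t * form_eval (n - 1) q y)"
proof (cases "p = 0")
  case True
  then show ?thesis by (intro exI[of _ 0]) auto
next
  case False
  show ?thesis
  proof (cases t)
    case (Aff a)
    then have "[:- a, 1:] dvd p" using assms by (simp add: poly_eq_0_iff_dvd)
    then obtain q where q: "p = [:- a, 1:] * q" by (rule dvdE)
    with False have "q \<noteq> 0" by auto
    then have deg: "degree p = Suc (degree q)" unfolding q by (subst degree_mult_eq) auto
    then obtain m where m: "n = Suc m" "degree q \<le> m" using assms by (cases n) auto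
    have "form_eval n p y = bracket y t * form_eval (n - 1) q y" for y
    proof (cases y)
      case Infty
      have "form_eval (1 + m) ([:- a, 1:] * q) y = form_eval 1 [:- a, 1:] y * form_eval m q y"
        by (rule form_eval_mult) (use m in auto)
      then show ?thesis using m q Infty Aff by simp
    qed (simp add: q Aff left_diff_distrib)
    then show ?thesis using m by (intro exI[of _ q]) auto
  next
    case Infty
    then have c: "coeff p n = 0" using assms by simp
    then have "degree p < n" using False assms by (metis le_neq_implies_less leading_coeff_neq_0)
    \<comment> \<open>A form vanishing at infinity is the same polynomial read in degree
      \<open>n - 1\<close>. The sign comes from the bracket with infinity, which is -1 at finite
      points.\<close>
    moreover have "form_eval n p y = bracket y t * form_eval (n - 1) (- p) y" for y
      using c by (cases y) (simp_all add: Infty)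
    ultimately show ?thesis by (intro exI[of _ "- p"]) auto
  qed
qed

text \<open>The maximal ideal at \<open>t\<close> is generated by the local parameter. The numerator
  splits off \<open>bracket y t\<close>, which is the parameter up to a unit and a twist of degree
  1; the remaining fraction is a section of O(-1), which compensates the twist.\<close>

lemma reg_at_divide_local_param:
  fixes u :: "'k::alg_closed_field proj_line \<Rightarrow> 'k"
  assumes "reg_at u t" "u t = 0"
  obtains b where "reg_at b t" "\<forall>\<^sub>\<infinity>y. u y = b y * local_param t y"
proof -
  obtain n p q where u: "degree p \<le> n" "degree q \<le> n" "form_eval n q t \<noteq> 0"
    "u t = form_eval n p t / form_eval n q t" "\<forall>\<^sub>\<infinity>y. u y = form_eval n p y / form_eval n q y"
    using assms(1) by (rule reg_atE)
  then have "form_eval n p t = 0" using assms(2) by simp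
  with u(1) obtain p' where p': "degree p' \<le> n - 1"
    "\<And>y. form_eval n p y = bracket y t * form_eval (n - 1) p' y" using form_divide_root by blast
  obtain w where w: "reg_at w t" "w t \<noteq> 0"
    "\<forall>\<^sub>\<infinity>y. bracket y t = w y * local_param t y powi 1 * twist 1 t y"
    using bracket_order[of t t] by auto
  show ?thesis
  proof (cases "n = 0")
    case True
    then obtain c where "p = [:c:]" using u(1) by (metis degree_eq_zeroE le_zero_eq)
    then have "p = 0" using \<open>form_eval n p t = 0\<close> True by (cases t) auto
    then have "\<forall>\<^sub>\<infinity>y. u y = 0 * local_param t y" using u(5) by simp
    then show ?thesis by (intro that[of "\<lambda>_. 0"]) (auto simp: reg_at_const)
  next
    case False
    let ?r = "\<lambda>y. form_eval (n - 1) p' y / form_eval n q y"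
    have "oreg (int (n - 1) - int n) ?r t"
      by (intro oreg_divide oreg_form p' u)
    then have "reg_at (\<lambda>y. ?r y / twist (- 1) t y) t"
      using False by (simp add: oreg_def of_nat_diff)
    then have "reg_at (\<lambda>y. w y * (?r y / twist (- 1) t y)) t" by (intro reg_at_mult w)
    moreover have "\<forall>\<^sub>\<infinity>y. u y = w y * (?r y / twist (- 1) t y) * local_param t y"
      using u(5) w(3) MOST_twist_minus[of 1 t] MOST_twist_neq_0[of 1 t]
      by eventually_elim (simp add: p' divide_inverse mult_ac)
    ultimately show ?thesis by (rule that)
  qed
qed

section \<open>Topology and regular functions of a binary curve\<close>

context
  fixes X :: "('p, 'k::alg_closed_field) fspace" and \<phi> :: "comp \<Rightarrow> 'k proj_line \<Rightarrow> 'p" and g :: int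
  assumes bc: "binary_curve X \<phi> g"
begin

lemma binary_space: "space_with_functions X"
  and binary_immersion: "closed_immersion P1 X (\<phi> i)"
  and binary_pts: "pts X = range (\<phi> C1) \<union> range (\<phi> C2)"
  and binary_finite_sing: "finite (sing \<phi>)"
  and binary_card_sing: "int (card (sing \<phi>)) = g + 1"
  and binary_node: "P \<in> sing \<phi> \<Longrightarrow> node_at X \<phi> P"
  using bc by (auto simp: binary_curve_def)

lemma pts_P1: "pts P1 = (UNIV :: 'k proj_line set)"
  using openin_subset[of cofinite_topology "UNIV :: 'k proj_line set"]
  by (auto simp: P1_def openin_cofinite_topology)

lemma binary_embedding: "embedding_map cofinite_topology (zar X) (\<phi> i)"
  using binary_immersion[of i] by (simp add: closed_immersion_def P1_def)

lemma topspace_cofinite: "topspace cofinite_topology = (UNIV :: 'k proj_line set)"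
  using pts_P1 by (simp add: P1_def)

lemma binary_inj: "inj (\<phi> i)"
  using homeomorphic_imp_injective_map[OF binary_embedding[unfolded embedding_map_def]]
  by (simp add: topspace_cofinite)

lemma binary_closed_map: "closed_map cofinite_topology (zar X) (\<phi> i)"
  using embedding_imp_closed_map[OF binary_embedding] binary_immersion[of i]
  by (simp add: closed_immersion_def P1_def)

lemma comp_UNIV: "(UNIV :: comp set) = {C1, C2}"
  using comp.exhaust by auto

lemma binary_vimage_open: "openin (zar X) U \<Longrightarrow> openin cofinite_topology (\<phi> i -` U)"
proof -
  assume U: "openin (zar X) U"
  have "continuous_map cofinite_topology (zar X) (\<phi> i)"
    using homeomorphic_imp_continuous_map[OF binary_embedding[unfolded embedding_map_def]]
    by (simp add: continuous_map_in_subtopology)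
  from openin_continuous_map_preimage[OF this U] show ?thesis
    by (simp add: topspace_cofinite vimage_def)
qed

text \<open>For the converse, the complement of \<open>U\<close> is the union of the images of
  closed subsets of the two lines, and closed immersions are closed maps.\<close>

lemma binary_open:
  "openin (zar X) U \<longleftrightarrow> U \<subseteq> (\<Union>i. range (\<phi> i)) \<and> (\<forall>i. openin cofinite_topology (\<phi> i -` U))"
proof (intro iffI conjI allI)
  assume U: "openin (zar X) U"
  show "U \<subseteq> (\<Union>i. range (\<phi> i))" using openin_subset[OF U] binary_pts by blast
  show "openin cofinite_topology (\<phi> i -` U)" for i by (rule binary_vimage_open[OF U])
next
  assume U: "U \<subseteq> (\<Union>i. range (\<phi> i)) \<and> (\<forall>i. openin cofinite_topology (\<phi> i -` U))"
  have pts: "pts X = (\<Union>i. range (\<phi> i))" using binary_pts by (simp add: comp_UNIV)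
  have "closedin (zar X) (\<phi> i ` (- (\<phi> i -` U)))" for i
  proof -
    have "closedin cofinite_topology (- (\<phi> i -` U))"
      using U by (simp add: closedin_def topspace_cofinite Compl_eq_Diff_UNIV[symmetric])
    then show ?thesis using binary_closed_map by (simp add: closed_map_def)
  qed
  then have "closedin (zar X) (\<phi> C1 ` (- (\<phi> C1 -` U)) \<union> \<phi> C2 ` (- (\<phi> C2 -` U)))"
    by (intro closedin_Un)
  moreover have "pts X - (\<phi> C1 ` (- (\<phi> C1 -` U)) \<union> \<phi> C2 ` (- (\<phi> C2 -` U))) = U"
    using U binary_pts by (auto simp: pts comp_UNIV)
  ultimately show "openin (zar X) U" by (metis closedin_def)
qed

lemma binary_MOST: "openin (zar X) U \<Longrightarrow> \<phi> i t \<in> U \<Longrightarrow> \<forall>\<^sub>\<infinity>y. \<phi> i y \<in> U"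
  using openin_cofinite_MOST[OF binary_vimage_open, of U t i] by simp

lemma binary_reg_at:
  assumes "openin (zar X) U" "f \<in> reg X U" "\<phi> i t \<in> U"
  shows "reg_at (\<lambda>y. f (\<phi> i y)) t"
proof -
  have "cut UNIV (\<lambda>y. f (\<phi> i y)) \<in> reg P1 {y \<in> UNIV. \<phi> i y \<in> U}"
    using binary_immersion[of i] assms(1,2) unfolding closed_immersion_def pts_P1 by blast
  then have "(\<lambda>y. f (\<phi> i y)) \<in> proj_reg (\<phi> i -` U)" by (simp add: P1_def cut_def vimage_def)
  then show ?thesis using proj_reg_iff[OF binary_vimage_open[OF assms(1)]] assms(3) by blast
qed

lemma binary_extend:
  assumes "reg_at u t"
  obtains U f where "openin (zar X) U" "\<phi> i t \<in> U" "f \<in> reg X U"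
    "\<forall>\<^sub>\<infinity>y. f (\<phi> i y) = u y" "f (\<phi> i t) = u t"
proof -
  obtain W v where W: "openin cofinite_topology W" "t \<in> W" "v \<in> proj_reg W" "\<forall>y\<in>W. v y = u y"
    using reg_at_witness[OF assms] by metis
  have "\<forall>V g y. openin (zar P1) V \<and> g \<in> reg P1 V \<and> y \<in> V \<longrightarrow>
        (\<exists>U f. openin (zar X) U \<and> \<phi> i y \<in> U \<and> f \<in> reg X U \<and> (\<forall>z\<in>V. \<phi> i z \<in> U \<longrightarrow> f (\<phi> i z) = g z))"
    using binary_immersion[of i] unfolding closed_immersion_def by (elim conjE)
  from this[rule_format, of W v t] obtain U f where U: "openin (zar X) U" "\<phi> i t \<in> U" "f \<in> reg X U"
    "\<And>z. z \<in> W \<Longrightarrow> \<phi> i z \<in> U \<Longrightarrow> f (\<phi> i z) = v z"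
    using W by (auto simp: P1_def)
  have "\<forall>\<^sub>\<infinity>y. f (\<phi> i y) = u y"
    using openin_cofinite_MOST[OF W(1,2)] binary_MOST[OF U(1,2)]
    by eventually_elim (simp add: U W)
  moreover have "f (\<phi> i t) = u t" using U W by simp
  ultimately show ?thesis using U that by blast
qed

lemma binary_agree_near:
  assumes W: "openin (zar X) W" "x \<in> W" and eq: "k x = F x"
    and gen: "\<And>i. x \<in> range (\<phi> i) \<Longrightarrow> \<forall>\<^sub>\<infinity>y. k (\<phi> i y) = F (\<phi> i y)"
  obtains V where "openin (zar X) V" "x \<in> V" "V \<subseteq> W" "\<forall>y\<in>V. k y = F y"
proof -
  \<comment> \<open>Points on a component that misses \<open>x\<close> are removed, since
    \<open>gen\<close> says nothing there. For \<open>x\<close> outside the nodes this discards all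
    nodes, only finitely many points of the component through \<open>x\<close>.\<close>
  define V where "V = {y \<in> W. k y = F y \<and> (\<forall>i. y \<in> range (\<phi> i) \<longrightarrow> x \<in> range (\<phi> i))}"
  have "openin (zar X) V"
    unfolding binary_open
  proof (intro conjI allI openin_cofiniteI_MOST)
    show "V \<subseteq> (\<Union>i. range (\<phi> i))" using W binary_open by (auto simp: V_def)
    fix j t assume t: "t \<in> \<phi> j -` V"
    then have xj: "x \<in> range (\<phi> j)" by (auto simp: V_def)
    have fin: "finite (\<phi> j -` sing \<phi>)"
      by (rule finite_vimageI[OF binary_finite_sing binary_inj])
    have tW: "\<phi> j t \<in> W" using t by (simp add: V_def)
    from gen[OF xj] binary_MOST[OF W(1) tW] MOST_notin[OF fin] show "\<forall>\<^sub>\<infinity>y. y \<in> \<phi> j -` V"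
    proof eventually_elim
      case (elim y)
      have "x \<in> range (\<phi> i)" if "\<phi> j y \<in> range (\<phi> i)" for i
        using that elim(3) xj by (cases i; cases j) (auto simp: sing_def)
      then show ?case using elim by (simp add: V_def)
    qed
  qed
  then show ?thesis using W eq by (intro that[of V]) (auto simp: V_def)
qed

text \<open>
  At a node, extend the function from the first component; the error vanishes at the node on the
  second component, hence is a multiple of the function provided by \<open>node_at\<close>, which vanishes on
  the first component.
\<close>

lemma binary_regular_near:
  assumes x: "x \<in> pts X" and F: "\<And>i t. \<phi> i t = x \<Longrightarrow> reg_at (\<lambda>y. F (\<phi> i y)) t"
  obtains W where "openin (zar X) W" "x \<in> W" "cut W F \<in> reg X W"
proof -
  note swf = binary_space
  have "\<exists>W k. openin (zar X) W \<and> x \<in> W \<and> k \<in> reg X W \<and> k x = F x \<and>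
    (\<forall>i. x \<in> range (\<phi> i) \<longrightarrow> (\<forall>\<^sub>\<infinity>y. k (\<phi> i y) = F (\<phi> i y)))"
  proof (cases "x \<in> sing \<phi>")
    case False
    then obtain i t where t: "\<phi> i t = x" "\<And>j. x \<in> range (\<phi> j) \<Longrightarrow> j = i"
      using x unfolding binary_pts sing_def
      by (metis (full_types) IntI UnE comp.exhaust rangeE)
    obtain U f where "openin (zar X) U" "\<phi> i t \<in> U" "f \<in> reg X U"
      "\<forall>\<^sub>\<infinity>y. f (\<phi> i y) = F (\<phi> i y)" "f (\<phi> i t) = F (\<phi> i t)"
      by (rule binary_extend[OF F[OF t(1)]])
    then show ?thesis using t by (intro exI[of _ U] exI[of _ f]) auto
  next
    case True
    then obtain t1 t2 where t: "\<phi> C1 t1 = x" "\<phi> C2 t2 = x" by (auto simp: sing_def)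
    obtain U h where h: "openin (zar X) U" "\<phi> C1 t1 \<in> U" "h \<in> reg X U"
      "\<forall>\<^sub>\<infinity>y. h (\<phi> C1 y) = F (\<phi> C1 y)" "h (\<phi> C1 t1) = F (\<phi> C1 t1)"
      by (rule binary_extend[OF F[OF t(1)]])
    obtain U' f t' where f: "openin (zar X) U'" "x \<in> U'" "f \<in> reg X U'" "\<And>s. f (\<phi> C1 s) = 0"
      "\<phi> C2 t' = x" "has_order (\<lambda>y. f (\<phi> C2 y)) t' 1"
      using binary_node[OF True] unfolding node_at_def by blast
    have "t' = t2" using f(5) t(2) binary_inj[of C2] by (metis injD)
    then obtain a where a: "reg_at a t2" "a t2 \<noteq> 0" "\<forall>\<^sub>\<infinity>y. f (\<phi> C2 y) = a y * local_param t2 y"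
      using has_orderE[OF f(6)] by auto
    have "reg_at (\<lambda>y. F (\<phi> C2 y) - h (\<phi> C2 y)) t2"
      using t h by (intro reg_at_diff F binary_reg_at) auto
    then obtain b where b: "reg_at b t2" "\<forall>\<^sub>\<infinity>y. F (\<phi> C2 y) - h (\<phi> C2 y) = b y * local_param t2 y"
      by (rule reg_at_divide_local_param) (use t h in auto)
    \<comment> \<open>On the second component \<open>f\<close> is \<open>a\<close> times the
      parameter and the error is \<open>b\<close> times it, so a factor extending
      \<open>b / a\<close> makes \<open>f * e\<close> restrict to the error.\<close>
    obtain U'' e where e: "openin (zar X) U''" "\<phi> C2 t2 \<in> U''" "e \<in> reg X U''"
      "\<forall>\<^sub>\<infinity>y. e (\<phi> C2 y) = b y / a y"
      by (rule binary_extend[OF reg_at_divide[OF b(1) a(1,2)], of C2])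
    define W where "W = U \<inter> U' \<inter> U''"
    have W: "openin (zar X) W" "x \<in> W" using h f e t by (auto simp: W_def)
    define k where "k = cut W h + cut W f * cut W e"
    have k: "k \<in> reg X W"
      unfolding k_def using W(1) h(1,3) f(1,3) e(1,3)
      by (intro reg_add[OF swf] reg_mult[OF swf] reg_res[OF swf _ W(1)]) (auto simp: W_def)
    have kv: "k y = h y + f y * e y" if "y \<in> W" for y using that by (simp add: k_def cut_def)
    have "k x = F x" using kv[OF W(2)] f(4)[of t1] t h(5) by simp
    moreover have "\<forall>\<^sub>\<infinity>y. k (\<phi> C1 y) = F (\<phi> C1 y)"
    proof -
      have "\<forall>\<^sub>\<infinity>y. \<phi> C1 y \<in> W" by (rule binary_MOST[OF W(1), of _ t1]) (use W t in simp)
      with h(4) show ?thesis by eventually_elim (simp add: kv f(4))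
    qed
    moreover have "\<forall>\<^sub>\<infinity>y. k (\<phi> C2 y) = F (\<phi> C2 y)"
    proof -
      have "\<forall>\<^sub>\<infinity>y. \<phi> C2 y \<in> W" by (rule binary_MOST[OF W(1), of _ t2]) (use W t in simp)
      with a(3) b(2) e(4) MOST_neq_0_if_reg_at[OF a(1,2)] show ?thesis
      proof eventually_elim
        case (elim y)
        then have "k (\<phi> C2 y) = h (\<phi> C2 y) + b y * local_param t2 y" by (simp add: kv)
        then show ?case unfolding elim(2)[symmetric] by simp
      qed
    qed
    ultimately have "k x = F x \<and> (\<forall>i. \<forall>\<^sub>\<infinity>y. k (\<phi> i y) = F (\<phi> i y))"
      by (metis (full_types) comp.exhaust)
    then show ?thesis using W k by blast
  qed
  then obtain W k where k: "openin (zar X) W" "x \<in> W" "k \<in> reg X W" "k x = F x"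
    "\<And>i. x \<in> range (\<phi> i) \<Longrightarrow> \<forall>\<^sub>\<infinity>y. k (\<phi> i y) = F (\<phi> i y)" by blast
  obtain V where V: "openin (zar X) V" "x \<in> V" "V \<subseteq> W" "\<forall>y\<in>V. k y = F y"
    by (rule binary_agree_near[OF k(1,2,4,5)])
  have "cut V k \<in> reg X V" using reg_res[OF swf k(1) V(1,3) k(3)] .
  moreover have "cut V k = cut V F" using V(4) by (intro cut_eqI) blast
  ultimately show ?thesis using V that by simp
qed

text \<open>This rests on the nodes being ordinary: were the components tangent, values agreeing at
  the intersection point would not suffice for regularity.\<close>

lemma binary_glued: "glued_from X UNIV \<phi>"
proof -
  note swf = binary_space
  have "f \<in> reg X U \<longleftrightarrow> cut U f = f \<and> (\<forall>i t. \<phi> i t \<in> U \<longrightarrow> reg_at (\<lambda>y. f (\<phi> i y)) t)"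
    if U: "openin (zar X) U" for U f
  proof (intro iffI conjI allI impI)
    assume f: "f \<in> reg X U"
    show "cut U f = f" by (rule reg_cut[OF swf U f])
    show "reg_at (\<lambda>y. f (\<phi> i y)) t" if "\<phi> i t \<in> U" for i t by (rule binary_reg_at[OF U f that])
  next
    assume f: "cut U f = f \<and> (\<forall>i t. \<phi> i t \<in> U \<longrightarrow> reg_at (\<lambda>y. f (\<phi> i y)) t)"
    have "cut U f \<in> reg X U"
    proof (rule reg_local[OF swf])
      fix x assume x: "x \<in> U"
      then have "x \<in> pts X" using openin_subset[OF U] by blast
      then obtain W where W: "openin (zar X) W" "x \<in> W" "cut W f \<in> reg X W"
        by (rule binary_regular_near[where F = f]) (use f x in auto)
      have "cut (U \<inter> W) (cut W f) \<in> reg X (U \<inter> W)"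
        by (rule reg_res[OF swf W(1) _ _ W(3)]) (use U W in auto)
      then show "\<exists>W. openin (zar X) W \<and> x \<in> W \<and> W \<subseteq> U \<and> cut W f \<in> reg X W"
        using x W U by (intro exI[of _ "U \<inter> W"]) (auto simp: Int_assoc)
    qed
    then show "f \<in> reg X U" using f by simp
  qed
  then show ?thesis unfolding glued_from_def using binary_open by auto
qed

end

section \<open>The dualizing sheaf\<close>

lemma reg_at_witness_punctured:
  fixes u :: "'k::alg_closed_field proj_line \<Rightarrow> 'k"
  assumes u: "reg_at u x" and R: "\<forall>\<^sub>\<infinity>y. R y"
  shows "\<exists>W v. openin cofinite_topology W \<and> x \<in> W \<and> v \<in> proj_reg W \<and> v x = u x \<and>
    (\<forall>y\<in>W - {x}. v y = u y \<and> R y)"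
proof -
  obtain W v where W: "openin cofinite_topology W" "x \<in> W" "v \<in> proj_reg W" "\<forall>y\<in>W. v y = u y"
    using reg_at_witness[OF u] by metis
  let ?W = "{y \<in> W. y = x \<or> R y}"
  have "\<forall>\<^sub>\<infinity>y. y \<in> ?W" using openin_cofinite_MOST[OF W(1,2)] R by eventually_elim simp
  then have o: "openin cofinite_topology ?W" by (intro openin_cofiniteI_MOST)
  have "cut ?W v \<in> proj_reg ?W"
    using W(3) unfolding proj_reg_iff[OF W(1)] by (intro proj_reg_cutI[OF o]) auto
  then show ?thesis
    using o W by (intro exI[of _ ?W] exI[of _ "cut ?W v"]) (auto simp: cut_def)
qed

lemma log_residue_iff:
  fixes h :: "'k::alg_closed_field proj_line \<Rightarrow> 'k"
  shows "log_residue h x r \<longleftrightarrow> (\<exists>P. oreg (- 1) P x \<and> P x = r \<and> (\<forall>\<^sub>\<infinity>y. P y = bracket y x * h y))"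
proof -
  have *: "\<forall>\<^sub>\<infinity>y. y \<noteq> Aff 0 \<and> y \<noteq> Infty"
    using MOST_not_eq[of "Aff 0"] MOST_not_eq[of Infty] by eventually_elim simp
  have tw: "twist (- 1) x y \<noteq> 0" if "y \<noteq> Aff 0 \<and> y \<noteq> Infty" for y
    using that by (cases x; cases y) auto
  have eq: "local_param x y * diff_coeff h x y = bracket y x * h y / twist (- 1) x y"
    if y: "y \<noteq> Aff 0 \<and> y \<noteq> Infty" for y
  proof -
    obtain s where s: "y = Aff s" "s \<noteq> 0" using y by (cases y) auto
    have "s powi - 1 = inverse s" using power_int_minus[of s 1] by simp
    then show ?thesis using s by (cases x) (simp_all add: power2_eq_square divide_inverse)
  qed
  show ?thesis
  proof
    assume "log_residue h x r"
    then obtain W u where W: "openin cofinite_topology W" "x \<in> W" "u \<in> proj_reg W" "u x = r"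
      "\<forall>y\<in>W - {x}. u y = local_param x y * diff_coeff h x y" by (auto simp: log_residue_def)
    let ?P = "\<lambda>y. u y * twist (- 1) x y"
    have u: "reg_at u x" using W(2,3) proj_reg_iff[OF W(1)] by blast
    have "oreg (- 1) ?P x" unfolding oreg_def
    proof (rule reg_at_cong[OF u])
      show "\<forall>\<^sub>\<infinity>y. u y = u y * twist (- 1) x y / twist (- 1) x y"
        using * by eventually_elim (simp add: tw)
    qed simp
    moreover have "\<forall>\<^sub>\<infinity>y. ?P y = bracket y x * h y"
      using * openin_cofinite_MOST[OF W(1,2)] MOST_not_eq[of x]
    proof eventually_elim
      case (elim y)
      then have "u y = bracket y x * h y / twist (- 1) x y" using W(5) eq by simp
      then show ?case using tw[OF elim(1)] by simp
    qed
    ultimately show "\<exists>P. oreg (- 1) P x \<and> P x = r \<and> (\<forall>\<^sub>\<infinity>y. P y = bracket y x * h y)"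
      using W(4) by (intro exI[of _ ?P]) simp
  next
    assume "\<exists>P. oreg (- 1) P x \<and> P x = r \<and> (\<forall>\<^sub>\<infinity>y. P y = bracket y x * h y)"
    then obtain P where P: "oreg (- 1) P x" "P x = r" "\<forall>\<^sub>\<infinity>y. P y = bracket y x * h y" by blast
    have "\<forall>\<^sub>\<infinity>y. P y / twist (- 1) x y = local_param x y * diff_coeff h x y"
      using * P(3) by eventually_elim (simp add: eq)
    from reg_at_witness_punctured[OF P(1)[unfolded oreg_def] this]
    obtain W v where W: "openin cofinite_topology W" "x \<in> W" "v \<in> proj_reg W" "v x = P x"
      "\<forall>y\<in>W - {x}. v y = local_param x y * diff_coeff h x y" by auto
    then show "log_residue h x r" unfolding log_residue_def using P(2) by blast
  qed
qed

lemma diff_regular_at_Infty_iff: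
  fixes h :: "'k::alg_closed_field proj_line \<Rightarrow> 'k"
  shows "diff_regular_at h Infty \<longleftrightarrow> (\<exists>P. oreg (- 2) P Infty \<and> (\<forall>\<^sub>\<infinity>y. P y = h y))"
proof -
  have *: "\<forall>\<^sub>\<infinity>y. y \<noteq> Aff 0 \<and> y \<noteq> Infty"
    using MOST_not_eq[of "Aff 0"] MOST_not_eq[of Infty] by eventually_elim simp
  have tw: "twist (- 2) Infty y \<noteq> 0" if "y \<noteq> Aff 0 \<and> y \<noteq> Infty" for y
    using that by (cases y) auto
  have eq: "diff_coeff h Infty y = - h y / twist (- 2) Infty y"
    if y: "y \<noteq> Aff 0 \<and> y \<noteq> Infty" for y
  proof -
    obtain s where s: "y = Aff s" "s \<noteq> 0" using y by (cases y) auto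
    have "s powi - 2 = inverse (s ^ 2)" using power_int_minus[of s 2] by simp
    then show ?thesis using s by (simp add: divide_inverse)
  qed
  show ?thesis
  proof
    assume "diff_regular_at h Infty"
    then obtain W u where W: "openin cofinite_topology W" "Infty \<in> W" "u \<in> proj_reg W"
      "\<forall>y\<in>W - {Infty}. u y = diff_coeff h Infty y" by (auto simp: diff_regular_at_def)
    let ?P = "\<lambda>y. - u y * twist (- 2) Infty y"
    have u: "reg_at u Infty" using W(2,3) proj_reg_iff[OF W(1)] by blast
    have "oreg (- 2) ?P Infty" unfolding oreg_def
    proof (rule reg_at_cong[OF reg_at_minus[OF u]])
      show "\<forall>\<^sub>\<infinity>y. - u y = - u y * twist (- 2) Infty y / twist (- 2) Infty y"
        using * by eventually_elim (simp add: tw)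
    qed simp
    moreover have "\<forall>\<^sub>\<infinity>y. ?P y = h y"
      using * openin_cofinite_MOST[OF W(1,2)]
    proof eventually_elim
      case (elim y)
      then have "u y = - h y / twist (- 2) Infty y" using W(4) eq by simp
      then show ?case using tw[OF elim(1)] by simp
    qed
    ultimately show "\<exists>P. oreg (- 2) P Infty \<and> (\<forall>\<^sub>\<infinity>y. P y = h y)" by blast
  next
    assume "\<exists>P. oreg (- 2) P Infty \<and> (\<forall>\<^sub>\<infinity>y. P y = h y)"
    then obtain P where P: "oreg (- 2) P Infty" "\<forall>\<^sub>\<infinity>y. P y = h y" by blast
    have "\<forall>\<^sub>\<infinity>y. - (P y / twist (- 2) Infty y) = diff_coeff h Infty y"
      using * P(2) by eventually_elim (simp add: eq)
    from reg_at_witness_punctured[OF reg_at_minus[OF P(1)[unfolded oreg_def]] this]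
    obtain W v where W: "openin cofinite_topology W" "Infty \<in> W" "v \<in> proj_reg W"
      "\<forall>y\<in>W - {Infty}. v y = diff_coeff h Infty y" by auto
    then show "diff_regular_at h Infty" unfolding diff_regular_at_def by blast
  qed
qed

text \<open>Dividing a section of O(n) by \<open>n + 2\<close> linear forms gives a differential
  with at most simple poles. The factor belonging to \<open>x\<close> cancels the one in
  \<open>log_residue_iff\<close>.\<close>

lemma log_residue_quotient:
  fixes P :: "'k::alg_closed_field proj_line \<Rightarrow> 'k"
  assumes N: "finite N" "x \<in> N" "int (card N) = n + 2"
    and P: "oreg n P x" and h: "\<forall>\<^sub>\<infinity>y. h y = P y / (\<Prod>z\<in>N. bracket y z)"
  shows "log_residue h x (P x / (\<Prod>z\<in>N - {x}. bracket x z))"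
  unfolding log_residue_iff
proof (intro exI conjI)
  let ?Q = "\<lambda>y. \<Prod>z\<in>N - {x}. bracket y z"
  have "oreg (n - int (card (N - {x}))) (\<lambda>y. P y / ?Q y) x"
    using N by (intro oreg_divide P oreg_prod_bracket) auto
  moreover have "n - int (card (N - {x})) = - 1"
  proof -
    have "card N = Suc (card (N - {x}))" using N by (metis card.remove)
    then show ?thesis using N(3) by simp
  qed
  ultimately show "oreg (- 1) (\<lambda>y. P y / ?Q y) x" by simp
  show "\<forall>\<^sub>\<infinity>y. P y / ?Q y = bracket y x * h y"
    using h MOST_not_eq[of x] by eventually_elim (simp add: prod.remove[OF N(1,2)])
qed simp

lemma log_residue_numerator:
  fixes h :: "'k::alg_closed_field proj_line \<Rightarrow> 'k"
  assumes N: "finite N" "x \<in> N" "int (card N) = n + 2" and r: "log_residue h x r"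
  shows "\<exists>P. oreg n P x \<and> P x = r * (\<Prod>z\<in>N - {x}. bracket x z) \<and>
    (\<forall>\<^sub>\<infinity>y. P y = h y * (\<Prod>z\<in>N. bracket y z))"
proof -
  let ?Q = "\<lambda>y. \<Prod>z\<in>N - {x}. bracket y z"
  obtain R where R: "oreg (- 1) R x" "R x = r" "\<forall>\<^sub>\<infinity>y. R y = bracket y x * h y"
    using r by (auto simp: log_residue_iff)
  have "oreg (- 1 + int (card (N - {x}))) (\<lambda>y. R y * ?Q y) x"
    using N by (intro oreg_mult R oreg_prod_bracket) auto
  moreover have "- 1 + int (card (N - {x})) = n"
  proof -
    have "card N = Suc (card (N - {x}))" using N by (metis card.remove)
    then show ?thesis using N(3) by simp
  qed
  moreover have "\<forall>\<^sub>\<infinity>y. R y * ?Q y = h y * (\<Prod>z\<in>N. bracket y z)"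
    using R(3) by eventually_elim (simp add: prod.remove[OF N(1,2)])
  ultimately show ?thesis using R(2) by (intro exI[of _ "\<lambda>y. R y * ?Q y"]) simp
qed

lemma oreg_eq:
  fixes P Q :: "'k::alg_closed_field proj_line \<Rightarrow> 'k"
  assumes "oreg n P t" "oreg n Q t" "\<forall>\<^sub>\<infinity>y. P y = Q y"
  shows "P t = Q t"
proof -
  have "P t / twist n t t = Q t / twist n t t"
  proof (rule reg_at_eq[OF assms(1,2)[unfolded oreg_def]])
    show "\<forall>\<^sub>\<infinity>y. P y / twist n t y = Q y / twist n t y" using assms(3) by eventually_elim simp
  qed
  then show ?thesis by simp
qed

section \<open>Bundles of bidegree (g - 1, g - 1) and regular differentials\<close>

locale binary_bundle = glued_bundle X L "UNIV :: comp set" \<phi>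
  for X :: "('p, 'k::alg_closed_field) fspace" and L :: "('p, 'k, 'm::ab_group_add) mod_sheaf"
    and \<phi> :: "comp \<Rightarrow> 'k proj_line \<Rightarrow> 'p" +
  fixes g :: int
  assumes binary: "binary_curve X \<phi> g"
begin

definition nodes :: "comp \<Rightarrow> 'k proj_line set"
  where "nodes i = \<phi> i -` sing \<phi>"

lemma inj_component: "inj (\<phi> i)"
  by (rule binary_inj[OF binary])

lemma finite_nodes: "finite (nodes i)"
  unfolding nodes_def by (rule finite_vimageI[OF binary_finite_sing[OF binary] inj_component])

lemma card_nodes: "int (card (nodes i)) = g + 1"
proof -
  have "sing \<phi> \<subseteq> range (\<phi> i)" by (cases i) (auto simp: sing_def)
  then have "card (nodes i) = card (sing \<phi>)" unfolding nodes_def by (rule card_vimage_inj[OF inj_component])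
  then show ?thesis using binary_card_sing[OF binary] by simp
qed

lemma node_image: "t \<in> nodes i \<Longrightarrow> \<phi> i t \<in> range (\<phi> j)"
  by (cases j) (auto simp: nodes_def sing_def)

lemma in_pts: "\<phi> i t \<in> pts X"
  using binary_pts[OF binary] by (cases i) auto

lemma nodesI: "\<phi> C1 t1 = \<phi> C2 t2 \<Longrightarrow> t1 \<in> nodes C1 \<and> t2 \<in> nodes C2"
  by (auto simp: nodes_def sing_def) (metis rangeI)

lemma section_eq_0:
  assumes "s \<in> sec L (pts X)" "\<And>i t. val (pts X) s (\<phi> i t) = 0"
  shows "s = 0"
proof (rule section_eq_by_val)
  fix x assume x: "x \<in> pts X"
  then obtain i t where "x = \<phi> i t" using binary_pts[OF binary] by blast
  then show "val (pts X) s x = val (pts X) 0 x" using assms(2) x by (simp add: val_0)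
qed (use assms sec_0 in auto)

definition nodal_form :: "comp \<Rightarrow> 'k proj_line \<Rightarrow> 'k"
  where "nodal_form i y = (\<Prod>z\<in>nodes i. bracket y z)"

definition nodal_deriv :: "comp \<Rightarrow> 'k proj_line \<Rightarrow> 'k"
  where "nodal_deriv i t = (\<Prod>z\<in>nodes i - {t}. bracket t z)"

lemma nodal_form_eq_0_iff: "nodal_form i t = 0 \<longleftrightarrow> t \<in> nodes i"
  by (auto simp: nodal_form_def finite_nodes)

lemma nodal_deriv_neq_0: "nodal_deriv i t \<noteq> 0"
  by (auto simp: nodal_deriv_def finite_nodes)

lemma oreg_nodal_form: "oreg (g + 1) (nodal_form i) t"
  using oreg_prod_bracket[OF finite_nodes, of i t] by (simp add: nodal_form_def[abs_def] card_nodes)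

text \<open>At a node the two values of a section agree, and the residue on a branch is the value
  divided by \<open>G\<close> and by the derivative of the nodal form. The condition
  \<open>residues\<close> is what turns equal values into opposite residues.\<close>

context
  fixes G :: "comp \<Rightarrow> 'k proj_line \<Rightarrow> 'k"
  assumes G: "\<And>i. trivialization i (g - 1) (G i)"
    and residues: "\<And>t1 t2. \<phi> C1 t1 = \<phi> C2 t2 \<Longrightarrow>
      G C1 t1 * nodal_deriv C1 t1 = - (G C2 t2 * nodal_deriv C2 t2)"
begin

lemma G_neq_0: "G i t \<noteq> 0"
  using G[of i] by (simp add: trivialization_def)

lemma G_oreg: "opn U \<Longrightarrow> s \<in> sec L U \<Longrightarrow> \<phi> i t \<in> U \<Longrightarrow> oreg (g - 1) (\<lambda>y. val U s (\<phi> i y) / G i y) t"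
  using G[of i] by (simp add: trivialization_def)

definition smooth_dom :: "'p set \<Rightarrow> comp \<Rightarrow> 'k proj_line set"
  where "smooth_dom U i = {t. t \<noteq> Infty \<and> \<phi> i t \<in> U - sing \<phi>}"

definition to_diff :: "'p set \<Rightarrow> 'm \<Rightarrow> comp \<Rightarrow> 'k proj_line \<Rightarrow> 'k"
  where "to_diff U s i = cut (smooth_dom U i) (\<lambda>t. val U s (\<phi> i t) / G i t / nodal_form i t)"

lemma MOST_smooth_dom:
  assumes "opn U" "\<phi> i t \<in> U"
  shows "\<forall>\<^sub>\<infinity>y. y \<in> smooth_dom U i"
proof -
  have "\<forall>\<^sub>\<infinity>y. \<phi> i y \<in> U" using glued_MOST[OF glued assms(1) UNIV_I assms(2)] .
  then show ?thesis using MOST_not_eq[of Infty] MOST_notin[OF finite_nodes[of i]]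
    by eventually_elim (simp add: smooth_dom_def nodes_def)
qed

lemma smooth_dom_open:
  assumes "opn U"
  shows "openin cofinite_topology (smooth_dom U i)"
proof (rule openin_cofiniteI_MOST)
  fix t assume "t \<in> smooth_dom U i"
  then show "\<forall>\<^sub>\<infinity>y. y \<in> smooth_dom U i" using MOST_smooth_dom[OF assms] by (auto simp: smooth_dom_def)
qed

lemma smooth_dom_nodal: "t \<in> smooth_dom U i \<Longrightarrow> nodal_form i t \<noteq> 0"
  by (simp add: nodal_form_eq_0_iff smooth_dom_def nodes_def)

lemma MOST_to_diff:
  assumes "opn U" "\<phi> i t \<in> U"
  shows "\<forall>\<^sub>\<infinity>y. to_diff U s i y = val U s (\<phi> i y) / G i y / nodal_form i y"
  using MOST_smooth_dom[OF assms] by eventually_elim (simp add: to_diff_def cut_def)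

lemma to_diff_in:
  assumes U: "opn U" and s: "s \<in> sec L U"
  shows "to_diff U s \<in> sec (dualizing_sheaf X \<phi>) U"
proof -
  let ?P = "\<lambda>i y. val U s (\<phi> i y) / G i y"
  note P = G_oreg[OF U s]
  have "to_diff U s i \<in> proj_reg (smooth_dom U i)" for i
    unfolding to_diff_def
  proof (rule proj_reg_cutI[OF smooth_dom_open[OF U]])
    fix t assume t: "t \<in> smooth_dom U i"
    then obtain a where a: "t = Aff a" "\<phi> i t \<in> U" by (cases t) (auto simp: smooth_dom_def)
    show "reg_at (\<lambda>t. ?P i t / nodal_form i t) t"
      using P[OF a(2)] oreg_nodal_form[of i t] smooth_dom_nodal[OF t]
      by (intro reg_at_divide[of "?P i"]) (simp_all add: a(1))
  qed
  moreover have "diff_regular_at (to_diff U s i) Infty" if t: "\<phi> i Infty \<in> U - sing \<phi>" for i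
    unfolding diff_regular_at_Infty_iff
  proof (intro exI conjI)
    have "oreg ((g - 1) - (g + 1)) (\<lambda>y. ?P i y / nodal_form i y) Infty"
      using t by (intro oreg_divide P oreg_nodal_form) (auto simp: nodal_form_eq_0_iff nodes_def)
    then show "oreg (- 2) (\<lambda>y. ?P i y / nodal_form i y) Infty" by simp
    have "\<phi> i Infty \<in> U" using t by simp
    from MOST_to_diff[OF U this, of s]
    show "\<forall>\<^sub>\<infinity>y. ?P i y / nodal_form i y = to_diff U s i y" by eventually_elim simp
  qed
  moreover have "\<exists>r. log_residue (to_diff U s C1) t1 r \<and> log_residue (to_diff U s C2) t2 (- r)"
    if t: "\<phi> C1 t1 = \<phi> C2 t2" "\<phi> C1 t1 \<in> U" for t1 t2
  proof -
    have r: "log_residue (to_diff U s i) t (?P i t / nodal_deriv i t)" if "t \<in> nodes i" "\<phi> i t \<in> U" for i t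
      unfolding nodal_deriv_def
      using MOST_to_diff[OF U that(2)] card_nodes
      by (intro log_residue_quotient[OF finite_nodes that(1) _ P[OF that(2)]]) (auto simp: nodal_form_def)
    have "?P C2 t2 / nodal_deriv C2 t2 = - (?P C1 t1 / nodal_deriv C1 t1)"
      using residues[OF t(1)] t(1) by (simp add: field_simps)
    then show ?thesis using r[of t1 C1] r[of t2 C2] nodesI[OF t(1)] t by metis
  qed
  ultimately show ?thesis by (auto simp: dualizing_sheaf_def smooth_dom_def)
qed

text \<open>\<open>to_diff\<close> discards the values at infinity and at the nodes. They are
  recovered because sections of O(g - 1) that agree almost everywhere agree at every point of their
  domain.\<close>

lemma to_diff_inj: "opn U \<Longrightarrow> inj_on (to_diff U) (sec L U)"
proof (rule inj_onI)
  fix s s' assume U: "opn U" and s: "s \<in> sec L U" "s' \<in> sec L U" and eq: "to_diff U s = to_diff U s'"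
  show "s = s'"
  proof (rule section_eq_by_val[OF U s])
    fix x assume x: "x \<in> U"
    then obtain i t where it: "x = \<phi> i t" using binary_pts[OF binary] opn_pts[OF U] by blast
    have "val U s (\<phi> i t) / G i t = val U s' (\<phi> i t) / G i t"
    proof (rule oreg_eq[OF G_oreg[OF U s(1)] G_oreg[OF U s(2)]])
      show "\<forall>\<^sub>\<infinity>y. val U s (\<phi> i y) / G i y = val U s' (\<phi> i y) / G i y"
        using MOST_smooth_dom[OF U, of i t, folded it, OF x]
      proof eventually_elim
        case (elim y)
        have "to_diff U s i y = to_diff U s' i y" using eq by simp
        then show ?case using elim smooth_dom_nodal[OF elim] G_neq_0 by (simp add: to_diff_def cut_def)
      qed
    qed (use x it in auto)
    then show "val U s x = val U s' x" using G_neq_0[of i t] it by simp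
  qed
qed

lemma to_diff_surj:
  assumes U: "opn U" and \<eta>: "\<eta> \<in> sec (dualizing_sheaf X \<phi>) U"
  shows "\<exists>s\<in>sec L U. to_diff U s = \<eta>"
proof -
  have reg: "\<eta> i \<in> proj_reg (smooth_dom U i)" for i
    using \<eta> by (simp add: dualizing_sheaf_def smooth_dom_def)
  have inf: "diff_regular_at (\<eta> i) Infty" if "\<phi> i Infty \<in> U - sing \<phi>" for i
    using \<eta> that by (simp add: dualizing_sheaf_def)
  have res: "\<exists>r. log_residue (\<eta> C1) t1 r \<and> log_residue (\<eta> C2) t2 (- r)"
    if "\<phi> C1 t1 = \<phi> C2 t2" "\<phi> C1 t1 \<in> U" for t1 t2
    using \<eta> that by (simp add: dualizing_sheaf_def)
  \<comment> \<open>A germ \<open>P\<close> with this property is the numerator of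
    \<open>\<eta> i\<close> over the nodal form. At infinity and at nodes \<open>\<eta> i\<close>
    has only the default value 0, so \<open>Q\<close> takes its value from such a germ.\<close>
  define num where "num i t P \<longleftrightarrow> oreg (g - 1) P t \<and> (\<forall>\<^sub>\<infinity>y. P y = \<eta> i y * nodal_form i y)" for i t P
  define Q where "Q i t = (SOME P. num i t P) t" for i t
  have unique: "Q i t = P t" if "num i t P" for i t P
  proof -
    define P' where "P' = (SOME P. num i t P)"
    have "num i t P'" unfolding P'_def by (rule someI[of "num i t", OF that])
    then have P': "oreg (g - 1) P' t" "\<forall>\<^sub>\<infinity>y. P' y = \<eta> i y * nodal_form i y"
      by (simp_all add: num_def)
    have P: "oreg (g - 1) P t" "\<forall>\<^sub>\<infinity>y. P y = \<eta> i y * nodal_form i y"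
      using that by (simp_all add: num_def)
    have "\<forall>\<^sub>\<infinity>y. P' y = P y" using P'(2) P(2) by eventually_elim simp
    then show ?thesis unfolding Q_def P'_def[symmetric] by (rule oreg_eq[OF P'(1) P(1)])
  qed
  have card: "int (card (nodes i)) = (g - 1) + 2" for i using card_nodes by simp
  have smooth: "num i t (\<lambda>y. \<eta> i y * nodal_form i y)" if t: "t \<in> smooth_dom U i" for i t
  proof -
    obtain a where a: "t = Aff a" using t by (cases t) (auto simp: smooth_dom_def)
    have "reg_at (\<eta> i) t" using reg t proj_reg_iff[OF smooth_dom_open[OF U]] by blast
    then show ?thesis using oreg_nodal_form[of i t] reg_at_mult by (auto simp: num_def a)
  qed
  have node: "\<exists>P. num i t P \<and> P t = r * nodal_deriv i t" if "t \<in> nodes i" "log_residue (\<eta> i) t r" for i t r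
    using log_residue_numerator[OF finite_nodes that(1) card that(2)]
    by (auto simp: num_def nodal_deriv_def nodal_form_def)
  have ex: "\<exists>P. num i t P" if t: "\<phi> i t \<in> U" for i t
  proof (cases "t \<in> nodes i")
    case True
    obtain t1 t2 where 12: "\<phi> i t = \<phi> C1 t1" "\<phi> i t = \<phi> C2 t2"
      using node_image[OF True, of C1] node_image[OF True, of C2] by blast
    then obtain r where r: "log_residue (\<eta> C1) t1 r" "log_residue (\<eta> C2) t2 (- r)"
      using res[of t1 t2] t by auto
    have "t = (case i of C1 \<Rightarrow> t1 | C2 \<Rightarrow> t2)"
      using 12 injD[OF inj_component[of i]] by (cases i) auto
    then show ?thesis using node[OF True] r by (cases i) auto
  next
    case False
    show ?thesis
    proof (cases "t = Infty")
      case Inf: True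
      obtain P where P: "oreg (- 2) P Infty" "\<forall>\<^sub>\<infinity>y. P y = \<eta> i y"
        using inf[of i] t False Inf by (auto simp: diff_regular_at_Infty_iff nodes_def)
      have "oreg (- 2 + (g + 1)) (\<lambda>y. P y * nodal_form i y) Infty"
        by (intro oreg_mult P oreg_nodal_form)
      moreover have "\<forall>\<^sub>\<infinity>y. P y * nodal_form i y = \<eta> i y * nodal_form i y"
        using P(2) by eventually_elim simp
      ultimately show ?thesis by (intro exI[of _ "\<lambda>y. P y * nodal_form i y"]) (simp add: num_def Inf)
    next
      case False2: False
      then have "t \<in> smooth_dom U i" using t False by (auto simp: smooth_dom_def nodes_def)
      then show ?thesis using smooth by blast
    qed
  qed
  have Qgen: "\<forall>\<^sub>\<infinity>y. Q i y = \<eta> i y * nodal_form i y" if "\<phi> i t \<in> U" for i t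
    using MOST_smooth_dom[OF U that] by eventually_elim (rule unique[OF smooth])
  have Qreg: "oreg (g - 1) (Q i) t" if t: "\<phi> i t \<in> U" for i t
  proof -
    obtain P where P: "num i t P" using ex[OF t] by blast
    show ?thesis
    proof (rule oreg_cong)
      show "oreg (g - 1) P t" "P t = Q i t" using P unique[OF P] by (auto simp: num_def)
      show "\<forall>\<^sub>\<infinity>y. P y = Q i y"
        using Qgen[OF t] P[unfolded num_def, THEN conjunct2] by eventually_elim simp
    qed
  qed
  \<comment> \<open>The sign between the residues cancels the one in \<open>residues\<close>; hence
    the branches define one value function \<open>F\<close> on the curve.\<close>
  have match: "Q C1 t1 * G C1 t1 = Q C2 t2 * G C2 t2" if t: "\<phi> C1 t1 = \<phi> C2 t2" "\<phi> C1 t1 \<in> U" for t1 t2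
  proof -
    obtain r where r: "log_residue (\<eta> C1) t1 r" "log_residue (\<eta> C2) t2 (- r)" using res[OF t] by blast
    have "Q C1 t1 = r * nodal_deriv C1 t1" "Q C2 t2 = - r * nodal_deriv C2 t2"
      using node[OF _ r(1)] node[OF _ r(2)] nodesI[OF t(1)] unique by metis+
    then show ?thesis using residues[OF t(1)] by (simp add: algebra_simps)
  qed
  define F where "F x = (if x \<in> range (\<phi> C1) then Q C1 (inv (\<phi> C1) x) * G C1 (inv (\<phi> C1) x)
    else Q C2 (inv (\<phi> C2) x) * G C2 (inv (\<phi> C2) x))" for x
  have F: "F (\<phi> i t) = Q i t * G i t" if t: "\<phi> i t \<in> U" for i t
  proof (cases i)
    case C1
    then show ?thesis by (simp add: F_def inv_f_f[OF inj_component])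
  next
    case C2
    show ?thesis
    proof (cases "\<phi> C2 t \<in> range (\<phi> C1)")
      case True
      then obtain t1 where t1: "\<phi> C2 t = \<phi> C1 t1" by blast
      then have "F (\<phi> C2 t) = Q C1 t1 * G C1 t1" by (simp add: F_def inv_f_f[OF inj_component])
      then show ?thesis using match[of t1 t] t1 t C2 by simp
    next
      case False
      then show ?thesis using C2 by (simp add: F_def inv_f_f[OF inj_component])
    qed
  qed
  have loc: "\<exists>W t. opn W \<and> x \<in> W \<and> W \<subseteq> U \<and> t \<in> sec L W \<and> (\<forall>y\<in>W. val W t y = F y)"
    if x: "x \<in> U" for x
  proof -
    from x have xp: "x \<in> pts X" using opn_pts U by blast
    let ?T = "fst (triv x)" and ?e = "snd (triv x)"
    let ?W = "U \<inter> ?T"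
    note tr = triv[OF xp]
    have o: "opn ?W" using U tr by auto
    have e: "?e \<in> sec L ?T" using generator_sec tr by blast
    have nz: "val ?T ?e y \<noteq> 0" if "y \<in> ?W" for y using val_generator_neq_0[OF tr(1,3)] that by blast
    have k: "cut ?W (\<lambda>y. F y / val ?T ?e y) \<in> reg X ?W"
    proof (rule glued_reg_cutI[OF glued o])
      fix i t assume t: "\<phi> i t \<in> ?W"
      \<comment> \<open>The candidate and the local generator both give sections of O(g - 1), so
        their quotient is regular on each component and thus on the curve. Multiplying the generator
        by it realizes \<open>F\<close>.\<close>
      have "oreg ((g - 1) - (g - 1)) (\<lambda>y. Q i y / (val ?T ?e (\<phi> i y) / G i y)) t"
        using t nz G_neq_0 by (intro oreg_divide Qreg G_oreg tr(1) e) auto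
      then have "reg_at (\<lambda>y. Q i y / (val ?T ?e (\<phi> i y) / G i y)) t" by simp
      then show "reg_at (\<lambda>y. F (\<phi> i y) / val ?T ?e (\<phi> i y)) t"
      proof (rule reg_at_cong)
        show "\<forall>\<^sub>\<infinity>y. Q i y / (val ?T ?e (\<phi> i y) / G i y) = F (\<phi> i y) / val ?T ?e (\<phi> i y)"
          using glued_MOST[OF glued o UNIV_I t] by eventually_elim (simp add: F)
      qed (use t in \<open>simp add: F\<close>)
    qed
    let ?t = "smul L ?W (cut ?W (\<lambda>y. F y / val ?T ?e y)) (res L ?T ?W ?e)"
    have r: "res L ?T ?W ?e \<in> sec L ?W" using tr o e by (intro sec_res) auto
    have "val ?W ?t y = F y" if y: "y \<in> ?W" for y
      using val_smul[OF o r k y] val_res[OF tr(1) o _ e y] nz[OF y] y by (simp add: cut_def)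
    then show ?thesis
      using o x tr sec_smul[OF o k r] by (intro exI[of _ ?W] exI[of _ ?t]) auto
  qed
  obtain s where s: "s \<in> sec L U" "\<forall>x\<in>U. val U s x = F x"
    using section_glue_by_val[of U F, OF loc] by metis
  have "to_diff U s i = \<eta> i" for i
  proof -
    have "to_diff U s i = cut (smooth_dom U i) (\<eta> i)"
      unfolding to_diff_def
    proof (rule cut_eqI)
      fix t assume t: "t \<in> smooth_dom U i"
      then have "\<phi> i t \<in> U" by (simp add: smooth_dom_def)
      then show "val U s (\<phi> i t) / G i t / nodal_form i t = \<eta> i t"
        using s(2) F G_neq_0 unique[OF smooth[OF t]] smooth_dom_nodal[OF t] by simp
    qed
    also have "\<dots> = \<eta> i" using reg[of i] proj_reg_iff[OF smooth_dom_open[OF U]] by blast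
    finally show ?thesis .
  qed
  then show ?thesis using s by blast
qed

lemma iso_dualizing: "sheaf_iso X L (dualizing_sheaf X \<phi>)"
  unfolding sheaf_iso_def
proof (intro exI[of _ to_diff] conjI allI impI ballI; (elim conjE)?)
  fix U assume U: "opn U"
  have "to_diff U ` sec L U = sec (dualizing_sheaf X \<phi>) U"
  proof
    show "to_diff U ` sec L U \<subseteq> sec (dualizing_sheaf X \<phi>) U" using to_diff_in[OF U] by blast
    show "sec (dualizing_sheaf X \<phi>) U \<subseteq> to_diff U ` sec L U"
    proof
      fix \<eta> assume "\<eta> \<in> sec (dualizing_sheaf X \<phi>) U"
      then show "\<eta> \<in> to_diff U ` sec L U" using to_diff_surj[OF U] by blast
    qed
  qed
  then show "bij_betw (to_diff U) (sec L U) (sec (dualizing_sheaf X \<phi>) U)"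
    using to_diff_inj[OF U] by (simp add: bij_betw_def)
  fix s assume s: "s \<in> sec L U"
  {
    fix s' assume "s' \<in> sec L U"
    then show "to_diff U (s + s') = to_diff U s + to_diff U s'"
      using U s by (auto simp: to_diff_def cut_def smooth_dom_def fun_eq_iff val_add add_divide_distrib)
  next
    fix f assume "f \<in> reg X U"
    then show "to_diff U (smul L U f s) = smul (dualizing_sheaf X \<phi>) U f (to_diff U s)"
      using U s by (auto simp: to_diff_def cut_def smooth_dom_def fun_eq_iff val_smul dualizing_sheaf_def)
  next
    fix V assume V: "opn V" "V \<subseteq> U"
    then show "to_diff V (res L U V s) = res (dualizing_sheaf X \<phi>) U V (to_diff U s)"
      using U s by (auto simp: to_diff_def cut_def smooth_dom_def fun_eq_iff val_res dualizing_sheaf_def)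
  }
qed

end

end

section \<open>Clifford's inequality\<close>

context binary_bundle
begin

lemma section_zero_if_zero_on_component:
  assumes deg: "\<And>j. has_degree X L (\<phi> j) (m j)" "\<And>j. m j \<le> g"
    and s: "s \<in> sec L (pts X)" and zero: "\<And>t. val (pts X) s (\<phi> i t) = 0"
  shows "s = 0"
proof (rule section_eq_0[OF s])
  fix j t
  show "val (pts X) s (\<phi> j t) = 0"
  proof (rule section_zero_on_component[OF UNIV_I deg(1) s finite_nodes[of j]])
    show "m j < int (card (nodes j))" using deg(2)[of j] card_nodes[of j] by simp
    fix u assume "u \<in> nodes j"
    then obtain t' where "\<phi> j u = \<phi> i t'" using node_image by blast
    then show "val (pts X) s (\<phi> j u) = 0" using zero by simp
  qed
qed

lemma binary_h0_le:
  assumes "i \<noteq> j" "has_degree X L (\<phi> i) m" "has_degree X L (\<phi> j) n"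
  shows "h0 X L \<le> enat (nat (m + 1) + nat (n - g))"
proof -
  have "h0 X L \<le> enat (nat (m + 1) + nat (n + 1 - int (card (nodes j))))"
  proof (rule h0_le[OF UNIV_I UNIV_I assms(2,3) finite_nodes node_image])
    fix s assume s: "s \<in> sec L (pts X)" and "\<And>t. val (pts X) s (\<phi> i t) = 0"
      "\<And>t. val (pts X) s (\<phi> j t) = 0"
    moreover have "k = i \<or> k = j" for k using assms(1) by (metis comp.exhaust)
    ultimately show "s = 0" by (intro section_eq_0) metis+
  qed
  then show ?thesis using card_nodes[of j] by (simp add: algebra_simps)
qed

lemma section_vanishing_on:
  assumes Z: "finite Z" "Z \<subseteq> pts X" and "enat (card Z) < h0 X L"
  obtains s where "s \<in> sec L (pts X)" "s \<noteq> 0" "\<forall>x\<in>Z. val (pts X) s x = 0"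
  using h0_le_card[OF Z] assms(3) by (metis not_le)

lemma degree_0_trivial:
  assumes deg: "\<And>i. has_degree X L (\<phi> i) 0" and g: "0 \<le> g" and h0: "h0 X L = 1"
  shows "sheaf_iso X L (structure_sheaf X)"
proof -
  obtain s where s: "s \<in> sec L (pts X)" "s \<noteq> 0"
    using section_vanishing_on[of "{}"] h0 by (auto simp: zero_enat_def one_enat_def)
  show ?thesis
  proof (rule nowhere_zero_imp_trivial[OF s(1)])
    fix x assume "x \<in> pts X"
    then obtain i t where x: "x = \<phi> i t" using binary_pts[OF binary] by blast
    show "val (pts X) s x \<noteq> 0"
    proof
      assume "val (pts X) s x = 0"
      \<comment> \<open>In degree 0 a single zero makes the section vanish on its component, hence
        at the nodes, of which there is at least one.\<close>
      then have "val (pts X) s (\<phi> i y) = 0" for y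
        using section_zero_on_component[OF UNIV_I deg s(1), of "{t}" i y] x by simp
      then have "s = 0" using section_zero_if_zero_on_component[of "\<lambda>_. 0"] deg g s(1) by blast
      with s(2) show False ..
    qed
  qed
qed

lemma section_factor:
  assumes G: "trivialization i n G" and n: "0 \<le> n" and s: "s \<in> sec L (pts X)"
    and N: "finite N" "card N = nat n" "\<And>t. t \<in> N \<Longrightarrow> val (pts X) s (\<phi> i t) = 0"
  obtains \<alpha> where "\<forall>y. val (pts X) s (\<phi> i y) = G y * (\<alpha> * (\<Prod>z\<in>N. bracket y z))"
proof -
  obtain p where p: "degree p \<le> nat n" "n < 0 \<longrightarrow> p = 0"
    "\<forall>y. val (pts X) s (\<phi> i y) = G y * form_eval (nat n) p y"
    by (rule section_form[OF UNIV_I G s])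
  have "form_eval (card N) p t = 0" if "t \<in> N" for t
    using N(3)[OF that] p(3) G by (simp add: trivialization_def N(2))
  then obtain \<alpha> where "\<forall>y. form_eval (card N) p y = \<alpha> * (\<Prod>z\<in>N. bracket y z)"
    using form_factor[of p N] p(1) N by auto
  then show ?thesis using p(3) N(2) by (intro that[of \<alpha>]) simp
qed

text \<open>
  A section vanishing at all nodes but two is a multiple of a known form on each component, and the
  two values at each of the remaining nodes agree. This determines the ratio of the gluing data of
  the bundle at these nodes.
\<close>

lemma gluing_proportional:
  assumes deg: "\<And>i. has_degree X L (\<phi> i) (g - 1)" and g: "1 \<le> g" and h0: "h0 X L = enat (nat g)"
    and G: "\<And>i. trivialization i (g - 1) (G i)"
    and t: "\<phi> C1 t1 = \<phi> C2 t2" and u: "\<phi> C1 u1 = \<phi> C2 u2"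
  shows "G C1 t1 * nodal_deriv C1 t1 * (G C2 u2 * nodal_deriv C2 u2) =
    G C1 u1 * nodal_deriv C1 u1 * (G C2 t2 * nodal_deriv C2 t2)"
proof (cases "t1 = u1")
  case True
  then have "t2 = u2" using t u injD[OF inj_component[of C2]] by metis
  with True show ?thesis by simp
next
  case False
  then have ne2: "t2 \<noteq> u2" using t u injD[OF inj_component[of C1]] by metis
  have nodes: "t1 \<in> nodes C1" "u1 \<in> nodes C1" "t2 \<in> nodes C2" "u2 \<in> nodes C2"
    using nodesI[OF t] nodesI[OF u] by auto
  \<comment> \<open>These are g - 1 nodes: one fewer than \<open>h0\<close>, so a nonzero section
    vanishes at them, and as many as the degree, so such a section is known up to a factor on each
    component.\<close>
  define N1 N2 where "N1 = nodes C1 - {t1, u1}" and "N2 = nodes C2 - {t2, u2}"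
  have card: "card (nodes i - {a, b}) = nat (g - 1)" if "a \<in> nodes i" "b \<in> nodes i" "a \<noteq> b" for i a b
  proof -
    have "card (nodes i - {a, b}) = card (nodes i) - card {a, b}"
      using that by (intro card_Diff_subset) auto
    then show ?thesis using that card_nodes[of i] g by simp
  qed
  have N: "finite N1" "finite N2" "card N1 = nat (g - 1)" "card N2 = nat (g - 1)"
    using card nodes False ne2 by (auto simp: N1_def N2_def finite_nodes)
  have "card (\<phi> C1 ` N1) = nat (g - 1)" using N(3) card_image[OF inj_on_subset[OF inj_component]] by (metis subset_UNIV)
  then obtain s where s: "s \<in> sec L (pts X)" "s \<noteq> 0" "\<forall>x\<in>\<phi> C1 ` N1. val (pts X) s x = 0"
    using section_vanishing_on[of "\<phi> C1 ` N1"] N(1) in_pts h0 g by auto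
  have z1: "val (pts X) s (\<phi> C1 y) = 0" if "y \<in> N1" for y using s(3) that by blast
  have z2: "val (pts X) s (\<phi> C2 y) = 0" if "y \<in> N2" for y
  proof -
    have "y \<in> nodes C2" "y \<noteq> t2" "y \<noteq> u2" using that by (auto simp: N2_def)
    moreover then obtain y' where y': "\<phi> C2 y = \<phi> C1 y'" using node_image by blast
    ultimately have "y' \<in> N1"
      using t u nodesI[OF y'[symmetric]] injD[OF inj_component[of C2]] by (auto simp: N1_def)
    then show ?thesis using z1 y' by simp
  qed
  have n: "0 \<le> g - 1" using g by simp
  obtain \<alpha> where \<alpha>: "\<forall>y. val (pts X) s (\<phi> C1 y) = G C1 y * (\<alpha> * (\<Prod>z\<in>N1. bracket y z))"
    by (rule section_factor[OF G n s(1) N(1,3) z1])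
  obtain \<beta> where \<beta>: "\<forall>y. val (pts X) s (\<phi> C2 y) = G C2 y * (\<beta> * (\<Prod>z\<in>N2. bracket y z))"
    by (rule section_factor[OF G n s(1) N(2,4) z2])
  have nz: "\<alpha> \<noteq> 0"
  proof
    assume "\<alpha> = 0"
    then have "val (pts X) s (\<phi> C1 y) = 0" for y using \<alpha> by simp
    then have "s = 0" using section_zero_if_zero_on_component[of "\<lambda>_. g - 1"] deg s(1) by force
    with s(2) show False ..
  qed
  \<comment> \<open>The factor of the other node is \<open>bracket t1 u1\<close> in one derivative
    and \<open>bracket u1 t1\<close> in the other. This change of sign occurs on both components and
    cancels in \<open>B\<close>.\<close>
  have d1: "nodal_deriv C1 t1 = bracket t1 u1 * (\<Prod>z\<in>N1. bracket t1 z)"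
    "nodal_deriv C1 u1 = bracket u1 t1 * (\<Prod>z\<in>N1. bracket u1 z)"
  proof -
    have "nodes C1 - {t1} = insert u1 N1" "nodes C1 - {u1} = insert t1 N1" "u1 \<notin> N1" "t1 \<notin> N1"
      using nodes False by (auto simp: N1_def)
    then show "nodal_deriv C1 t1 = bracket t1 u1 * (\<Prod>z\<in>N1. bracket t1 z)"
      "nodal_deriv C1 u1 = bracket u1 t1 * (\<Prod>z\<in>N1. bracket u1 z)"
      using N by (simp_all add: nodal_deriv_def)
  qed
  have d2: "nodal_deriv C2 t2 = bracket t2 u2 * (\<Prod>z\<in>N2. bracket t2 z)"
    "nodal_deriv C2 u2 = bracket u2 t2 * (\<Prod>z\<in>N2. bracket u2 z)"
  proof -
    have "nodes C2 - {t2} = insert u2 N2" "nodes C2 - {u2} = insert t2 N2" "u2 \<notin> N2" "t2 \<notin> N2"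
      using nodes ne2 by (auto simp: N2_def)
    then show "nodal_deriv C2 t2 = bracket t2 u2 * (\<Prod>z\<in>N2. bracket t2 z)"
      "nodal_deriv C2 u2 = bracket u2 t2 * (\<Prod>z\<in>N2. bracket u2 z)"
      using N by (simp_all add: nodal_deriv_def)
  qed
  let ?K1 = "\<lambda>y. G C1 y * nodal_deriv C1 y" and ?K2 = "\<lambda>y. G C2 y * nodal_deriv C2 y"
  let ?a = "bracket t1 u1" and ?b = "bracket t2 u2"
  have eqt: "G C1 t1 * (\<alpha> * (\<Prod>z\<in>N1. bracket t1 z)) = G C2 t2 * (\<beta> * (\<Prod>z\<in>N2. bracket t2 z))"
    using \<alpha> \<beta> t by metis
  have equ: "G C1 u1 * (\<alpha> * (\<Prod>z\<in>N1. bracket u1 z)) = G C2 u2 * (\<beta> * (\<Prod>z\<in>N2. bracket u2 z))"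
    using \<alpha> \<beta> u by metis
  have A: "?K1 t1 * (\<alpha> * ?b) = ?K2 t2 * (\<beta> * ?a)"
  proof -
    have "?K1 t1 * (\<alpha> * ?b) = (G C1 t1 * (\<alpha> * (\<Prod>z\<in>N1. bracket t1 z))) * (?a * ?b)"
      by (simp add: d1 mult_ac)
    also have "\<dots> = ?K2 t2 * (\<beta> * ?a)" unfolding eqt by (simp add: d2 mult_ac)
    finally show ?thesis .
  qed
  have B: "?K1 u1 * (\<alpha> * ?b) = ?K2 u2 * (\<beta> * ?a)"
  proof -
    have "?K1 u1 * (\<alpha> * ?b) = - ((G C1 u1 * (\<alpha> * (\<Prod>z\<in>N1. bracket u1 z))) * (?a * ?b))"
      using bracket_commute[of u1 t1] by (simp add: d1 mult_ac)
    also have "\<dots> = ?K2 u2 * (\<beta> * ?a)" unfolding equ using bracket_commute[of u2 t2] by (simp add: d2 mult_ac)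
    finally show ?thesis .
  qed
  \<comment> \<open>\<open>A\<close> and \<open>B\<close> give the same ratio at both nodes;
    combining them eliminates the unknown \<open>\<beta>\<close>, and the nonzero
    \<open>\<alpha> * ?b\<close> cancels.\<close>
  have "(?K1 t1 * ?K2 u2) * (\<alpha> * ?b) = (?K1 t1 * (\<alpha> * ?b)) * ?K2 u2" by (simp only: mult_ac)
  also have "\<dots> = ?K2 t2 * (?K2 u2 * (\<beta> * ?a))" unfolding A by (simp only: mult_ac)
  also have "\<dots> = (?K1 u1 * ?K2 t2) * (\<alpha> * ?b)" unfolding B[symmetric] by (simp only: mult_ac)
  finally show ?thesis using nz ne2 by simp
qed

lemma canonical_degree_dualizing:
  assumes deg: "\<And>i. has_degree X L (\<phi> i) (g - 1)" and g: "1 \<le> g" and h0: "h0 X L = enat (nat g)"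
  shows "sheaf_iso X L (dualizing_sheaf X \<phi>)"
proof -
  have "\<exists>G. trivialization i (g - 1) G" for i by (rule degree_trivialization[OF UNIV_I deg])
  then obtain G where G: "\<And>i. trivialization i (g - 1) (G i)" by metis
  have "nodes C1 \<noteq> {}" using card_nodes[of C1] g by auto
  then obtain t1 where "t1 \<in> nodes C1" by blast
  then obtain t2 where t: "\<phi> C1 t1 = \<phi> C2 t2" using node_image by blast
  let ?K = "\<lambda>i y. G i y * nodal_deriv i y"
  have nz: "?K i y \<noteq> 0" for i y using G[of i] by (simp add: trivialization_def nodal_deriv_neq_0)
  \<comment> \<open>A trivialization may be rescaled on each component. This constant enforces the
    residue condition at one node, and \<open>gluing_proportional\<close> carries it over to all
    others.\<close>
  define c where "c = (case_comp 1 (- (?K C1 t1 / ?K C2 t2)))"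
  have c: "c i \<noteq> 0" for i using nz by (cases i) (auto simp: c_def)
  define H where "H i y = c i * G i y" for i y
  show ?thesis
  proof (rule iso_dualizing[of H])
    show "trivialization i (g - 1) (H i)" for i
      unfolding trivialization_def
    proof (intro conjI allI impI)
      show "H i t \<noteq> 0" for t using c[of i] G[of i] by (simp add: H_def trivialization_def)
      fix U s t assume "opn U" "s \<in> sec L U" "\<phi> i t \<in> U"
      then have "oreg (g - 1) (\<lambda>y. val U s (\<phi> i y) / G i y) t"
        using G[of i] by (simp add: trivialization_def)
      then have "oreg (g - 1) (\<lambda>y. inverse (c i) * (val U s (\<phi> i y) / G i y)) t" by (rule oreg_cmult)
      then show "oreg (g - 1) (\<lambda>y. val U s (\<phi> i y) / H i y) t"
        by (simp add: H_def divide_inverse mult_ac)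
    qed
    fix u1 u2 assume u: "\<phi> C1 u1 = \<phi> C2 u2"
    have "?K C1 t1 * ?K C2 u2 = ?K C1 u1 * ?K C2 t2"
      by (rule gluing_proportional[OF deg g h0 G t u])
    then have "?K C1 u1 = ?K C1 t1 / ?K C2 t2 * ?K C2 u2" using nz[of C2 t2] by (simp add: field_simps)
    then show "H C1 u1 * nodal_deriv C1 u1 = - (H C2 u2 * nodal_deriv C2 u2)"
      by (simp add: H_def c_def mult.assoc)
  qed
qed

end

section \<open>Balanced degrees and the bound on blow-ups\<close>

lemma balanced_iff:
  "balanced g d \<longleftrightarrow> (\<forall>i. total_degree d - g - 1 \<le> 2 * d i \<and> 2 * d i \<le> total_degree d + g + 1)"
proof -
  have "(real_of_int (total_degree d) - g - 1) / 2 \<le> d i \<longleftrightarrow>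
      real_of_int (total_degree d - g - 1) \<le> real_of_int (2 * d i)"
    and "d i \<le> (real_of_int (total_degree d) + g + 1) / 2 \<longleftrightarrow>
      real_of_int (2 * d i) \<le> real_of_int (total_degree d + g + 1)" for i
    by (simp_all add: field_simps)
  then show ?thesis unfolding balanced_def of_int_le_iff by simp
qed

lemma strictly_balanced_iff:
  "strictly_balanced g d \<longleftrightarrow> (\<forall>i. total_degree d - g - 1 < 2 * d i \<and> 2 * d i < total_degree d + g + 1)"
proof -
  have "(real_of_int (total_degree d) - g - 1) / 2 < d i \<longleftrightarrow>
      real_of_int (total_degree d - g - 1) < real_of_int (2 * d i)"
    and "d i < (real_of_int (total_degree d) + g + 1) / 2 \<longleftrightarrow>
      real_of_int (2 * d i) < real_of_int (total_degree d + g + 1)" for i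
    by (simp_all add: field_simps)
  then show ?thesis unfolding strictly_balanced_def of_int_less_iff by simp
qed

lemma total_degree_eq: "i \<noteq> j \<Longrightarrow> total_degree d = d i + d j"
  by (cases i; cases j) auto

lemma ordered_components:
  obtains i j :: comp where "i \<noteq> j" "(d i :: int) \<le> d j"
  by (metis comp.distinct(1) linear)

lemma enat_le_half:
  assumes "h \<le> enat N" "2 * int N \<le> d + 2"
  shows "ereal_of_enat h \<le> ereal (real_of_int d / 2 + 1)"
proof -
  have "ereal_of_enat h \<le> ereal_of_enat (enat N)" using assms(1) by (simp only: ereal_of_enat_le_iff)
  also have "\<dots> \<le> ereal (real_of_int d / 2 + 1)" using assms(2) by simp
  finally show ?thesis .
qed

lemma blowup_h0_le:
  fixes L :: "(('p, 'k::alg_closed_field) bpoint, 'k, 'm::ab_group_add) mod_sheaf"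
  assumes X: "binary_curve X \<phi> g" and L: "blowup_bundle \<phi> S e L" and ij: "i \<noteq> j"
  shows "h0 (blowup \<phi> S) L \<le> enat (nat (e i + 1) + nat (e j - (g - int (card S))))"
proof -
  let ?I = "range Strict \<union> Exceptional ` S" and ?\<psi> = "blowup_map \<phi> S"
  have S: "S \<subseteq> sing \<phi>" and inv: "invertible_sheaf (blowup \<phi> S) L"
    and deg: "\<And>i. has_degree (blowup \<phi> S) L (?\<psi> (Strict i)) (e i)"
    and deg1: "\<And>P. P \<in> S \<Longrightarrow> has_degree (blowup \<phi> S) L (?\<psi> (Exceptional P)) 1"
    using L by (auto simp: blowup_bundle_def)
  have glued: "glued_from (blowup \<phi> S) ?I ?\<psi>" unfolding blowup_def by (rule glued_curve_glued_from)
  interpret glued_bundle "blowup \<phi> S" L ?I ?\<psi>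
    by unfold_locales (fact glued_space_with_functions[OF glued] inv glued)+
  have inj: "inj (\<phi> k)" for k by (rule binary_inj[OF X])
  have fin: "finite (sing \<phi>)" by (rule binary_finite_sing[OF X])
  have sub: "sing \<phi> \<subseteq> range (\<phi> k)" for k by (cases k) (auto simp: sing_def)
  \<comment> \<open>Only the nodes outside \<open>S\<close> still join the two strict components
    directly.\<close>
  let ?Q = "\<phi> j -` (sing \<phi> - S)"
  have "card ?Q = card (sing \<phi> - S)" using sub[of j] by (intro card_vimage_inj inj) auto
  also have "int \<dots> = g + 1 - int (card S)"
    using binary_card_sing[OF X] card_mono[OF fin S] finite_subset[OF S fin] S
    by (simp add: card_Diff_subset of_nat_diff)
  finally have Q: "int (card ?Q) = g + 1 - int (card S)" .
  have "h0 (blowup \<phi> S) L \<le> enat (nat (e i + 1) + nat (e j + 1 - int (card ?Q)))"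
  proof (rule h0_le[OF _ _ deg deg])
    show "finite ?Q" using fin by (intro finite_vimageI inj) auto
    fix t assume t: "t \<in> ?Q"
    then have "\<phi> j t \<in> range (\<phi> i)" using sub[of i] by auto
    then obtain t' where "\<phi> j t = \<phi> i t'" by (rule rangeE)
    then have "?\<psi> (Strict j) t = ?\<psi> (Strict i) t'" using t by (simp add: norm_map_def)
    then show "?\<psi> (Strict j) t \<in> range (?\<psi> (Strict i))" by blast
  next
    fix s assume s: "s \<in> sec L (pts (blowup \<phi> S))"
      and zero: "\<And>t. val (pts (blowup \<phi> S)) s (?\<psi> (Strict i) t) = 0"
        "\<And>t. val (pts (blowup \<phi> S)) s (?\<psi> (Strict j) t) = 0"
    have strict: "val (pts (blowup \<phi> S)) s (?\<psi> (Strict k) t) = 0" for k t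
    proof -
      consider "k = i" | "k = j" using ij by (cases i; cases j; cases k) auto
      then show ?thesis by cases (simp_all only: zero)
    qed
    have exc: "val (pts (blowup \<phi> S)) s (?\<psi> (Exceptional P) t) = 0" if P: "P \<in> S" for P t
    proof (rule section_zero_on_component[OF _ deg1[OF P] s, of "{Aff 0, Infty}"])
      \<comment> \<open>The points \<open>Aff 0\<close> and \<open>Infty\<close> of the exceptional
        line are the points over \<open>P\<close> on the two strict components. Two zeros exceed the
        degree 1.\<close>
      have *: "val (pts (blowup \<phi> S)) s (Branch k P) = 0" for k
      proof -
        have "P \<in> range (\<phi> k)" using P S sub[of k] by auto
        then obtain u where "P = \<phi> k u" by (rule rangeE)
        then have "?\<psi> (Strict k) u = Branch k P" using P by (simp add: norm_map_def)
        with strict[of k u] show ?thesis by (simp only:)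
      qed
      fix u assume "u \<in> {Aff 0 :: 'k proj_line, Infty}"
      then show "val (pts (blowup \<phi> S)) s (?\<psi> (Exceptional P) u) = 0"
        using *[of C1] *[of C2] by (elim insertE emptyE) simp_all
    qed (use P in auto)
    show "s = 0"
    proof (rule section_eq_by_val[OF _ s])
      fix x assume x: "x \<in> pts (blowup \<phi> S)"
      then have "x \<in> (\<Union>c\<in>?I. range (?\<psi> c))" unfolding glued_pts[OF glued] .
      then have "val (pts (blowup \<phi> S)) s x = 0"
        by (elim UN_E UnE imageE rangeE) (simp_all only: strict exc)
      then show "val (pts (blowup \<phi> S)) s x = val (pts (blowup \<phi> S)) 0 x" using x by (simp add: val_0)
    qed (use sec_0 in auto)
  qed auto
  moreover have "e j + 1 - int (card ?Q) = e j - (g - int (card S))" using Q by simp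
  ultimately show ?thesis by simp
qed

text \<open>The condition on the difference is balancedness on the partial normalization, of genus
  \<open>g - int (card S)\<close>. Allowing equality includes the additional point
  \<open>ell0\<close>.\<close>

lemma blowup_clifford:
  fixes L :: "(('p, 'k::alg_closed_field) bpoint, 'k, 'm::ab_group_add) mod_sheaf"
  assumes X: "binary_curve X \<phi> g" and d: "0 \<le> d" "d \<le> 2 * g" and L: "blowup_bundle \<phi> S e L"
    and e: "total_degree e + int (card S) = d" "\<bar>e C1 - e C2\<bar> \<le> g + 1 - int (card S)"
  shows "ereal_of_enat (h0 (blowup \<phi> S) L) \<le> ereal (real_of_int d / 2 + 1)"
proof -
  obtain i j where ij: "i \<noteq> j" "e i \<le> e j" by (rule ordered_components)
  have t: "e i + e j = d - int (card S)" using e(1) total_degree_eq[OF ij(1), of e] by simp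
  have b: "e j - e i \<le> g + 1 - int (card S)" using e(2) ij by (cases i; cases j) auto
  let ?N = "nat (e i + 1) + nat (e j - (g - int (card S)))"
  \<comment> \<open>If both summands count, \<open>?N\<close> is d + 1 - g and d \<le> 2 g is used.
    If only the first does, it is at most half the total degree plus 1, as \<open>e i\<close> is the
    smaller degree. If only the second does, balancedness bounds \<open>e j\<close>.\<close>
  have "2 * int ?N \<le> d + 2" using t b ij(2) d by (cases "e i < 0"; cases "e j < g - int (card S)") auto
  then show ?thesis by (rule enat_le_half[OF blowup_h0_le[OF X L ij(1)]])
qed

theorem proposition13:
  fixes X :: "('p, 'k::alg_closed_field) fspace"
    and \<phi> :: "comp \<Rightarrow> 'k proj_line \<Rightarrow> 'p"
    and g d :: int
  assumes "binary_curve X \<phi> g"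
    and "1 \<le> g"
    and "0 \<le> d" and "d \<le> 2 * g"
  shows "(\<forall>md. balanced g md \<and> total_degree md = d \<longrightarrow>
            (\<forall>L :: ('p, 'k, 'm::ab_group_add) mod_sheaf. L \<in> Pic X \<phi> md \<longrightarrow>
                ereal_of_enat (h0 X L) \<le> ereal (d / 2 + 1)
              \<and> (d = 0 \<and> h0 X L = 1 \<longrightarrow> sheaf_iso X L (structure_sheaf X))
              \<and> (d = 2 * g - 2 \<and> h0 X L = enat (nat g) \<longrightarrow> sheaf_iso X L (dualizing_sheaf X \<phi>))))
       \<and> (2 \<le> g \<longrightarrow>
            (\<forall>c \<in> (compactified_picard \<phi> g d
                   :: ('p set \<times> (('p, 'k) bpoint, 'k, 'n::ab_group_add) mod_sheaf) set set).
               \<forall>(S, L) \<in> c. ereal_of_enat (h0 (blowup \<phi> S) L) \<le> ereal (d / 2 + 1)))"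
proof (intro conjI allI impI ballI; (elim conjE)?)
  fix md and L :: "('p, 'k, 'm) mod_sheaf"
  assume bal: "balanced g md" and md: "total_degree md = d" and L: "L \<in> Pic X \<phi> md"
  have inv: "invertible_sheaf X L" and deg: "\<And>i. has_degree X L (\<phi> i) (md i)"
    using L by (auto simp: Pic_def)
  interpret binary_bundle X L \<phi> g
    by unfold_locales (fact binary_space[OF assms(1)] inv binary_glued[OF assms(1)] assms(1))+
  obtain i j where ij: "i \<noteq> j" "md i \<le> md j" by (rule ordered_components)
  have t: "md i + md j = d" using md total_degree_eq[OF ij(1), of md] by simp
  have b: "2 * md j \<le> d + g + 1" using bal md by (simp add: balanced_iff)
  have all: "k = i \<or> k = j" for k using ij(1) by (cases i; cases j; cases k) auto
  let ?N = "nat (md i + 1) + nat (md j - g)"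
  have h: "h0 X L \<le> enat ?N" by (rule binary_h0_le[OF ij(1) deg deg])
  have "2 * int ?N \<le> d + 2" using t b ij(2) assms by (cases "md i < 0"; cases "md j < g") auto
  then show "ereal_of_enat (h0 X L) \<le> ereal (d / 2 + 1)" by (rule enat_le_half[OF h])
  {
    assume d: "d = 0" and h0: "h0 X L = 1"
    have "1 \<le> ?N" using h by (simp add: h0 one_enat_def)
    \<comment> \<open>In a bidegree (-a, a) with a > 0 balancedness gives 2 a \<le> g + 1, so a
      \<le> g and the bound would be 0.\<close>
    then have "md i = 0 \<and> md j = 0"
      using t b ij(2) assms d by (cases "md i < 0"; cases "md j < g") auto
    then have "has_degree X L (\<phi> k) 0" for k using deg[of k] all[of k] by auto
    then show "sheaf_iso X L (structure_sheaf X)"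
      by (rule degree_0_trivial[OF _ _ h0]) (use assms in simp)
  next
    assume d: "d = 2 * g - 2" and h0: "h0 X L = enat (nat g)"
    have "nat g \<le> ?N" using h by (simp add: h0)
    \<comment> \<open>If \<open>md j\<close> were at least g, the bound would be at most g - 1:
      equal to it when \<open>md i\<close> is nonnegative, and at most (g - 1) / 2 by balancedness
      otherwise.\<close>
    then have "md i = g - 1 \<and> md j = g - 1"
      using t b ij(2) assms d by (cases "md i < 0"; cases "md j < g") auto
    then have "has_degree X L (\<phi> k) (g - 1)" for k using deg[of k] all[of k] by auto
    then show "sheaf_iso X L (dualizing_sheaf X \<phi>)"
      by (rule canonical_degree_dualizing[OF _ assms(2) h0])
  }
next
  fix c :: "('p set \<times> (('p, 'k) bpoint, 'k, 'n) mod_sheaf) set" and p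
  assume c: "c \<in> compactified_picard \<phi> g d" and p: "p \<in> c"
  obtain S L where SL: "p = (S, L)" by (cases p)
  have "\<exists>e. blowup_bundle \<phi> S e L \<and> total_degree e + int (card S) = d \<and>
    \<bar>e C1 - e C2\<bar> \<le> g + 1 - int (card S)"
  proof (cases "c \<in> strictly_balanced_bundles \<phi> g d // bundle_equiv \<phi> g d")
    case True
    \<comment> \<open>The equivalence relates only strictly balanced bundles, so every member of a
      class has the required degrees itself.\<close>
    then have "(S, L) \<in> strictly_balanced_bundles \<phi> g d"
      using p SL by (auto simp: quotient_def bundle_equiv_def)
    then obtain e where "blowup_bundle \<phi> S e L" "total_degree e + int (card S) = d"
      "strictly_balanced (g - int (card S)) e" by (auto simp: strictly_balanced_bundles_def)
    moreover from this(3) have "\<bar>e C1 - e C2\<bar> \<le> g + 1 - int (card S)"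
      unfolding strictly_balanced_iff by (auto dest: spec[of _ C1])
    ultimately show ?thesis by blast
  next
    case False
    then obtain m where m: "c = ell0 \<phi> m" "2 * m = d - g - 1" using c by (auto simp: compactified_picard_def)
    then have "S = sing \<phi>" "blowup_bundle \<phi> S (\<lambda>_. m) L" using p SL by (auto simp: ell0_def)
    \<comment> \<open>All g + 1 nodes are blown up, so the permitted difference is 0, matching the
      equal degrees m, and the total degree is 2 m + g + 1 = d.\<close>
    then show ?thesis using m(2) binary_card_sing[OF assms(1)] by (intro exI[of _ "\<lambda>_. m"]) simp
  qed
  then obtain e where "blowup_bundle \<phi> S e L" "total_degree e + int (card S) = d"
    "\<bar>e C1 - e C2\<bar> \<le> g + 1 - int (card S)" by blast
  then show "case p of (S, L) \<Rightarrow> ereal_of_enat (h0 (blowup \<phi> S) L) \<le> ereal (d / 2 + 1)"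
    using blowup_clifford[OF assms(1,3,4)] SL by simp
qed

end
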